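(* Let $K$ be a field and $n\ge 3$. Then every $\mathrm{Ind}$-scheme automorphism $\varphi$ of the group $\mathrm{NAut}(K[x_1,\dots,x_n])$ of nice automorphisms is inner, i.e. it is conjugation by some automorphism of $K[x_1,\dots,x_n]$: there is an automorphism $g$ with $\varphi(f)=g f g^{-1}$ for all $f\in \mathrm{NAut}(K[x_1,\dots,x_n])$.
   Context: $\mathrm{Aut}(K[x_1,\dots,x_n])$ is the group of $K$-algebra automorphisms of the polynomial algebra. An automorphism is elementary if, for some $i$, it has the form $x_i\mapsto x_i+P$, $x_j\mapsto x_j$ ($j\ne i$), with $P$ a polynomial not involving $x_i$. The tame automorphism group $\mathrm{TAut}$ is the subgroup generated by linear and elementary automorphisms. An automorphism $\varphi\in \mathrm{Aut}(K[x_1,\dots,x_n])$ is nice if for every $m$ there exist $\psi_m\in\mathrm{Aut}(K[x_1,\dots,x_n])$ and $\phi_m\in \mathrm{TAut}(K[x_1,\dots,x_n])$ such that $\varphi=\psi_m\phi_m$ and $\psi_m(x_i)\equiv x_i \bmod (x_1,\dots,x_n)^m$ for all $i$. $\mathrm{NAut}(K[x_1,\dots,x_n])$ is the group of nice automorphisms. An $\mathrm{Ind}$-variety $M$ is a direct limit of algebraic varieties $M_1\subseteq M_2\subseteq\cdots$. An $\mathrm{Ind}$-scheme (Ind-group) is an $\mathrm{Ind}$-variety which is a group such that inversion is a morphism $M_i\to M_{j(i)}$ and multiplication induces morphisms $M_i\times M_j\to M_{k(i,j)}$. A map $\varphi: M\to N$ of $\mathrm{Ind}$-varieties is a morphism if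 for each $i$ there is $j(i)$ with $\varphi(M_i)\subseteq N_{j(i)}$ and $\varphi|_{M_i}$ is a morphism of varieties. Automorphism groups are given the $\mathrm{Ind}$-structure in which $M_j$ is the set of automorphisms of degree $\le j$ (subgroups carry the induced structure). An $\mathrm{Ind}$-scheme automorphism is a group automorphism which is an isomorphism of $\mathrm{Ind}$-varieties. *)

theory Defs
  imports
    "HOL-Library.Poly_Mapping"
    "HOL-Library.Cardinality"
    "HOL-Algebra.Algebraic_Closure_Type"
    "HOL-Algebra.Generated_Groups"
begin

section \<open>Polynomial algebras\<close>

text \<open>\<open>('v, 'k) pol\<close> is the polynomial algebra over \<open>'k\<close> in the variables indexed by \<open>'v\<close>.\<close>

type_synonym ('v, 'k) pol = "('v \<Rightarrow>\<^sub>0 nat) \<Rightarrow>\<^sub>0 'k"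

definition pconst :: "'k::comm_ring_1 \<Rightarrow> ('v, 'k) pol"
  where "pconst c = Poly_Mapping.single 0 c"

definition pvar :: "'v \<Rightarrow> ('v, 'k::comm_ring_1) pol"
  where "pvar i = Poly_Mapping.single (Poly_Mapping.single i 1) 1"

definition mon_degree :: "('v::finite \<Rightarrow>\<^sub>0 nat) \<Rightarrow> nat"
  where "mon_degree m = (\<Sum>i\<in>UNIV. Poly_Mapping.lookup m i)"

text \<open>Substitute \<open>a v\<close> for the variable \<open>v\<close>, mapping coefficients into the target by \<open>h\<close>.\<close>

definition pol_eval :: "('k \<Rightarrow> 'b) \<Rightarrow> ('v \<Rightarrow> 'b) \<Rightarrow> ('v, 'k::comm_ring_1) pol \<Rightarrow> 'b::comm_ring_1"
  where "pol_eval h a p = (\<Sum>m\<in>Poly_Mapping.keys p. h (Poly_Mapping.lookup p m) *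
           (\<Prod>v\<in>Poly_Mapping.keys m. a v ^ Poly_Mapping.lookup m v))"

lemma pol_eval_pconst: "h 0 = 0 \<Longrightarrow> pol_eval h a (pconst c) = h c"
  by (auto simp: pol_eval_def pconst_def)

lemma pol_eval_pvar: "h 1 = 1 \<Longrightarrow> pol_eval h a (pvar i) = a i"
  by (auto simp: pol_eval_def pvar_def)

definition ideal_span :: "'a::comm_ring_1 set \<Rightarrow> 'a set"
  where "ideal_span S = Modules.module.span (*) S"

lemma module_mult: "Modules.module ((*) :: 'a::comm_ring_1 \<Rightarrow> 'a \<Rightarrow> 'a)"
  by unfold_locales (simp_all add: algebra_simps)

lemma ideal_span_explicit:
  "ideal_span S = {(\<Sum>a\<in>t. r a * a) | t r. finite t \<and> t \<subseteq> S}"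
  unfolding ideal_span_def by (rule Modules.module.span_explicit[OF module_mult])

definition ideal_power :: "'a::comm_ring_1 set \<Rightarrow> nat \<Rightarrow> 'a set"
  where "ideal_power I m = ideal_span {(\<Prod>k<m. a k) | a. \<forall>k<m. a k \<in> I}"


section \<open>Polynomial automorphisms\<close>

type_synonym ('v, 'k) endo = "('v, 'k) pol \<Rightarrow> ('v, 'k) pol"

definition alg_aut :: "('v, 'k::field) endo set"
  where "alg_aut = {f. bij f \<and> (\<forall>p q. f (p + q) = f p + f q) \<and> (\<forall>p q. f (p * q) = f p * f q)
                       \<and> (\<forall>c. f (pconst c) = pconst c)}"

definition AutG :: "('v, 'k::field) endo monoid"
  where "AutG = \<lparr>carrier = alg_aut, monoid.mult = (\<circ>), one = id\<rparr>"

lemma group_AutG: "group (AutG :: ('v, 'k::field) endo monoid)"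
proof (rule groupI)
  fix f :: "('v, 'k) endo" assume "f \<in> carrier AutG"
  then have f: "f \<in> alg_aut" by (simp add: AutG_def)
  define g where "g = inv_into UNIV f"
  have fg: "f (g p) = p" and gf: "g (f p) = p" for p
    using f by (simp_all add: g_def alg_aut_def bij_def surj_f_inv_f)
  have "g (p + q) = g p + g q" "g (p * q) = g p * g q" "g (pconst c) = pconst c" for p q c
    using f unfolding alg_aut_def mem_Collect_eq by (metis fg gf)+
  moreover have "bij g"
    using f by (simp add: g_def alg_aut_def bij_imp_bij_inv)
  ultimately have "g \<in> alg_aut" by (simp add: alg_aut_def)
  moreover have "g \<circ> f = id" by (auto simp: gf)
  ultimately show "\<exists>g\<in>carrier AutG. g \<otimes>\<^bsub>AutG\<^esub> f = \<one>\<^bsub>AutG\<^esub>"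
    by (auto simp: AutG_def)
qed (auto simp: AutG_def alg_aut_def bij_comp o_assoc)

definition linear_auts :: "('v::finite, 'k::field) endo set"
  where "linear_auts = {f \<in> alg_aut. \<exists>a. \<forall>i. f (pvar i) = (\<Sum>j\<in>UNIV. pconst (a i j) * pvar j)}"

definition elementary_auts :: "('v, 'k::field) endo set"
  where "elementary_auts = {f \<in> alg_aut. \<exists>i P.
           (\<forall>m\<in>Poly_Mapping.keys P. Poly_Mapping.lookup m i = 0) \<and>
           f (pvar i) = pvar i + P \<and> (\<forall>j. j \<noteq> i \<longrightarrow> f (pvar j) = pvar j)}"

definition TAut :: "('v::finite, 'k::field) endo set"
  where "TAut = generate AutG (linear_auts \<union> elementary_auts)"

definition NAut :: "('v::finite, 'k::field) endo set"
  where "NAut = {f \<in> alg_aut. \<forall>m. \<exists>\<psi>\<in>alg_aut. \<exists>\<tau>\<in>TAut. f = \<psi> \<circ> \<tau> \<and>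
           (\<forall>i. \<psi> (pvar i) - pvar i \<in> ideal_power (ideal_span (pvar ` UNIV)) m)}"

definition NAutG :: "('v::finite, 'k::field) endo monoid"
  where "NAutG = AutG\<lparr>carrier := NAut\<rparr>"


section \<open>Ind-varieties over a field\<close>

text \<open>
  A variety over the field \<open>'k\<close> (a reduced \<open>'k\<close>-scheme, which need not have enough \<open>'k\<close>-rational
  points) is represented by its points over the algebraic closure of \<open>'k\<close>: a set \<open>A\<close> of points
  with an affine coordinate function \<open>\<chi>\<close>. A function is regular over \<open>'k\<close> if, Zariski-locally
  on \<open>A\<close>, it is a quotient of polynomials in the coordinates with coefficients in \<open>'k\<close>. The
  coordinate family may be infinite; each polynomial involves only finitely many coordinates, and
  in the application below only finitely many of them are nonzero on a given \<open>A\<close>.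

  Testing regularity on \<open>'k\<close>-rational points only would be wrong for finite \<open>'k\<close>: there every
  map between sets of rational points is polynomial, so for instance the action of the Frobenius of
  the field of four elements on coefficients would count as an automorphism.
\<close>

definition regular_on ::
  "('p \<Rightarrow> 'w \<Rightarrow> 'k alg_closure) \<Rightarrow> 'p set \<Rightarrow> ('p \<Rightarrow> 'k::field alg_closure) \<Rightarrow> bool"
  where "regular_on \<chi> A h \<longleftrightarrow>
    (\<forall>p\<in>A. \<exists>P Q :: ('w, 'k) pol. pol_eval to_ac (\<chi> p) Q \<noteq> 0 \<and>
       (\<forall>q\<in>A. pol_eval to_ac (\<chi> q) Q \<noteq> 0 \<longrightarrow>
          h q = pol_eval to_ac (\<chi> q) P / pol_eval to_ac (\<chi> q) Q))"

definition variety_morphism ::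
  "('p \<Rightarrow> 'w \<Rightarrow> 'k alg_closure) \<Rightarrow> 'p set \<Rightarrow>
   ('q \<Rightarrow> 'u \<Rightarrow> 'k::field alg_closure) \<Rightarrow> 'q set \<Rightarrow> ('p \<Rightarrow> 'q) \<Rightarrow> bool"
  where "variety_morphism \<chi> A \<chi>' B F \<longleftrightarrow>
    F ` A \<subseteq> B \<and> (\<forall>u. regular_on \<chi> A (\<lambda>p. \<chi>' (F p) u))"

text \<open>An Ind-variety is given by its filtration \<open>M 0 \<subseteq> M 1 \<subseteq> \<dots>\<close>.\<close>

definition ind_morphism ::
  "('p \<Rightarrow> 'w \<Rightarrow> 'k alg_closure) \<Rightarrow> (nat \<Rightarrow> 'p set) \<Rightarrow>
   ('q \<Rightarrow> 'u \<Rightarrow> 'k::field alg_closure) \<Rightarrow> (nat \<Rightarrow> 'q set) \<Rightarrow> ('p \<Rightarrow> 'q) \<Rightarrow> bool"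
  where "ind_morphism \<chi> M \<chi>' N F \<longleftrightarrow> (\<forall>i. \<exists>j. variety_morphism \<chi> (M i) \<chi>' (N j) F)"


section \<open>The Ind-group of nice automorphisms\<close>

definition aut_coords :: "('v, 'k::field) endo \<Rightarrow> 'v \<times> ('v \<Rightarrow>\<^sub>0 nat) \<Rightarrow> 'k"
  where "aut_coords f = (\<lambda>(i, m). Poly_Mapping.lookup (f (pvar i)) m)"

definition NAut_le :: "nat \<Rightarrow> ('v::finite, 'k::field) endo set"
  where "NAut_le d = {f \<in> NAut. \<forall>i. \<forall>m\<in>Poly_Mapping.keys (f (pvar i)). mon_degree m \<le> d}"

definition base_change :: "('v, 'k::field) endo \<Rightarrow> ('v, 'k alg_closure) endo"
  where "base_change f = pol_eval pconst (\<lambda>i. Poly_Mapping.map to_ac (f (pvar i)))"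

lemma base_change_pvar: "base_change f (pvar i) = Poly_Mapping.map to_ac (f (pvar i))"
  by (simp add: base_change_def pol_eval_pvar pconst_def)

lemma aut_coords_base_change: "aut_coords (base_change f) x = to_ac (aut_coords f x)"
  by (cases x) (simp add: aut_coords_def base_change_pvar Poly_Mapping.map.rep_eq when_def)

text \<open>
  A group automorphism \<open>\<phi>\<close> of the group of nice automorphisms over \<open>'k\<close> is an Ind-scheme
  automorphism if it is the effect on \<open>'k\<close>-rational points of an automorphism \<open>\<Phi>\<close>, defined
  over \<open>'k\<close>, of the Ind-group of nice automorphisms. If \<open>'k\<close> is algebraically closed, then
  \<open>to_ac\<close> is bijective and \<open>\<Phi>\<close> is just \<open>\<phi>\<close>.
\<close>

definition ind_scheme_automorphism ::
  "(('v::finite, 'k::field) endo \<Rightarrow> ('v, 'k) endo) \<Rightarrow> bool"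
  where "ind_scheme_automorphism \<phi> \<longleftrightarrow> \<phi> \<in> iso NAutG NAutG \<and>
    (\<exists>\<Phi> :: ('v, 'k alg_closure) endo \<Rightarrow> ('v, 'k alg_closure) endo.
       \<Phi> \<in> iso NAutG NAutG \<and>
       ind_morphism aut_coords NAut_le aut_coords NAut_le \<Phi> \<and>
       ind_morphism aut_coords NAut_le aut_coords NAut_le (inv_into NAut \<Phi>) \<and>
       (\<forall>f\<in>NAut. \<Phi> (base_change f) = base_change (\<phi> f)))"

end

(* The images of the diagonal torus and of the elementary automorphisms determine an Ind-automorphism
   of the nice automorphisms. Over the algebraic closure, the image of the torus decomposes the
   polynomial ring into weight spaces. They are one-dimensional by a count of dimensions, and units
   being constant, the weights span a pointed cone; homogeneous generators of the cotangent space at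
   the fixed point are then coordinates in which the image of the torus is diagonal. The image of a
   one-parameter root subgroup is equivariant and polynomial in the parameter, and so is its inverse,
   which forces it to be a root subgroup again. Roots a e_j - e_i with arbitrary a show that
   translations go to translations up to a permutation; after a monomial conjugation the torus and the
   translations are fixed, and conjugation by translations fixes all elementary automorphisms.

   A nice automorphism is approximated by tame ones. If psi is the identity to order N, then its
   conjugates by the homothety u extend to a curve through the identity at u = 0, which is constant to
   order N - 1; regularity there shows that the image of psi is the identity to order N as well.

   Finally, the conjugating automorphism is determined by its behaviour on translations and one
   homothety, and these conditions are preserved by a linear retraction onto the ground field if that
   is infinite, and by the Frobenius automorphism if it is finite. *)
theory Submission
  imports Defs "HOL-Analysis.Cartesian_Space"
begin

section \<open>Substitution homomorphisms\<close>

text \<open>Regularity enters only along curves of automorphisms with polynomial coordinates: on the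
  whole line a regular function is a polynomial in the parameter, on the punctured line a Laurent
  polynomial. This yields weights and root subgroups without any structure theory of algebraic
  groups, in every characteristic. The dimension count needs weights that spread in all n
  directions, which the torus alone does not provide: the translation x_i -> x_i + 1 commutes with
  the subtorus t_i = 1 but not with the full torus, so its image produces two weights that differ
  exactly in direction i. The same translations show that the weight matrix is invertible over the
  rationals. Over a finite ground field with q elements the rational translations are too few to
  force an invariant polynomial to be constant, and the field with two elements has no homothety
  besides the identity. The closure has enough of both, and there the map commutes with the q-th
  power map on coefficients because it is defined over the ground field.\<close>

abbreviation coef :: "('a \<Rightarrow>\<^sub>0 'b::zero) \<Rightarrow> 'a \<Rightarrow> 'b" where "coef \<equiv> Poly_Mapping.lookup"
abbreviation supp :: "('a \<Rightarrow>\<^sub>0 'b::zero) \<Rightarrow> 'a set" where "supp \<equiv> Poly_Mapping.keys"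
abbreviation mterm :: "'a \<Rightarrow> 'b::zero \<Rightarrow> ('a \<Rightarrow>\<^sub>0 'b)" where "mterm \<equiv> Poly_Mapping.single"

definition mono_eval :: "('v \<Rightarrow> 'b::comm_ring_1) \<Rightarrow> ('v \<Rightarrow>\<^sub>0 nat) \<Rightarrow> 'b"
  where "mono_eval a m = (\<Prod>v\<in>supp m. a v ^ coef m v)"

lemma mono_eval_superset:
  assumes "finite S" "supp m \<subseteq> S"
  shows "mono_eval a m = (\<Prod>v\<in>S. a v ^ coef m v)"
  unfolding mono_eval_def using assms
  by (intro prod.mono_neutral_left) (auto simp: in_keys_iff)

lemma mono_eval_UNIV: "mono_eval a m = (\<Prod>v\<in>UNIV. a v ^ coef m v)" for a :: "'v::finite \<Rightarrow> _"
  by (rule mono_eval_superset) auto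

lemma mono_eval_0 [simp]: "mono_eval a 0 = 1"
  by (simp add: mono_eval_def)

lemma mono_eval_add: "mono_eval a (m + m') = mono_eval a m * mono_eval a m'"
proof -
  have "mono_eval a (m + m') = (\<Prod>v\<in>supp m \<union> supp m'. a v ^ coef (m + m') v)"
    by (rule mono_eval_superset) (use Poly_Mapping.keys_add[of m m'] in auto)
  also have "\<dots> = (\<Prod>v\<in>supp m \<union> supp m'. a v ^ coef m v) * (\<Prod>v\<in>supp m \<union> supp m'. a v ^ coef m' v)"
    by (simp add: lookup_add power_add prod.distrib)
  also have "\<dots> = mono_eval a m * mono_eval a m'"
    by (subst (1 2) mono_eval_superset[symmetric]) auto
  finally show ?thesis .
qed

lemma mono_eval_single [simp]: "mono_eval a (mterm v k) = a v ^ k"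
  by (cases "k = 0") (auto simp: mono_eval_def)

lemma pol_eval_alt: "pol_eval h a p = (\<Sum>m\<in>supp p. h (coef p m) * mono_eval a m)"
  by (simp add: pol_eval_def mono_eval_def)

lemma pol_sum_terms: "p = (\<Sum>m\<in>supp p. mterm m (coef p m))"
  by (rule poly_mapping_eqI)
     (auto simp: lookup_sum lookup_single when_def in_keys_iff sum.delta' cong: if_cong)

lemma pol_induct [case_names zero mterm add]:
  fixes p :: "'a \<Rightarrow>\<^sub>0 'b::comm_monoid_add"
  assumes "P 0" "\<And>m c. P (mterm m c)" "\<And>p q. P p \<Longrightarrow> P q \<Longrightarrow> P (p + q)"
  shows "P p"
proof -
  have "P (\<Sum>m\<in>S. mterm m (coef p m))" if "finite S" for S
    using that by induction (auto intro: assms)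
  thus ?thesis by (subst pol_sum_terms) simp
qed

definition ring_hom_fun :: "('a::comm_ring_1 \<Rightarrow> 'b::comm_ring_1) \<Rightarrow> bool" where
  "ring_hom_fun h \<longleftrightarrow> h 1 = 1 \<and> (\<forall>x y. h (x + y) = h x + h y) \<and> (\<forall>x y. h (x * y) = h x * h y)"

lemma ring_hom_fun_simps:
  assumes "ring_hom_fun h"
  shows "h 0 = 0" "h 1 = 1" "h (x + y) = h x + h y" "h (x * y) = h x * h y" "h (- x) = - h x"
    "h (x - y) = h x - h y" "h (x ^ n) = h x ^ n" "h (sum f S) = (\<Sum>i\<in>S. h (f i))"
    "h (prod f S) = (\<Prod>i\<in>S. h (f i))"
proof -
  show 1: "h 1 = 1" "h (x + y) = h x + h y" "h (x * y) = h x * h y" for x y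
    using assms by (auto simp: ring_hom_fun_def)
  have "h 0 + h 0 = h 0 + 0" using 1(2)[of 0 0] by simp
  thus 0: "h 0 = 0" by (simp only: add_left_cancel)
  have "h x + h (- x) = 0" for x using 1(2)[of x "- x"] 0 by simp
  thus neg: "h (- x) = - h x" for x by (simp add: eq_neg_iff_add_eq_0 add.commute)
  show "h (x - y) = h x - h y" using 1(2)[of x "- y"] neg[of y] by simp
  show "h (x ^ n) = h x ^ n" by (induction n) (auto simp: 1)
  show "h (sum f S) = (\<Sum>i\<in>S. h (f i))" by (induction S rule: infinite_finite_induct) (auto simp: 0 1)
  show "h (prod f S) = (\<Prod>i\<in>S. h (f i))" by (induction S rule: infinite_finite_induct) (auto simp: 1)
qed

lemma pol_eval_superset:
  assumes "h 0 = 0" "finite S" "supp p \<subseteq> S"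
  shows "pol_eval h a p = (\<Sum>m\<in>S. h (coef p m) * mono_eval a m)"
  unfolding pol_eval_alt using assms
  by (intro sum.mono_neutral_left) (auto simp: in_keys_iff)

lemma pol_eval_add:
  assumes "ring_hom_fun h"
  shows "pol_eval h a (p + q) = pol_eval h a p + pol_eval h a q"
proof -
  let ?S = "supp p \<union> supp q"
  have S: "supp (p + q) \<subseteq> ?S" by (rule Poly_Mapping.keys_add)
  show ?thesis using ring_hom_fun_simps(1)[OF assms] S
    by (simp add: pol_eval_superset[of h ?S] lookup_add ring_hom_fun_simps[OF assms]
          distrib_right sum.distrib)
qed

lemma pol_eval_single: "h 0 = 0 \<Longrightarrow> pol_eval h a (mterm m c) = h c * mono_eval a m"
  by (cases "c = 0") (simp_all add: pol_eval_alt)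

lemma pol_eval_0 [simp]: "pol_eval h a 0 = 0"
  by (simp add: pol_eval_def)

lemma pol_eval_mult:
  assumes "ring_hom_fun h"
  shows "pol_eval h a (p * q) = pol_eval h a p * pol_eval h a q"
proof (induction p rule: pol_induct)
  case (mterm m c)
  show ?case
    by (induction q rule: pol_induct)
       (simp_all add: mult_single pol_eval_single ring_hom_fun_simps[OF assms] mono_eval_add
          distrib_left pol_eval_add[OF assms] mult.assoc mult.left_commute)
qed (simp_all add: pol_eval_add[OF assms] distrib_right)

lemma one_pconst: "1 = pconst 1"
  by (simp add: pconst_def)

lemma pconst_simps:
  "pconst 0 = 0" "pconst 1 = 1" "pconst (a + b) = pconst a + pconst b" "pconst (a * b) = pconst a * pconst b"
  "pconst (- a) = - pconst a" "pconst (a - b) = pconst a - pconst b"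
  by (simp_all add: pconst_def single_add single_diff single_uminus mult_single)

lemma ring_hom_pconst: "ring_hom_fun pconst"
  by (simp add: ring_hom_fun_def pconst_simps)

lemma pconst_power: "pconst (a ^ n) = pconst a ^ n"
  by (rule ring_hom_fun_simps(7)[OF ring_hom_pconst])

lemma pol_eval_const: "ring_hom_fun h \<Longrightarrow> pol_eval h a (pconst c) = h c"
  by (rule pol_eval_pconst) (rule ring_hom_fun_simps(1))

lemma pol_eval_var: "ring_hom_fun h \<Longrightarrow> pol_eval h a (pvar c) = a c"
  by (rule pol_eval_pvar) (rule ring_hom_fun_simps(2))

lemma ring_hom_pol_eval:
  assumes "ring_hom_fun h"
  shows "ring_hom_fun (pol_eval h a)"
  using pol_eval_const[OF assms, of a 1] ring_hom_fun_simps(2)[OF assms]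
  by (simp add: ring_hom_fun_def[of "pol_eval h a"] pol_eval_add[OF assms] pol_eval_mult[OF assms]
      pconst_simps)

lemma pconst_mult_single: "pconst c * mterm m d = mterm m (c * d)"
  by (simp add: pconst_def mult_single)

lemma mono_eval_pvar: "mono_eval pvar m = (mterm m 1 :: ('v, 'k::comm_ring_1) pol)"
proof -
  have *: "mono_eval pvar m = (\<Prod>v\<in>supp m. mterm (mterm v (coef m v)) (1::'k))"
  proof -
    have "pvar v ^ k = (mterm (mterm v k) 1 :: ('v, 'k) pol)" for v k
      by (induction k) (auto simp: pvar_def mult_single single_add[symmetric] simp flip: single_one)
    thus ?thesis by (simp add: mono_eval_def)
  qed
  have "(\<Prod>v\<in>S. mterm (mterm v (coef m v)) (1::'k)) = mterm (\<Sum>v\<in>S. mterm v (coef m v)) 1"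
    if "finite S" for S
    using that by induction (auto simp: mult_single)
  with * show ?thesis using pol_sum_terms[of m] by simp
qed

lemma mterm_conv: "mterm m c = pconst c * mono_eval pvar m"
  by (simp add: mono_eval_pvar pconst_mult_single)

lemma pol_ring_induct [case_names const var add mult]:
  fixes p :: "('v, 'a::comm_ring_1) pol"
  assumes const: "\<And>c. P (pconst c)" and var: "\<And>v. P (pvar v)"
    and add: "\<And>p q. P p \<Longrightarrow> P q \<Longrightarrow> P (p + q)" and mult: "\<And>p q. P p \<Longrightarrow> P q \<Longrightarrow> P (p * q)"
  shows "P p"
proof (induction p rule: pol_induct)
  case zero show ?case using const[of 0] by (simp add: pconst_simps)
next
  case (mterm m c)
  have one: "P 1" using const[of 1] by (simp add: pconst_simps)
  have "P (pvar v ^ k)" for v k by (induction k) (simp_all add: one var mult)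
  hence "P (\<Prod>v\<in>S. pvar v ^ coef m v)" for S
    by (induction S rule: infinite_finite_induct) (simp_all add: one mult)
  thus ?case unfolding mterm_conv mono_eval_def by (intro mult const)
qed (rule add)

lemma mterm_eq_0_iff [simp]: "mterm v k = 0 \<longleftrightarrow> k = 0"
proof
  assume "mterm v k = 0"
  hence "coef (mterm v k) v = 0" by (simp only: lookup_zero)
  thus "k = 0" by simp
qed simp

lemma mterm_eq_iff [simp]: "k \<noteq> 0 \<Longrightarrow> mterm i k = mterm j k \<longleftrightarrow> i = j"
proof
  assume k: "k \<noteq> 0" and eq: "mterm i k = mterm j k"
  have "coef (mterm j k) i = k" unfolding eq[symmetric] by simp
  thus "i = j" using k by (auto simp: lookup_single when_def split: if_splits)
qed simp

lemma coef_pconst: "coef (pconst c) m = (if m = 0 then c else 0)"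
  by (simp add: pconst_def lookup_single when_def)

lemma coef_pvar: "coef (pvar v) m = (if m = mterm v 1 then 1 else 0)"
  by (auto simp: pvar_def lookup_single when_def)

lemma coef_pconst_mult: "coef (pconst c * p) m = c * coef p m"
proof (induction p rule: pol_induct)
  case (mterm n d) thus ?case by (simp add: pconst_mult_single lookup_single when_def)
qed (simp_all add: distrib_left lookup_add)

lemma pconst_eq_iff [simp]: "pconst a = pconst b \<longleftrightarrow> a = b"
  by (metis coef_pconst)

lemma mono_eval_hom:
  assumes "ring_hom_fun f"
  shows "f (mono_eval a m) = mono_eval (\<lambda>v. f (a v)) m"
  by (simp add: mono_eval_def ring_hom_fun_simps[OF assms])

definition alg_hom :: "('v, 'k::comm_ring_1) endo \<Rightarrow> bool"
  where "alg_hom f \<longleftrightarrow> ring_hom_fun f \<and> (\<forall>c. f (pconst c) = pconst c)"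

lemma alg_homD: "alg_hom f \<Longrightarrow> ring_hom_fun f" "alg_hom f \<Longrightarrow> f (pconst c) = pconst c"
  by (auto simp: alg_hom_def)

lemmas alg_hom_simps = ring_hom_fun_simps[OF alg_homD(1)] alg_homD(2)

lemma alg_aut_iff: "f \<in> alg_aut \<longleftrightarrow> bij f \<and> alg_hom f"
  by (auto simp: alg_aut_def alg_hom_def ring_hom_fun_def one_pconst)

text \<open>The universal property of the polynomial ring. It is stated for ring homomorphisms that
  need not fix the constants, because extension of scalars and the Frobenius map on coefficients are
  compared through it as well.\<close>

lemma ring_hom_pol_conv:
  assumes "ring_hom_fun f"
  shows "f p = pol_eval (\<lambda>c. f (pconst c)) (\<lambda>v. f (pvar v)) p"
proof -
  have *: "ring_hom_fun (\<lambda>c. f (pconst c))"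
    by (simp add: ring_hom_fun_def pconst_simps ring_hom_fun_simps[OF assms])
  show ?thesis
  proof (induction p rule: pol_induct)
    case (mterm m c)
    show ?case
      by (subst pol_eval_single)
         (simp_all add: pconst_simps mterm_conv ring_hom_fun_simps[OF assms] mono_eval_hom[OF assms])
  qed (simp_all add: pol_eval_add[OF *] ring_hom_fun_simps[OF assms])
qed

lemma ring_hom_pol_eqI:
  assumes "ring_hom_fun f" "ring_hom_fun g" "\<And>c. f (pconst c) = g (pconst c)" "\<And>v. f (pvar v) = g (pvar v)"
  shows "f = g"
  by (rule ext, subst (1 2) ring_hom_pol_conv) (use assms in auto)

lemma alg_hom_conv: "alg_hom f \<Longrightarrow> f p = pol_eval pconst (\<lambda>v. f (pvar v)) p"
  using ring_hom_pol_conv[of f p] by (simp add: alg_hom_def)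

lemma alg_hom_eqI:
  assumes "alg_hom f" "alg_hom g" "\<And>v. f (pvar v) = g (pvar v)"
  shows "f = g"
  using assms by (intro ring_hom_pol_eqI) (auto simp: alg_hom_def)

abbreviation sub :: "('v \<Rightarrow> ('v, 'k::comm_ring_1) pol) \<Rightarrow> ('v, 'k) endo"
  where "sub \<equiv> pol_eval pconst"

lemma alg_hom_sub [simp]: "alg_hom (sub a)"
  by (simp add: alg_hom_def ring_hom_pol_eval[OF ring_hom_pconst] pol_eval_const[OF ring_hom_pconst])

lemma sub_pvar [simp]: "sub a (pvar v) = a v"
  by (rule pol_eval_var[OF ring_hom_pconst])

lemma sub_pconst [simp]: "sub a (pconst c) = pconst c"
  by (rule pol_eval_const[OF ring_hom_pconst])

lemma sub_mterm: "sub a (mterm m c) = pconst c * mono_eval a m"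
  by (rule pol_eval_single) (simp add: pconst_simps)

lemma alg_hom_id [simp]: "alg_hom id"
  by (simp add: alg_hom_def ring_hom_fun_def)

lemma alg_hom_comp: "alg_hom f \<Longrightarrow> alg_hom g \<Longrightarrow> alg_hom (f \<circ> g)"
  by (simp add: alg_hom_def ring_hom_fun_def)

abbreviation finv :: "('a \<Rightarrow> 'b) \<Rightarrow> 'b \<Rightarrow> 'a" where "finv \<equiv> inv_into UNIV"

lemma alg_autI:
  assumes "alg_hom f" "alg_hom g" "\<And>v. f (g (pvar v)) = pvar v" "\<And>v. g (f (pvar v)) = pvar v"
  shows "f \<in> alg_aut" "finv f = g"
proof -
  have "f \<circ> g = id" "g \<circ> f = id"
    by (rule alg_hom_eqI; use assms in \<open>auto intro: alg_hom_comp\<close>)+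
  thus "f \<in> alg_aut" "finv f = g" using assms(1)
    by (auto simp: alg_aut_iff o_bij inv_unique_comp)
qed

lemma alg_aut_hom: "f \<in> alg_aut \<Longrightarrow> alg_hom f"
  by (simp add: alg_aut_iff)

lemmas alg_aut_simps = alg_hom_simps[OF alg_aut_hom]

lemma alg_aut_bij: "f \<in> alg_aut \<Longrightarrow> bij f"
  by (simp add: alg_aut_iff)

lemma alg_aut_inv_simps [simp]:
  assumes "f \<in> alg_aut"
  shows "f (finv f p) = p" "finv f (f p) = p" "f \<circ> finv f = id" "finv f \<circ> f = id" 
    "f \<circ> (finv f \<circ> h) = h" "finv f \<circ> (f \<circ> h) = h"
  using alg_aut_bij[OF assms] by (auto simp: bij_def surj_f_inv_f fun_eq_iff)

lemma alg_aut_comp: "f \<in> alg_aut \<Longrightarrow> g \<in> alg_aut \<Longrightarrow> f \<circ> g \<in> alg_aut"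
  by (simp add: alg_aut_iff alg_hom_comp bij_comp)

lemma alg_aut_id [simp]: "id \<in> alg_aut"
  by (simp add: alg_aut_iff)

lemma alg_aut_inv:
  assumes "f \<in> alg_aut"
  shows "finv f \<in> alg_aut"
proof -
  note f = alg_aut_simps[OF assms]
  have eq: "finv f x = y" if "f y = x" for x y
    using alg_aut_inv_simps(2)[OF assms, of y] that by simp
  have "finv f (p + q) = finv f p + finv f q" "finv f (p * q) = finv f p * finv f q" 
    "finv f (pconst c) = pconst c" for p q c
    by (rule eq; simp add: f assms)+
  thus ?thesis using assms
    by (auto simp: alg_aut_iff alg_hom_def ring_hom_fun_def one_pconst bij_imp_bij_inv)
qed

lemma alg_aut_eqI:
  assumes "f \<in> alg_aut" "g \<in> alg_aut" "\<And>v. f (pvar v) = g (pvar v)"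
  shows "f = g"
  using assms by (intro alg_hom_eqI) (auto simp: alg_aut_hom)

lemma AutG_simps [simp]: "carrier AutG = alg_aut" "\<one>\<^bsub>AutG\<^esub> = id" "f \<otimes>\<^bsub>AutG\<^esub> g = f \<circ> g"
  by (simp_all add: AutG_def)

lemma inv_AutG: "f \<in> alg_aut \<Longrightarrow> inv\<^bsub>AutG\<^esub> f = finv f"
  using group.inv_equality[OF group_AutG, of "finv f" f] by (simp add: alg_aut_inv)

lemma inv_comp_alg_aut: "f \<in> alg_aut \<Longrightarrow> g \<in> alg_aut \<Longrightarrow> finv (f \<circ> g) = finv g \<circ> finv f"
  by (simp add: alg_aut_bij o_inv_distrib)

section \<open>Degrees, and polynomials over a domain\<close>

lemma mon_degree_add: "mon_degree (m + m') = mon_degree m + mon_degree m'"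
  by (simp add: mon_degree_def lookup_add sum.distrib)

lemma mon_degree_0 [simp]: "mon_degree 0 = 0"
  by (simp add: mon_degree_def)

lemma mon_degree_single [simp]: "mon_degree (mterm v k) = k"
  by (simp add: mon_degree_def lookup_single when_def)

lemma coef_le_mon_degree: "coef m v \<le> mon_degree m"
  unfolding mon_degree_def by (rule member_le_sum) auto

lemma mon_degree_eq_0_iff: "mon_degree m = 0 \<longleftrightarrow> m = 0"
  by (auto simp: mon_degree_def poly_mapping_eq_iff fun_eq_iff)

definition deg_le :: "nat \<Rightarrow> ('v::finite, 'k::comm_ring_1) pol set"
  where "deg_le d = {p. \<forall>m\<in>supp p. mon_degree m \<le> d}"

text \<open>The N-th power of the ideal generated by the variables, described by supports.\<close>

definition ord_ge :: "nat \<Rightarrow> ('v::finite, 'k::comm_ring_1) pol set"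
  where "ord_ge N = {p. \<forall>m\<in>supp p. N \<le> mon_degree m}"

lemma deg_le_iff: "p \<in> deg_le d \<longleftrightarrow> (\<forall>m. d < mon_degree m \<longrightarrow> coef p m = 0)"
  by (auto simp: deg_le_def in_keys_iff not_le[symmetric])

lemma deg_le_mono: "p \<in> deg_le d \<Longrightarrow> d \<le> e \<Longrightarrow> p \<in> deg_le e"
  by (force simp: deg_le_def)

lemma deg_le_ex: "\<exists>d. p \<in> deg_le d"
proof
  show "p \<in> deg_le (\<Sum>m\<in>supp p. mon_degree m)"
    by (auto simp: deg_le_def intro: member_le_sum)
qed

lemma deg_le_add: "p \<in> deg_le d \<Longrightarrow> q \<in> deg_le d \<Longrightarrow> p + q \<in> deg_le d"
  using Poly_Mapping.keys_add[of p q] by (force simp: deg_le_def)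

lemma deg_le_mult: "p \<in> deg_le d \<Longrightarrow> q \<in> deg_le e \<Longrightarrow> p * q \<in> deg_le (d + e)"
  using Poly_Mapping.keys_mult[of p q] by (fastforce simp: deg_le_def mon_degree_add intro: add_mono)

lemma deg_le_pconst [simp]: "pconst c \<in> deg_le d"
  by (auto simp: deg_le_def pconst_def)

lemma deg_le_power: "p \<in> deg_le d \<Longrightarrow> p ^ k \<in> deg_le (k * d)"
  by (induction k) (auto simp: deg_le_mult one_pconst)

lemma deg_le_prod: "(\<And>i. i \<in> S \<Longrightarrow> p i \<in> deg_le (d i)) \<Longrightarrow> prod p S \<in> deg_le (sum d S)"
  by (induction S rule: infinite_finite_induct) (auto simp: deg_le_mult one_pconst)

lemma deg_le_0 [simp]: "0 \<in> deg_le d"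
  by (simp add: deg_le_def)

lemma ord_ge_iff: "p \<in> ord_ge N \<longleftrightarrow> (\<forall>m. mon_degree m < N \<longrightarrow> coef p m = 0)"
  by (auto simp: ord_ge_def in_keys_iff not_le[symmetric])

lemma ord_ge_mono: "p \<in> ord_ge d \<Longrightarrow> e \<le> d \<Longrightarrow> p \<in> ord_ge e"
  by (force simp: ord_ge_def)

lemma ord_ge_0 [simp]: "p \<in> ord_ge 0" "0 \<in> ord_ge N"
  by (auto simp: ord_ge_def)

lemma ord_ge_add: "p \<in> ord_ge d \<Longrightarrow> q \<in> ord_ge d \<Longrightarrow> p + q \<in> ord_ge d"
  using Poly_Mapping.keys_add[of p q] by (force simp: ord_ge_def)

lemma ord_ge_mult: "p \<in> ord_ge d \<Longrightarrow> q \<in> ord_ge e \<Longrightarrow> p * q \<in> ord_ge (d + e)"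
  using Poly_Mapping.keys_mult[of p q] by (fastforce simp: ord_ge_def mon_degree_add intro: add_mono)

lemma ord_ge_pconst_mult: "p \<in> ord_ge d \<Longrightarrow> pconst c * p \<in> ord_ge d"
  by (simp add: ord_ge_iff coef_pconst_mult)

lemma ord_ge_sum: "(\<And>i. i \<in> S \<Longrightarrow> p i \<in> ord_ge d) \<Longrightarrow> sum p S \<in> ord_ge d"
  by (induction S rule: infinite_finite_induct) (auto simp: ord_ge_add)

lemma ord_ge_prod: "(\<And>i. i \<in> S \<Longrightarrow> p i \<in> ord_ge (d i)) \<Longrightarrow> prod p S \<in> ord_ge (sum d S)"
  by (induction S rule: infinite_finite_induct) (auto simp: ord_ge_mult)

lemma ord_ge_power: "p \<in> ord_ge d \<Longrightarrow> p ^ k \<in> ord_ge (k * d)"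
  by (induction k) (auto simp: ord_ge_mult)

lemma ord_ge_diff: "p \<in> ord_ge d \<Longrightarrow> q \<in> ord_ge d \<Longrightarrow> p - q \<in> ord_ge d"
  by (simp add: ord_ge_iff lookup_minus)

lemma ord_ge_pvar [simp]: "pvar v \<in> ord_ge 1"
  by (auto simp: ord_ge_def pvar_def split: if_splits)

lemma ord_ge_eq_0: "p \<in> deg_le d \<Longrightarrow> p \<in> ord_ge (Suc d) \<Longrightarrow> p = 0"
  unfolding poly_mapping_eq_iff fun_eq_iff ord_ge_iff deg_le_iff
  by (metis lookup_zero not_less_eq)

lemma sub_ord_ge:
  assumes "\<And>v. a v \<in> ord_ge 1" "p \<in> ord_ge N"
  shows "sub a p \<in> ord_ge N"
  unfolding pol_eval_alt
proof (rule ord_ge_sum, rule ord_ge_pconst_mult)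
  fix m assume m: "m \<in> supp p"
  have "mono_eval a m \<in> ord_ge (\<Sum>v\<in>UNIV. coef m v * 1)"
    unfolding mono_eval_UNIV by (intro ord_ge_prod ord_ge_power assms)
  hence "mono_eval a m \<in> ord_ge (mon_degree m)"
    by (simp add: mon_degree_def)
  thus "mono_eval a m \<in> ord_ge N"
    by (rule ord_ge_mono) (use assms(2) m in \<open>auto simp: ord_ge_def\<close>)
qed

section \<open>Zero divisors, units and zeros by reduction to one variable\<close>

text \<open>Reduction modulo \<open>D\<close> recovers the lowest digit; the others follow by
  induction.\<close>

lemma digits_unique:
  fixes a b :: "nat \<Rightarrow> nat"
  assumes "(\<Sum>i<n. a i * D ^ i) = (\<Sum>i<n. b i * D ^ i)" "\<And>i. i < n \<Longrightarrow> a i < D" "\<And>i. i < n \<Longrightarrow> b i < D" "i < n"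
  shows "a i = b i"
  using assms
proof (induction n arbitrary: a b i)
  case (Suc n)
  have *: "(\<Sum>i<Suc n. c i * D ^ i) = c 0 + D * (\<Sum>i<n. c (Suc i) * D ^ i)" for c :: "nat \<Rightarrow> nat"
    by (subst sum.lessThan_Suc_shift) (simp add: sum_distrib_left mult_ac)
  have eq: "a 0 + D * (\<Sum>i<n. a (Suc i) * D ^ i) = b 0 + D * (\<Sum>i<n. b (Suc i) * D ^ i)"
    using Suc.prems(1) unfolding * .
  have ab: "a 0 < D" "b 0 < D" using Suc.prems by auto
  have 0: "a 0 = b 0" using arg_cong[OF eq, of "\<lambda>x. x mod D"] ab by simp
  have "(\<Sum>i<n. a (Suc i) * D ^ i) = (\<Sum>i<n. b (Suc i) * D ^ i)" using eq 0 ab by simp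
  from Suc.IH[OF this] Suc.prems 0 show ?case by (cases i) auto
qed auto

text \<open>Kronecker's substitution \<open>x\<^sub>v \<mapsto> X ^ (D ^ idx v)\<close> is injective on polynomials all of whose
  exponents are less than \<open>D\<close>; it reduces questions on zero divisors, units and zeros to one variable.\<close>

definition kron_exp :: "nat \<Rightarrow> 'v::finite \<Rightarrow> nat"
  where "kron_exp D v = D ^ (SOME f. bij_betw f (UNIV :: 'v set) {0..<CARD('v)}) v"

definition kron :: "nat \<Rightarrow> ('v::finite, 'k::comm_ring_1) pol \<Rightarrow> 'k poly"
  where "kron D = pol_eval (\<lambda>c. [:c:]) (\<lambda>v. Polynomial.monom 1 (kron_exp D v))"

lemma ring_hom_pCons: "ring_hom_fun (\<lambda>c. [:c:])"
  by (simp add: ring_hom_fun_def)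

lemma ring_hom_kron: "ring_hom_fun (kron D)"
  unfolding kron_def by (rule ring_hom_pol_eval[OF ring_hom_pCons])

lemma kron_exp_inj:
  fixes m m' :: "'v::finite \<Rightarrow>\<^sub>0 nat"
  assumes "\<And>v. coef m v < D" "\<And>v. coef m' v < D"
    "(\<Sum>v\<in>UNIV. coef m v * kron_exp D v) = (\<Sum>v\<in>UNIV. coef m' v * kron_exp D v)"
  shows "m = m'"
proof -
  define f where "f = (SOME f. bij_betw f (UNIV :: 'v set) {0..<CARD('v)})"
  have f: "bij_betw f (UNIV :: 'v set) {0..<CARD('v)}"
    unfolding f_def using ex_bij_betw_finite_nat[OF finite, of "UNIV :: 'v set"] by (rule someI_ex)
  have f_exp: "kron_exp D v = D ^ f v" for v
    by (simp add: kron_exp_def f_def)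
  have inv: "inv_into UNIV f (f v) = v" for v
    using f by (meson UNIV_I bij_betw_imp_inj_on inv_into_f_f)
  have *: "(\<Sum>v\<in>UNIV. coef m v * kron_exp D v) = (\<Sum>i<CARD('v). coef m (inv_into UNIV f i) * D ^ i)" for m :: "'v \<Rightarrow>\<^sub>0 nat"
    using sum.reindex_bij_betw[OF f, of "\<lambda>i. coef m (finv f i) * D ^ i"]
    by (simp add: f_exp inv atLeast0LessThan)
  have "coef m (inv_into UNIV f (f v)) = coef m' (inv_into UNIV f (f v))" for v
    by (rule digits_unique[where D = D and n = "CARD('v)"])
       (use assms bij_betwE[OF f] in \<open>auto simp flip: *\<close>)
  thus ?thesis by (intro poly_mapping_eqI) (simp add: inv)
qed

lemma mono_eval_kron: "mono_eval (\<lambda>v. Polynomial.monom 1 (kron_exp D v)) m =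
    Polynomial.monom (1 :: 'k::comm_ring_1) (\<Sum>v\<in>UNIV. coef m v * kron_exp D v)"
proof -
  have "(\<Prod>v\<in>S. Polynomial.monom (1::'k) (kron_exp D v) ^ coef m v) = Polynomial.monom 1 (\<Sum>v\<in>S. coef m v * kron_exp D v)" if "finite S" for S
    using that by induction (auto simp: monom_power mult_monom mult.commute)
  thus ?thesis by (simp add: mono_eval_UNIV)
qed

lemma coeff_kron:
  fixes m :: "'v::finite \<Rightarrow>\<^sub>0 nat"
  assumes "p \<in> deg_le d" "d < D" "\<And>v. coef m v < D"
  shows "Polynomial.coeff (kron D p) (\<Sum>v\<in>UNIV. coef m v * kron_exp D v) = coef p m"
proof -
  have "Polynomial.coeff (kron D p) (\<Sum>v\<in>UNIV. coef m v * kron_exp D v)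
      = (\<Sum>m'\<in>supp p. if m' = m then coef p m' else 0)"
    unfolding kron_def pol_eval_alt mono_eval_kron coeff_sum
  proof (rule sum.cong, goal_cases)
    case (2 m')
    hence "coef m' v < D" for v
      using assms coef_le_mon_degree[of m' v] by (force simp: deg_le_def)
    hence "(\<Sum>v\<in>UNIV. coef m' v * kron_exp D v) = (\<Sum>v\<in>UNIV. coef m v * kron_exp D v) \<longleftrightarrow> m' = m"
      using kron_exp_inj[of m' D m] assms(3) by blast
    thus ?case by (simp add: mult.commute[of "[:_:]"] coeff_monom_mult)
  qed simp
  thus ?thesis by (auto simp: in_keys_iff)
qed

lemma kron_inj:
  fixes p :: "('v::finite, 'k::comm_ring_1) pol"
  assumes "p \<in> deg_le d" "q \<in> deg_le d" "d < D" "kron D p = kron D q"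
  shows "p = q"
proof (rule poly_mapping_eqI)
  fix m :: "'v \<Rightarrow>\<^sub>0 nat"
  show "coef p m = coef q m"
  proof (cases "\<forall>v. coef m v < D")
    case True
    thus ?thesis using coeff_kron[OF assms(1,3), of m] coeff_kron[OF assms(2,3), of m] assms(4) by simp
  next
    case False
    then obtain v where "\<not> coef m v < D" by auto
    hence "mon_degree m > d" using assms coef_le_mon_degree[of m v] by simp
    thus ?thesis using assms(1,2) by (simp add: deg_le_iff)
  qed
qed

lemma kron_0 [simp]: "kron D 0 = 0"
  by (rule ring_hom_fun_simps[OF ring_hom_kron])

lemma pol_mult_eq_0:
  fixes p q :: "('v::finite, 'k::idom) pol"
  assumes "p * q = 0"
  shows "p = 0 \<or> q = 0"
proof -
  obtain d e where d: "p \<in> deg_le d" "q \<in> deg_le e" using deg_le_ex by meson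
  let ?D = "max d e"
  have 0: "p \<in> deg_le ?D" "q \<in> deg_le ?D" "0 \<in> deg_le ?D"
    using d by (auto intro: deg_le_mono simp: deg_le_def)
  have "kron (Suc ?D) p * kron (Suc ?D) q = 0"
    using assms by (simp add: ring_hom_fun_simps(4)[OF ring_hom_kron, symmetric])
  hence "kron (Suc ?D) p = kron (Suc ?D) 0 \<or> kron (Suc ?D) q = kron (Suc ?D) 0" by simp
  thus ?thesis using kron_inj 0 by blast
qed

lemma pol_mult_nonzero: "p \<noteq> 0 \<Longrightarrow> q \<noteq> 0 \<Longrightarrow> p * q \<noteq> 0" for p q :: "('v::finite, 'k::idom) pol"
  using pol_mult_eq_0 by blast

lemma pol_mult_cancel:
  fixes p :: "('v::finite, 'k::idom) pol"
  assumes "p * q = p * r" "p \<noteq> 0"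
  shows "q = r"
  using pol_mult_eq_0[of p "q - r"] assms by (auto simp: right_diff_distrib)

lemma pol_prod_nonzero:
  fixes p :: "'i \<Rightarrow> ('v::finite, 'k::idom) pol"
  assumes "\<And>i. i \<in> S \<Longrightarrow> p i \<noteq> 0"
  shows "prod p S \<noteq> 0"
  using assms by (induction S rule: infinite_finite_induct) (auto dest: pol_mult_eq_0)

lemma pol_power_nonzero: "p \<noteq> 0 \<Longrightarrow> p ^ k \<noteq> 0" for p :: "('v::finite, 'k::idom) pol"
  by (induction k) (auto dest: pol_mult_eq_0)

text \<open>The Kronecker image of a unit is a unit in one variable, hence a constant, and by
  injectivity on polynomials of bounded degree only a constant has such an image.\<close>

lemma pol_unit_const:
  fixes p q :: "('v::finite, 'k::field) pol"
  assumes "p * q = 1"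
  shows "\<exists>c. p = pconst c"
proof -
  obtain d where d: "p \<in> deg_le d" using deg_le_ex by meson
  have "kron (Suc d) p * kron (Suc d) q = 1"
    using arg_cong[OF assms, of "kron (Suc d)"] by (simp add: ring_hom_fun_simps(2,4)[OF ring_hom_kron])
  hence "kron (Suc d) p dvd 1" by (metis dvdI)
  then obtain c where "kron (Suc d) p = [:c:]"
    using is_unit_iff_degree[of "kron (Suc d) p"] by (auto simp: is_unit_poly_iff)
  also have "[:c:] = kron (Suc d) (pconst c)" by (simp add: kron_def pol_eval_const[OF ring_hom_pCons])
  finally show ?thesis using kron_inj[OF d deg_le_pconst] by auto
qed

text \<open>A nonzero univariate polynomial has a nonroot \<open>u\<close> in \<open>U\<close>; read
  back through the Kronecker substitution this is a point all of whose coordinates are powers of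
  \<open>u\<close>. Such a point stays inside any set closed under powers, for instance the image of
  the ground field in its closure.\<close>

lemma pol_nonvanishing:
  fixes p :: "('v::finite, 'k::idom) pol"
  assumes "p \<noteq> 0" "infinite U"
  shows "\<exists>u\<in>U. \<exists>e. pol_eval id (\<lambda>v. u ^ e v) p \<noteq> 0"
proof -
  obtain d where d: "p \<in> deg_le d" using deg_le_ex by meson
  let ?q = "kron (Suc d) p"
  have "?q \<noteq> 0" using kron_inj[OF d, of 0 "Suc d"] assms(1) by (auto simp: deg_le_def)
  hence "finite {u. poly ?q u = 0}" by (rule poly_roots_finite)
  with assms(2) obtain u where u: "u \<in> U" "poly ?q u \<noteq> 0"
    by (metis (mono_tags, lifting) finite_subset mem_Collect_eq subsetI)
  have "poly ?q u = pol_eval id (\<lambda>v. u ^ kron_exp (Suc d) v) p"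
    by (simp add: kron_def pol_eval_alt poly_sum mono_eval_def poly_prod poly_monom)
  thus ?thesis using u by auto
qed

section \<open>Dilations, elementary automorphisms and translations\<close>

lemma sub_comp: "alg_hom f \<Longrightarrow> f (sub a p) = sub (\<lambda>v. f (a v)) p"
  using alg_hom_eqI[OF alg_hom_comp[OF _ alg_hom_sub] alg_hom_sub, of f a "\<lambda>v. f (a v)"]
  by (auto simp: fun_eq_iff)

lemma sub_id [simp]: "sub pvar p = p"
  using alg_hom_eqI[OF alg_hom_sub alg_hom_id, of pvar] by (auto simp: fun_eq_iff)

definition dil :: "('v::finite \<Rightarrow> 'k::field) \<Rightarrow> ('v, 'k) endo"
  where "dil t = sub (\<lambda>v. pconst (t v) * pvar v)"

lemma alg_hom_dil [simp]: "alg_hom (dil t)"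
  by (simp add: dil_def)

lemma dil_pvar [simp]: "dil t (pvar v) = pconst (t v) * pvar v"
  by (simp add: dil_def)

lemma dil_mterm: "dil t (mterm m c) = mterm m (mono_eval t m * c)"
proof -
  have "mono_eval (\<lambda>v. pconst (t v) * pvar v) m = pconst (mono_eval t m) * mono_eval pvar m"
    by (simp add: mono_eval_def prod.distrib power_mult_distrib pconst_power 
        ring_hom_fun_simps(9)[OF ring_hom_pconst])
  thus ?thesis by (simp add: dil_def sub_mterm mono_eval_pvar pconst_mult_single) (simp add: mult.commute)
qed

lemma coef_dil: "coef (dil t p) m = mono_eval t m * coef p m"
proof (induction p rule: pol_induct)
  case (add p q)
  thus ?case by (simp add: alg_hom_simps[OF alg_hom_dil] lookup_add distrib_left)
qed (auto simp: alg_hom_simps[OF alg_hom_dil] dil_mterm lookup_single when_def)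

lemma dil_comp: "dil s \<circ> dil t = dil (\<lambda>v. s v * t v)"
  by (rule alg_hom_eqI)
     (auto intro: alg_hom_comp simp: alg_hom_simps[OF alg_hom_dil] pconst_simps mult_ac)

lemma dil_one [simp]: "dil (\<lambda>v. 1) = id"
  by (rule alg_hom_eqI) (auto simp: pconst_simps)

lemma dil_comp_inverse: "\<forall>v. t v \<noteq> 0 \<Longrightarrow> dil t (dil (\<lambda>v. inverse (t v)) p) = p"
  "\<forall>v. t v \<noteq> 0 \<Longrightarrow> dil (\<lambda>v. inverse (t v)) (dil t p) = p"
  using dil_comp[of t "\<lambda>v. inverse (t v)"] dil_comp[of "\<lambda>v. inverse (t v)" t]
  by (simp_all add: fun_eq_iff)

lemma dil_aut: "\<forall>v. t v \<noteq> 0 \<Longrightarrow> dil t \<in> alg_aut"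
  and finv_dil: "\<forall>v. t v \<noteq> 0 \<Longrightarrow> finv (dil t) = dil (\<lambda>v. inverse (t v))"
  using alg_autI[of "dil t" "dil (\<lambda>v. inverse (t v))"] 
  by (simp_all add: dil_comp_inverse del: dil_pvar)

definition var_free :: "'v \<Rightarrow> ('v, 'k::comm_ring_1) pol \<Rightarrow> bool"
  where "var_free i P \<longleftrightarrow> (\<forall>m\<in>supp P. coef m i = 0)"

lemma var_free_0 [simp]: "var_free i 0"
  by (simp add: var_free_def)

lemma var_free_add: "var_free i P \<Longrightarrow> var_free i Q \<Longrightarrow> var_free i (P + Q)"
  using Poly_Mapping.keys_add[of P Q] by (force simp: var_free_def)

lemma var_free_mult: "var_free i P \<Longrightarrow> var_free i Q \<Longrightarrow> var_free i (P * Q)"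
  using Poly_Mapping.keys_mult[of P Q] by (fastforce simp: var_free_def lookup_add)

lemma var_free_uminus: "var_free i P \<Longrightarrow> var_free i (- P)"
  by (simp add: var_free_def in_keys_iff)

lemma var_free_mterm [simp]: "coef m i = 0 \<Longrightarrow> var_free i (mterm m c)"
  by (simp add: var_free_def)

lemma var_free_pconst [simp]: "var_free i (pconst c)"
  by (simp add: pconst_def)

lemma sub_cong_free:
  assumes "\<And>v. v \<noteq> i \<Longrightarrow> a v = b v" "var_free i P"
  shows "sub a P = sub b P"
  unfolding pol_eval_alt mono_eval_def
proof (intro sum.cong prod.cong arg_cong2[of _ _ _ _ "(*)"] refl)
  fix m v assume m: "m \<in> supp P" "v \<in> supp m"
  hence "v \<noteq> i" using assms(2) by (auto simp: var_free_def)
  thus "a v ^ coef m v = b v ^ coef m v" by (simp add: assms)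
qed

definition elmt :: "'v \<Rightarrow> ('v, 'k::comm_ring_1) pol \<Rightarrow> ('v, 'k) endo"
  where "elmt i P = sub (\<lambda>v. if v = i then pvar i + P else pvar v)"

lemma alg_hom_elmt [simp]: "alg_hom (elmt i P)"
  by (simp add: elmt_def)

lemma elmt_pvar: "elmt i P (pvar v) = (if v = i then pvar i + P else pvar v)"
  by (simp add: elmt_def)

lemma elmt_var_free: "var_free i Q \<Longrightarrow> elmt i P Q = Q"
  using sub_cong_free[of i "\<lambda>v. if v = i then pvar i + P else pvar v" pvar Q] by (simp add: elmt_def)

lemma elmt_0 [simp]: "elmt i 0 = id"
  by (rule alg_hom_eqI) (auto simp: elmt_pvar)

lemma elmt_comp: "var_free i Q \<Longrightarrow> elmt i P \<circ> elmt i Q = elmt i (P + Q)"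
  by (rule alg_hom_eqI)
     (auto intro: alg_hom_comp simp: elmt_pvar alg_hom_simps[OF alg_hom_elmt] elmt_var_free add_ac)

lemma elmt_aut:
  assumes "var_free i P"
  shows "elmt i P \<in> alg_aut" "finv (elmt i P) = elmt i (- P)"
  using alg_autI[of "elmt i P" "elmt i (- P)"] elmt_comp[OF assms, of "- P"]
    elmt_comp[OF var_free_uminus[OF assms], of P] by (simp_all add: fun_eq_iff)

lemma elmt_in_elementary: "var_free i P \<Longrightarrow> elmt i P \<in> elementary_auts"
  unfolding elementary_auts_def
  by (auto simp: elmt_aut elmt_pvar var_free_def[symmetric] intro!: exI[of _ i] exI[of _ P])

lemma elementary_auts_iff: "f \<in> elementary_auts \<longleftrightarrow> (\<exists>i P. var_free i P \<and> f = elmt i P)"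
proof safe
  assume "f \<in> elementary_auts"
  then obtain i P where f: "f \<in> alg_aut" "var_free i P" "f (pvar i) = pvar i + P" "\<forall>j. j \<noteq> i \<longrightarrow> f (pvar j) = pvar j"
    by (auto simp: elementary_auts_def var_free_def)
  have "f = elmt i P"
    by (rule alg_aut_eqI) (use f in \<open>auto simp: elmt_aut elmt_pvar\<close>)
  thus "\<exists>i P. var_free i P \<and> f = elmt i P" using f by blast
qed (rule elmt_in_elementary)

text \<open>The torus normalises the root subgroup of all x_i -> x_i + c x^m and scales its
  parameter by the character t^m / t_i.\<close>

lemma dil_elmt_mterm:
  assumes "t i \<noteq> 0" "coef m i = 0"
  shows "dil t \<circ> elmt i (mterm m c) = elmt i (mterm m (c * mono_eval t m / t i)) \<circ> dil t"
  by (rule alg_hom_eqI)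
     (use assms in \<open>auto intro: alg_hom_comp simp: elmt_pvar alg_hom_simps[OF alg_hom_elmt]
        alg_hom_simps[OF alg_hom_dil] dil_mterm distrib_left pconst_mult_single mult_ac\<close>)

section \<open>Translations and evaluation at points\<close>

definition shift :: "('v \<Rightarrow> 'k::comm_ring_1) \<Rightarrow> ('v, 'k) endo"
  where "shift s = sub (\<lambda>v. pvar v + pconst (s v))"

lemma alg_hom_shift [simp]: "alg_hom (shift s)"
  by (simp add: shift_def)

lemma shift_pvar [simp]: "shift s (pvar v) = pvar v + pconst (s v)"
  by (simp add: shift_def)

lemma shift_comp: "shift s \<circ> shift t = shift (\<lambda>v. s v + t v)"
  by (rule alg_hom_eqI) (auto intro: alg_hom_comp simp: alg_hom_simps[OF alg_hom_shift] pconst_simps add_ac)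

lemma shift_0: "shift (\<lambda>_. 0) = id"
  by (rule alg_hom_eqI) (auto simp: pconst_simps)

lemma shift_aut [simp]: "shift s \<in> alg_aut" and finv_shift: "finv (shift s) = shift (\<lambda>v. - s v)"
proof -
  have *: "shift s (shift (\<lambda>v. - s v) p) = p" "shift (\<lambda>v. - s v) (shift s p) = p" for p
    using shift_comp[of s "\<lambda>v. - s v"] shift_comp[of "\<lambda>v. - s v" s] by (simp_all add: shift_0 fun_eq_iff)
  show "shift s \<in> alg_aut" 
    by (rule alg_autI[of _ "shift (\<lambda>v. - s v)"]; simp only: * alg_hom_shift)
  show "finv (shift s) = shift (\<lambda>v. - s v)"
    by (rule alg_autI; simp only: * alg_hom_shift)
qed

lemma shift_elmt: "elmt i (pconst c) = shift (\<lambda>v. if v = i then c else 0)"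
  by (rule alg_hom_eqI) (auto simp: elmt_pvar pconst_simps)

lemma shift_induct:
  fixes s :: "'v::finite \<Rightarrow> 'k::comm_ring_1"
  assumes "P id" "\<And>i c. P (elmt i (pconst c))" "\<And>f g. P f \<Longrightarrow> P g \<Longrightarrow> P (f \<circ> g)"
  shows "P (shift s)"
proof -
  have "P (shift (\<lambda>v. if v \<in> S then s v else 0))" if "finite S" for S
    using that
  proof induction
    case (insert x S)
    have "shift (\<lambda>v. if v \<in> insert x S then s v else 0) = 
        shift (\<lambda>v. if v = x then s x else 0) \<circ> shift (\<lambda>v. if v \<in> S then s v else 0)"
      unfolding shift_comp by (rule arg_cong[of _ _ shift]) (use insert in auto)
    moreover have "P (shift (\<lambda>v. if v = x then s x else 0) \<circ> shift (\<lambda>v. if v \<in> S then s v else 0))"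
      unfolding shift_elmt[symmetric] by (intro assms insert)
    ultimately show ?case by (simp only:)
  qed (simp only: empty_iff if_False shift_0 assms(1))
  from this[of UNIV] show ?thesis by simp
qed

lemma ring_hom_coef_0: "ring_hom_fun (\<lambda>p :: ('v, 'k::comm_ring_1) pol. coef p 0)"
proof -
  have 0: "m + n = 0 \<longleftrightarrow> m = 0 \<and> n = 0" for m n :: "'v \<Rightarrow>\<^sub>0 nat"
    by (auto simp: poly_mapping_eq_iff fun_eq_iff lookup_add)
  have "coef (p * q) 0 = coef p 0 * coef q 0" for p q :: "('v, 'k) pol"
  proof (induction p rule: pol_induct)
    case (mterm m c)
    show ?case
      by (induction q rule: pol_induct)
         (auto simp: mult_single lookup_single when_def 0 distrib_left lookup_add)
  qed (simp_all add: distrib_right lookup_add)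
  thus ?thesis by (simp add: ring_hom_fun_def lookup_add lookup_one)
qed

lemma ring_hom_fun_comp: "ring_hom_fun f \<Longrightarrow> ring_hom_fun g \<Longrightarrow> ring_hom_fun (\<lambda>x. f (g x))"
  by (simp add: ring_hom_fun_def)

lemma coef_0_sub: 
  fixes p :: "('v, 'k::comm_ring_1) pol"
  shows "coef (sub a p) 0 = pol_eval id (\<lambda>v. coef (a v) 0) p"
proof -
  have id: "ring_hom_fun (id :: 'k \<Rightarrow> 'k)" by (simp add: ring_hom_fun_def)
  have "(\<lambda>p. coef (sub a p) 0) = pol_eval id (\<lambda>v. coef (a v) 0)"
  proof (rule ring_hom_pol_eqI)
    show "ring_hom_fun (\<lambda>p. coef (sub a p) 0)"
      by (rule ring_hom_fun_comp[OF ring_hom_coef_0 alg_homD(1)[OF alg_hom_sub]])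
  qed (simp_all add: ring_hom_pol_eval[OF id] pol_eval_const[OF id] pol_eval_var[OF id] coef_pconst)
  thus ?thesis by (rule fun_cong)
qed

text \<open>Evaluation at the point \<open>s\<close> is the constant term of the translate by
  \<open>s\<close>; this turns translation invariance into a statement about values.\<close>

lemma coef_0_shift: "coef (shift s p) 0 = pol_eval id s p"
  by (simp add: shift_def coef_0_sub lookup_add coef_pvar coef_pconst poly_mapping_eq_iff[of 0] 
      fun_eq_iff lookup_single when_def)

text \<open>Invariance gives \<open>p\<close> its value at the origin at every point with
  coordinates u^(e v); were \<open>p\<close> minus that value nonzero,
  \<open>pol_nonvanishing\<close> would provide such a point with another value.\<close>

lemma shift_invariant_const:
  fixes p :: "('v::finite, 'k::idom) pol"
  assumes "\<And>u e. u \<in> U \<Longrightarrow> shift (\<lambda>v. u ^ e v) p = p" "infinite U"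
  shows "p = pconst (coef p 0)"
proof (rule ccontr)
  assume "p \<noteq> pconst (coef p 0)"
  then obtain u e where u: "u \<in> U" "pol_eval id (\<lambda>v. u ^ e v) (p - pconst (coef p 0)) \<noteq> 0"
    using pol_nonvanishing[of "p - pconst (coef p 0)" U] assms(2) by auto
  have id: "ring_hom_fun (id :: 'k \<Rightarrow> 'k)" by (simp add: ring_hom_fun_def)
  show False
    using u assms(1)[OF u(1), of e] coef_0_shift[of "\<lambda>v. u ^ e v" p]
    by (simp add: ring_hom_fun_simps(6)[OF ring_hom_pol_eval[OF id]] pol_eval_const[OF id])
qed

section \<open>Tame and nice automorphisms\<close>

lemma TAut_aut: 
  fixes f :: "('v::finite, 'k::field) endo"
  assumes "f \<in> TAut"
  shows "f \<in> alg_aut"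
proof -
  have "generate AutG (linear_auts \<union> elementary_auts) \<subseteq> carrier (AutG :: ('v, 'k) endo monoid)"
    by (rule group.generate_incl[OF group_AutG]) (auto simp: linear_auts_def elementary_auts_def)
  thus ?thesis using assms by (auto simp: TAut_def)
qed

lemma TAut_id [simp]: "id \<in> TAut"
  unfolding TAut_def using generate.one[of AutG] by simp

lemma TAut_comp: "f \<in> TAut \<Longrightarrow> g \<in> TAut \<Longrightarrow> f \<circ> g \<in> TAut"
  unfolding TAut_def using generate.eng[of f AutG _ g] by simp

lemma TAut_inv: "f \<in> TAut \<Longrightarrow> finv f \<in> TAut"
proof -
  assume f: "f \<in> TAut"
  have "inv\<^bsub>AutG\<^esub> f \<in> TAut" unfolding TAut_def
    by (rule group.generate_m_inv_closed[OF group_AutG])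
       (use f in \<open>auto simp: TAut_def linear_auts_def elementary_auts_def\<close>)
  thus ?thesis using inv_AutG[OF TAut_aut[OF f]] by simp
qed

lemma TAut_induct [consumes 1, case_names linear elementary comp inv]:
  assumes "f \<in> TAut" "\<And>f. f \<in> linear_auts \<Longrightarrow> P f" "\<And>i p. var_free i p \<Longrightarrow> P (elmt i p)"
    "\<And>f g. f \<in> TAut \<Longrightarrow> g \<in> TAut \<Longrightarrow> P f \<Longrightarrow> P g \<Longrightarrow> P (f \<circ> g)"
    "\<And>f. f \<in> TAut \<Longrightarrow> P f \<Longrightarrow> P (finv f)"
  shows "P f"
proof -
  have 1: "P h" "h \<in> TAut" if "h \<in> linear_auts \<union> elementary_auts" for h
    using that assms(2,3) generate.incl[OF that, of AutG] by (auto simp: elementary_auts_iff TAut_def)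
  \<comment> \<open>The identity is elementary with polynomial 0, so the induction rule has no
    separate case for it.\<close>
  have "id = elmt undefined 0" by simp
  hence id: "P id" using assms(3)[of undefined 0] by simp
  have "f \<in> generate AutG (linear_auts \<union> elementary_auts)" using assms(1) by (simp add: TAut_def)
  hence "f \<in> TAut \<and> P f"
  proof induction
    case (inv h)
    show ?case using 1[OF inv] assms(5) by (simp add: inv_AutG TAut_aut TAut_inv)
  qed (use 1 id assms(4) in \<open>simp_all only: AutG_simps TAut_comp TAut_id simp_thms\<close>)
  thus ?thesis by simp
qed

lemma elmt_TAut [simp]: "var_free i P \<Longrightarrow> elmt i P \<in> TAut"
  unfolding TAut_def by (rule generate.incl) (simp add: elmt_in_elementary)

lemma dil_TAut [simp]:
  assumes "\<forall>v. t v \<noteq> 0"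
  shows "dil t \<in> TAut"
proof -
  have "dil t (pvar i) = (\<Sum>j\<in>UNIV. pconst (if i = j then t j else 0) * pvar j)" for i
    by (simp add: if_distrib[of pconst] if_distrib[of "\<lambda>x. x * _"] pconst_simps cong: if_cong)
  hence "dil t \<in> linear_auts" using dil_aut[OF assms] unfolding linear_auts_def
    by (intro CollectI conjI exI[of _ "\<lambda>i j. if i = j then t j else 0"] allI)
  thus ?thesis unfolding TAut_def by (intro generate.incl) simp
qed

section \<open>Nice automorphisms and powers of the ideal of the origin\<close>

lemma NAut_aut: "f \<in> NAut \<Longrightarrow> f \<in> alg_aut"
  by (simp add: NAut_def)

lemma ideal_span_closed:
  fixes S :: "'a::comm_ring_1 set"
  shows "0 \<in> ideal_span S" "x \<in> S \<Longrightarrow> x \<in> ideal_span S"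
    "x \<in> ideal_span S \<Longrightarrow> y \<in> ideal_span S \<Longrightarrow> x + y \<in> ideal_span S"
    "x \<in> ideal_span S \<Longrightarrow> r * x \<in> ideal_span S"
  unfolding ideal_span_def
  by (auto intro: Modules.module.span_zero[OF module_mult] Modules.module.span_base[OF module_mult]
        Modules.module.span_add[OF module_mult] Modules.module.span_scale[OF module_mult])

lemma ideal_span_induct [consumes 1, case_names zero base]:
  fixes S :: "'a::comm_ring_1 set"
  assumes "x \<in> ideal_span S" "P 0" "\<And>r a y. a \<in> S \<Longrightarrow> P y \<Longrightarrow> P (r * a + y)"
  shows "P x"
  using Modules.module.span_induct_alt[OF module_mult, of x S P] assms unfolding ideal_span_def by blast

lemma ideal_power_ord_ge:
  assumes "p \<in> ideal_power (ideal_span (range pvar)) N"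
  shows "p \<in> ord_ge N"
proof -
  have 1: "q \<in> ord_ge 1" if "q \<in> ideal_span (range pvar)" for q :: "('a, 'b) pol"
    using that by (induction rule: ideal_span_induct)
      (auto intro!: ord_ge_add ord_ge_mult[of _ 0 _ 1, unfolded add_0_left] simp del: One_nat_def)
  have 2: "(\<Prod>k<N. a k) \<in> ord_ge N" if "\<forall>k<N. a k \<in> ideal_span (range pvar)" for a :: "nat \<Rightarrow> ('a, 'b) pol"
    using ord_ge_prod[of "{..<N}" a "\<lambda>_. 1"] that 1 by simp
  show ?thesis using assms unfolding ideal_power_def
    by (induction rule: ideal_span_induct) (auto intro!: ord_ge_add ord_ge_mult[of _ 0 _ N, unfolded add_0_left] 2)
qed

text \<open>The coefficient ring may change along \<open>h\<close>, so that dilations and extension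
  of scalars are covered at once.\<close>

lemma ideal_power_hom:
  fixes h :: "('v, 'a::comm_ring_1) pol \<Rightarrow> ('v, 'b::comm_ring_1) pol"
  assumes h: "ring_hom_fun h" "\<And>v. h (pvar v) \<in> ideal_span (range pvar)"
    and p: "p \<in> ideal_power (ideal_span (range pvar)) N"
  shows "h p \<in> ideal_power (ideal_span (range pvar)) N"
proof -
  note h_simps = ring_hom_fun_simps[OF h(1)]
  have 1: "h q \<in> ideal_span (range pvar)" if "q \<in> ideal_span (range pvar)" for q
    using that by (induction rule: ideal_span_induct)
      (auto simp: h_simps intro!: ideal_span_closed(1,3,4) h(2))
  show ?thesis using p unfolding ideal_power_def
  proof (induction rule: ideal_span_induct)
    case (base r a y)
    then obtain b where b: "\<forall>k<N. b k \<in> ideal_span (range pvar)" "a = prod b {..<N}" by auto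
    hence "h a \<in> {\<Prod>k<N. a k | a. \<forall>k<N. a k \<in> ideal_span (range pvar)}"
      by (auto simp: h_simps 1 intro!: exI[of _ "\<lambda>k. h (b k)"])
    from ideal_span_closed(3)[OF ideal_span_closed(4)[OF ideal_span_closed(2)[OF this]] base(2)]
    show ?case by (simp only: h_simps)
  qed (simp add: h_simps ideal_span_closed)
qed

lemma ideal_power_dil:
  assumes "p \<in> ideal_power (ideal_span (range pvar)) N"
  shows "dil t p \<in> ideal_power (ideal_span (range pvar)) N"
  by (rule ideal_power_hom[OF alg_homD(1)[OF alg_hom_dil] _ assms])
     (simp add: ideal_span_closed(4) ideal_span_closed(2)[OF rangeI])

text \<open>A tame factor on the right is absorbed into the tame part of each factorisation; the
  part close to the identity stays the same.\<close>

lemma NAut_TAut: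
  assumes "f \<in> NAut" "\<tau> \<in> TAut"
  shows "f \<circ> \<tau> \<in> NAut"
proof -
  have "\<exists>\<psi>\<in>alg_aut. \<exists>\<tau>'\<in>TAut. f \<circ> \<tau> = \<psi> \<circ> \<tau>' \<and>
      (\<forall>i. \<psi> (pvar i) - pvar i \<in> ideal_power (ideal_span (range pvar)) m)" for m
  proof -
    obtain \<psi> \<sigma> where *: "\<psi> \<in> alg_aut" "\<sigma> \<in> TAut" "f = \<psi> \<circ> \<sigma>"
      "\<forall>i. \<psi> (pvar i) - pvar i \<in> ideal_power (ideal_span (range pvar)) m"
      using assms(1) unfolding NAut_def by blast
    thus ?thesis using assms(2) by (intro bexI[of _ \<psi>] bexI[of _ "\<sigma> \<circ> \<tau>"]) (auto simp: TAut_comp)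
  qed
  thus ?thesis using assms by (auto simp: NAut_def alg_aut_comp TAut_aut)
qed

lemma NAut_id [simp]: "id \<in> NAut"
  unfolding NAut_def
  by (auto intro!: bexI[of _ id] simp: ideal_power_def ideal_span_closed(1))

lemma NAut_of_TAut [simp]: "f \<in> TAut \<Longrightarrow> f \<in> NAut"
  using NAut_TAut[OF NAut_id] by simp

text \<open>A diagonal automorphism preserves the powers of the ideal of the origin, so both factors
  of a factorisation can be conjugated separately.\<close>

lemma NAut_dil_conj:
  assumes "f \<in> NAut" "\<forall>v. t v \<noteq> 0"
  shows "dil t \<circ> f \<circ> finv (dil t) \<in> NAut"
proof -
  let ?d = "dil t" and ?e = "finv (dil t)"
  have d: "?d \<in> alg_aut" "?e \<in> alg_aut" using assms dil_aut alg_aut_inv by auto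
  have dT: "?d \<in> TAut" "?e \<in> TAut" using TAut_inv[OF dil_TAut[OF assms(2)]] assms(2) by simp_all
  have "\<exists>\<psi>\<in>alg_aut. \<exists>\<tau>\<in>TAut. ?d \<circ> f \<circ> ?e = \<psi> \<circ> \<tau> \<and>
      (\<forall>i. \<psi> (pvar i) - pvar i \<in> ideal_power (ideal_span (range pvar)) m)" for m
  proof -
    obtain \<psi> \<sigma> where *: "\<psi> \<in> alg_aut" "\<sigma> \<in> TAut" "f = \<psi> \<circ> \<sigma>"
      "\<forall>i. \<psi> (pvar i) - pvar i \<in> ideal_power (ideal_span (range pvar)) m"
      using assms(1) unfolding NAut_def by blast
    have "(?d \<circ> \<psi> \<circ> ?e) (pvar i) - pvar i = pconst (inverse (t i)) * ?d (\<psi> (pvar i) - pvar i)" for i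
      using assms(2) by (simp add: finv_dil alg_hom_simps[OF alg_hom_dil] alg_aut_simps[OF *(1)] 
          right_diff_distrib mult.assoc[symmetric] pconst_simps(4)[symmetric])
         (simp add: pconst_simps)
    hence "\<forall>i. (?d \<circ> \<psi> \<circ> ?e) (pvar i) - pvar i \<in> ideal_power (ideal_span (range pvar)) m"
      using *(4) ideal_power_dil[of _ m t] unfolding ideal_power_def
      by (auto intro: ideal_span_closed)
    moreover have "?d \<circ> f \<circ> ?e = (?d \<circ> \<psi> \<circ> ?e) \<circ> (?d \<circ> \<sigma> \<circ> ?e)"
      using *(3) d(1) by (simp add: o_assoc[symmetric])
    ultimately show ?thesis using * d dT 
      by (intro bexI[of _ "?d \<circ> \<psi> \<circ> ?e"] bexI[of _ "?d \<circ> \<sigma> \<circ> ?e"]) (auto simp: TAut_comp alg_aut_comp)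
  qed
  thus ?thesis using assms d by (auto simp: NAut_def alg_aut_comp)
qed

section \<open>Regular functions on curves\<close>

text \<open>Otherwise 1 plus the product of all X - a would be a nonconstant polynomial with
  constant value 1.\<close>

lemma alg_closed_infinite: "infinite (UNIV :: 'a::alg_closed_field set)"
proof
  assume fin: "finite (UNIV :: 'a set)"
  define p :: "'a poly" where "p = (\<Prod>a\<in>UNIV. [:- a, 1:]) + 1"
  have "degree (\<Prod>a\<in>(UNIV :: 'a set). [:- a, 1:]) = card (UNIV :: 'a set)"
    by (subst degree_prod_eq_sum_degree) auto
  moreover have "card (UNIV :: 'a set) > 0" using fin by (simp add: card_gt_0_iff)
  ultimately have "Polynomial.degree p > 0" unfolding p_def by (subst degree_add_eq_left) auto
  then obtain x where "poly p x = 0" using alg_closed_imp_poly_has_root by blast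
  moreover have "poly (\<Prod>a\<in>(UNIV :: 'a set). [:- a, 1:]) x = 0"
    using fin by (auto simp: poly_prod)
  ultimately show False by (simp add: p_def)
qed

lemma alg_closed_infinite_Compl: "finite A \<Longrightarrow> infinite (- A :: 'a::alg_closed_field set)"
  using finite_compl alg_closed_infinite by blast

lemma poly_eqI_cofinite:
  fixes p q :: "'a::idom poly"
  assumes "infinite A" "\<And>x. x \<in> A \<Longrightarrow> poly p x = poly q x"
  shows "p = q"
proof (rule ccontr)
  assume "p \<noteq> q"
  hence "finite {x. poly (p - q) x = 0}" by (intro poly_roots_finite) auto
  thus False using assms by (auto dest: finite_subset[rotated])
qed

text \<open>The order \<open>M\<close> of contact with a constant at \<open>0\<close> is recorded for the approximation argument
  by automorphisms that are the identity to high order; elsewhere \<open>M = 0\<close>.\<close>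

definition flat :: "nat \<Rightarrow> 'a::comm_ring_1 poly \<Rightarrow> bool"
  where "flat M p \<longleftrightarrow> Polynomial.monom 1 M dvd p - [:poly p 0:]"

lemma flat_0 [simp]: "flat 0 p"
  unfolding flat_def monom_0 pCons_one by (rule one_dvd)

lemma flat_const [simp]: "flat M [:c:]"
  by (simp add: flat_def)

lemma flat_add: "flat M p \<Longrightarrow> flat M q \<Longrightarrow> flat M (p + q)"
proof -
  assume "flat M p" "flat M q"
  hence "Polynomial.monom 1 M dvd (p - [:poly p 0:]) + (q - [:poly q 0:])"
    unfolding flat_def by (rule dvd_add)
  also have "\<dots> = p + q - [:poly (p + q) 0:]" by simp
  finally show ?thesis by (simp add: flat_def)
qed

lemma flat_mult: "flat M p \<Longrightarrow> flat M q \<Longrightarrow> flat M (p * q)"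
proof -
  assume "flat M p" "flat M q"
  hence "Polynomial.monom 1 M dvd (p - [:poly p 0:]) * q + [:poly p 0:] * (q - [:poly q 0:])"
    unfolding flat_def by (intro dvd_add dvd_mult dvd_mult2)
  also have "\<dots> = p * q - [:poly (p * q) 0:]" by (simp add: algebra_simps)
  finally show ?thesis by (simp add: flat_def)
qed

lemma flat_power: "flat M p \<Longrightarrow> flat M (p ^ k)"
  by (induction k) (auto intro: flat_mult simp: one_pCons simp del: pCons_one)

lemma flat_prod: "(\<And>i. i \<in> S \<Longrightarrow> flat M (p i)) \<Longrightarrow> flat M (prod p S)"
  by (induction S rule: infinite_finite_induct) (auto intro!: flat_mult simp: one_pCons simp del: pCons_one)

lemma flat_sum: "(\<And>i. i \<in> S \<Longrightarrow> flat M (p i)) \<Longrightarrow> flat M (sum p S)"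
  using flat_const[of M 0]
  by (induction S rule: infinite_finite_induct) (auto intro!: flat_add simp del: flat_const)

lemma flat_pol_eval: "(\<And>c. flat M (h c)) \<Longrightarrow> (\<And>v. flat M (a v)) \<Longrightarrow> flat M (pol_eval h a p)"
  unfolding pol_eval_def by (intro flat_sum flat_mult flat_prod flat_power)

lemma flat_coeff:
  assumes "flat M p" "0 < k" "k < M"
  shows "Polynomial.coeff p k = 0"
proof -
  obtain q where q: "p - [:poly p 0:] = Polynomial.monom 1 M * q" using assms(1) by (auto simp: flat_def dvd_def)
  have "Polynomial.coeff (p - [:poly p 0:]) k = 0"
    unfolding q using assms by (simp add: coeff_monom_mult)
  thus ?thesis using assms by (cases k) auto
qed

text \<open>The shape of \<open>regular_on\<close> after composition with a curve over
  \<open>D\<close>. There \<open>P\<close> and \<open>Q\<close> are polynomial expressions in the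
  coordinates of the curve, hence as flat at 0 as these are.\<close>

definition loc_rational :: "'a::field set \<Rightarrow> nat \<Rightarrow> ('a \<Rightarrow> 'a) \<Rightarrow> bool"
  where "loc_rational D M h \<longleftrightarrow> (\<forall>u\<in>D. \<exists>P Q. flat M P \<and> flat M Q \<and> poly Q u \<noteq> 0 \<and>
           (\<forall>w\<in>D. poly Q w \<noteq> 0 \<longrightarrow> h w = poly P w / poly Q w))"

lemma finite_compl_inter_roots:
  fixes Q :: "'a::alg_closed_field poly"
  assumes "finite (- D)" "Q \<noteq> 0"
  shows "infinite (D \<inter> {w. poly Q w \<noteq> 0})"
proof -
  have "finite (- D \<union> {w. poly Q w = 0})" using assms poly_roots_finite by auto
  hence "infinite (- (- D \<union> {w. poly Q w = 0}))" by (rule alg_closed_infinite_Compl)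
  moreover have "- (- D \<union> {w. poly Q w = 0}) = D \<inter> {w. poly Q w \<noteq> 0}" by auto
  ultimately show ?thesis by simp
qed

text \<open>Take a global quotient with a denominator of least degree: a zero of it in \<open>D\<close> would be a zero
  of the numerator by comparison with a local quotient at that point, and could be cancelled.\<close>

lemma loc_rational_global:
  fixes h :: "'a::alg_closed_field \<Rightarrow> 'a"
  assumes h: "loc_rational D M h" and D: "finite (- D)"
  shows "\<exists>P Q. (\<forall>w\<in>D. poly Q w \<noteq> 0 \<and> h w * poly Q w = poly P w)"
proof -
  \<comment> \<open>Finitely many exceptional points are tolerated at first, so that a single local
    quotient already qualifies.\<close>
  define good where "good = (\<lambda>PQ :: 'a poly \<times> 'a poly. snd PQ \<noteq> 0 \<and> 
      finite {w\<in>D. h w * poly (snd PQ) w \<noteq> poly (fst PQ) w})"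
  have good_iff: "good (P, Q) \<longleftrightarrow> Q \<noteq> 0 \<and> finite {w\<in>D. h w * poly Q w \<noteq> poly P w}" for P Q
    unfolding good_def fst_conv snd_conv ..
  have "infinite D" using alg_closed_infinite_Compl[OF D] by simp
  then obtain u where u: "u \<in> D" by (metis finite.emptyI ex_in_conv)
  have good_loc: "good (P, Q)" if "poly Q u \<noteq> 0" "\<forall>w\<in>D. poly Q w \<noteq> 0 \<longrightarrow> h w = poly P w / poly Q w" for P Q u
  proof -
    have "Q \<noteq> 0" using that by auto
    moreover have "{w\<in>D. h w * poly Q w \<noteq> poly P w} \<subseteq> {w. poly Q w = 0}" 
      using that(2) by (auto, metis nonzero_eq_divide_eq)
    ultimately show ?thesis unfolding good_iff using poly_roots_finite[of Q] finite_subset by blast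
  qed
  have "\<exists>PQ. good PQ" using h u good_loc unfolding loc_rational_def by blast
  then obtain PQ0 where "good PQ0" by blast
  define PQ where "PQ = arg_min (\<lambda>PQ. Polynomial.degree (snd PQ)) good"
  have PQ1: "good PQ" unfolding PQ_def by (rule arg_min_natI) fact
  have PQ2: "Polynomial.degree (snd PQ) \<le> Polynomial.degree (snd PQ')" if "good PQ'" for PQ'
    using arg_min_nat_le[of good PQ', OF that, of "\<lambda>PQ. Polynomial.degree (snd PQ)"] by (simp add: PQ_def)
  note PQ = PQ1 PQ2
  obtain P Q where PQ_eq: "PQ = (P, Q)" by force
  \<comment> \<open>Both quotients represent \<open>h\<close> up to finitely many points, so the
    identity holds at infinitely many points.\<close>
  have cross: "P * Q' = P' * Q" if "good (P', Q')" for P' Q'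
  proof (rule poly_eqI_cofinite)
    let ?B = "{w\<in>D. h w * poly Q w \<noteq> poly P w} \<union> {w\<in>D. h w * poly Q' w \<noteq> poly P' w}"
    have "finite {w\<in>D. h w * poly Q w \<noteq> poly P w}" "finite {w\<in>D. h w * poly Q' w \<noteq> poly P' w}"
      using PQ(1) that unfolding PQ_eq good_iff by blast+
    hence "finite (- D \<union> ?B)" using D by blast
    thus "infinite (- (- D \<union> ?B))" by (rule alg_closed_infinite_Compl)
  next
    fix x assume "x \<in> - (- D \<union> ({w\<in>D. h w * poly Q w \<noteq> poly P w} \<union> {w\<in>D. h w * poly Q' w \<noteq> poly P' w}))"
    hence "poly P x = h x * poly Q x" "poly P' x = h x * poly Q' x" by auto
    thus "poly (P * Q') x = poly (P' * Q) x" by simp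
  qed
  have "poly Q w \<noteq> 0 \<and> h w * poly Q w = poly P w" if w: "w \<in> D" for w
  proof -
    obtain P' Q' where *: "poly Q' w \<noteq> 0" "\<forall>w\<in>D. poly Q' w \<noteq> 0 \<longrightarrow> h w = poly P' w / poly Q' w"
      using h w unfolding loc_rational_def by blast
    have eq: "P * Q' = P' * Q" by (rule cross[OF good_loc[OF *]])
    have Qw: "poly Q w \<noteq> 0"
    proof
      assume Q0: "poly Q w = 0"
      hence "poly P w = 0" using arg_cong[OF eq, of "\<lambda>p. poly p w"] *(1) by simp
      then obtain P1 where P1: "P = [:-w, 1:] * P1" by (auto simp: poly_eq_0_iff_dvd dvd_def)
      obtain Q1 where Q1: "Q = [:-w, 1:] * Q1" using Q0 by (auto simp: poly_eq_0_iff_dvd dvd_def)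
      have "Q1 \<noteq> 0" using PQ(1) Q1 unfolding PQ_eq good_iff by auto
      have "{x\<in>D. h x * poly Q1 x \<noteq> poly P1 x} \<subseteq> insert w {x\<in>D. h x * poly Q x \<noteq> poly P x}"
      proof safe
        fix x assume x: "x \<in> D" "x \<noteq> w" "h x * poly Q1 x \<noteq> poly P1 x" "h x * poly Q x = poly P x"
        have "(x - w) * (h x * poly Q1 x) = (x - w) * poly P1 x"
          using x(4) unfolding P1 Q1 by (simp add: algebra_simps)
        thus False using x by simp
      qed
      moreover have "finite (insert w {x\<in>D. h x * poly Q x \<noteq> poly P x})"
        using PQ(1) unfolding PQ_eq good_iff by blast
      ultimately have "good (P1, Q1)" using \<open>Q1 \<noteq> 0\<close> unfolding good_iff by (blast intro: finite_subset)
      from PQ(2)[OF this] show False using \<open>Q1 \<noteq> 0\<close> by (simp add: PQ_eq Q1 degree_mult_eq del: mult_pCons_left)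
    qed
    have "h w * poly Q' w = poly P' w" using * w by simp
    hence "(h w * poly Q w) * poly Q' w = poly P w * poly Q' w"
      using arg_cong[OF eq, of "\<lambda>p. poly p w"] by (simp add: mult_ac)
    hence "h w * poly Q w = poly P w" using *(1) by simp
    with Qw show ?thesis by simp
  qed
  thus ?thesis by blast
qed

text \<open>The order of vanishing at 0 is additive, and that of \<open>Q\<close> is 0.\<close>

lemma monom_dvd_mult_cancel:
  fixes A Q :: "'a::field poly"
  assumes "Polynomial.monom 1 M dvd A * Q" "poly Q 0 \<noteq> 0"
  shows "Polynomial.monom 1 M dvd A"
proof -
  have *: "Polynomial.monom 1 M dvd p \<longleftrightarrow> p = 0 \<or> M \<le> Polynomial.order 0 p" for p :: "'a poly"
    using order_divides[of 0 M p] monom_altdef[of "1 :: 'a" M] by simp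
  have "Q \<noteq> 0" "Polynomial.order 0 Q = 0" using assms(2) by (auto simp: order_0I)
  thus ?thesis using assms(1) unfolding * by (cases "A = 0") (auto simp: order_mult)
qed

text \<open>A denominator without zeros on the line over an algebraically closed field is constant.
  Flatness is a local matter at 0: there \<open>h\<close> is a quotient of flat polynomials whose
  denominator does not vanish.\<close>

lemma loc_rational_UNIV:
  fixes h :: "'a::alg_closed_field \<Rightarrow> 'a"
  assumes h: "loc_rational UNIV M h"
  shows "\<exists>H. flat M H \<and> h = poly H"
proof -
  obtain P Q where PQ: "\<forall>w. poly Q w \<noteq> 0 \<and> h w * poly Q w = poly P w"
    using loc_rational_global[OF h] by auto
  have "Polynomial.degree Q = 0" using alg_closed_imp_poly_has_root[of Q] PQ by auto
  then obtain c where c: "Q = [:c:]" by (auto elim: degree_eq_zeroE)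
  define H where "H = Polynomial.smult (inverse c) P"
  have hH: "h w = poly H w" for w using PQ c by (simp add: H_def field_simps)
  obtain P' Q' where *: "flat M P'" "flat M Q'" "poly Q' 0 \<noteq> 0" 
    "\<forall>w. poly Q' w \<noteq> 0 \<longrightarrow> h w = poly P' w / poly Q' w"
    using h unfolding loc_rational_def by blast
  have "H * Q' = P'"
  proof (rule poly_eqI_cofinite)
    show "infinite (UNIV \<inter> {w. poly Q' w \<noteq> 0})" by (rule finite_compl_inter_roots) (use * in auto)
  qed (use * hH in auto)
  hence "(H - [:poly H 0:]) * Q' = (P' - [:poly P' 0:]) - [:poly H 0:] * (Q' - [:poly Q' 0:])"
    by (auto simp: algebra_simps)
  moreover have "Polynomial.monom 1 M dvd \<dots>"
    using *(1,2) unfolding flat_def by (rule dvd_diff[OF _ dvd_mult])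
  ultimately have "Polynomial.monom 1 M dvd H - [:poly H 0:]"
    using monom_dvd_mult_cancel *(3) by metis
  thus ?thesis using hH by (auto simp: flat_def)
qed

text \<open>The global denominator can vanish only at 0, so it is a constant times a power of
  \<open>u\<close>.\<close>

lemma loc_rational_nonzero:
  fixes h :: "'a::alg_closed_field \<Rightarrow> 'a"
  assumes h: "loc_rational (- {0}) M h"
  shows "\<exists>N H. \<forall>u. u \<noteq> 0 \<longrightarrow> h u * u ^ N = poly H u"
proof -
  obtain P Q where PQ: "\<forall>w\<in>-{0}. poly Q w \<noteq> 0 \<and> h w * poly Q w = poly P w"
    using loc_rational_global[OF h] by auto
  have "Q \<noteq> 0" using PQ[rule_format, of 1] by auto
  obtain R where R: "Q = [:- 0, 1:] ^ Polynomial.order 0 Q * R" "\<not> [:- 0, 1:] dvd R"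
    using order_decomp[OF \<open>Q \<noteq> 0\<close>, of 0] by blast
  have "poly Q w = w ^ Polynomial.order 0 Q * poly R w" for w by (subst R(1)) simp
  hence "poly R w \<noteq> 0" for w
    using PQ R(2) poly_eq_0_iff_dvd[of R 0] by (cases "w = 0") auto
  hence "Polynomial.degree R = 0" using alg_closed_imp_poly_has_root[of R] by auto
  then obtain c where c: "R = [:c:]" by (auto elim: degree_eq_zeroE)
  have c0: "c \<noteq> 0" using \<open>Q \<noteq> 0\<close> R(1) c by auto
  have "h u * u ^ Polynomial.order 0 Q = poly (Polynomial.smult (inverse c) P) u" if "u \<noteq> 0" for u
  proof -
    have "poly Q u = u ^ Polynomial.order 0 Q * c" by (subst R(1)) (simp add: c)
    moreover have "h u * poly Q u = poly P u" using PQ that by auto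
    ultimately show ?thesis using c0 by (simp add: field_simps)
  qed
  thus ?thesis by blast
qed

section \<open>Families of polynomials\<close>

definition fun_algebra :: "('u \<Rightarrow> 'a::comm_ring_1) set \<Rightarrow> bool"
  where "fun_algebra R \<longleftrightarrow> (\<forall>c. (\<lambda>_. c) \<in> R) \<and> (\<forall>f\<in>R. \<forall>g\<in>R. (\<lambda>u. f u + g u) \<in> R \<and> (\<lambda>u. f u * g u) \<in> R)"

text \<open>The polynomial ring over the function algebra \<open>R\<close>, with elements viewed as
  functions of the parameter. The degree bound is uniform in the parameter; without it the
  coefficientwise condition would allow infinitely many monomials.\<close>

definition families :: "('u \<Rightarrow> 'a::comm_ring_1) set \<Rightarrow> ('u \<Rightarrow> ('v::finite, 'a) pol) set"
  where "families R = {p. (\<exists>d. \<forall>u. p u \<in> deg_le d) \<and> (\<forall>m. (\<lambda>u. coef (p u) m) \<in> R)}"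

lemma fun_algebra_sum:
  assumes R: "fun_algebra R" and f: "\<And>i. i \<in> S \<Longrightarrow> f i \<in> R"
  shows "(\<lambda>u. \<Sum>i\<in>S. f i u) \<in> R"
  using f
proof (induction S rule: infinite_finite_induct)
  case (insert x F)
  moreover have "f x \<in> R" "(\<lambda>u. \<Sum>i\<in>F. f i u) \<in> R" using insert by auto
  ultimately show ?case using R unfolding fun_algebra_def by auto
qed (use R in \<open>auto simp: fun_algebra_def\<close>)

lemma card_exponents_less: "finite {m :: 'v::finite \<Rightarrow>\<^sub>0 nat. \<forall>v. coef m v < D}"
  "card {m :: 'v::finite \<Rightarrow>\<^sub>0 nat. \<forall>v. coef m v < D} \<le> D ^ CARD('v)"
proof -
  let ?A = "{m :: 'v \<Rightarrow>\<^sub>0 nat. \<forall>v. coef m v < D}" and ?F = "Pi\<^sub>E (UNIV :: 'v set) (\<lambda>_. {..<D})"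
  have F1: "finite ?F" by (rule finite_PiE) (rule finite, rule finite_lessThan)
  have F2: "card ?F = D ^ CARD('v)"
    unfolding card_PiE[OF finite] card_lessThan prod_constant ..
  note F = F1 F2
  have inj: "inj_on coef ?A" by (rule inj_onI) (rule poly_mapping_eqI, simp)
  have sub: "coef ` ?A \<subseteq> ?F" by (rule image_subsetI) (simp add: PiE_UNIV_domain)
  show "finite ?A" by (rule finite_imageD[OF finite_subset[OF sub F(1)] inj])
  show "card ?A \<le> D ^ CARD('v)" using card_inj_on_le[OF inj sub F(1)] F(2) by simp
qed

lemma finite_mon_degree_le: "finite {m :: 'v::finite \<Rightarrow>\<^sub>0 nat. mon_degree m \<le> d}"
  by (rule finite_subset[OF _ card_exponents_less(1)[of "Suc d"]])
     (use coef_le_mon_degree in \<open>fastforce intro: le_less_trans\<close>)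

lemma families_terms:
  assumes "p \<in> families R"
  shows "\<exists>S. finite S \<and> (\<forall>u. p u = (\<Sum>m\<in>S. mterm m (coef (p u) m)))"
proof -
  obtain d where d: "\<And>u. p u \<in> deg_le d" using assms by (auto simp: families_def)
  let ?S = "{m. mon_degree m \<le> d}"
  have "p u = (\<Sum>m\<in>?S. mterm m (coef (p u) m))" for u
    by (subst pol_sum_terms, rule sum.mono_neutral_left)
       (use d[of u] in \<open>auto simp: finite_mon_degree_le deg_le_def in_keys_iff\<close>)
  thus ?thesis using finite_mon_degree_le by blast
qed

context
  fixes R :: "('u \<Rightarrow> 'a::field) set"
  assumes R: "fun_algebra R"
begin

lemma families_const: "(\<lambda>_. p) \<in> families R"
  using R deg_le_ex[of p] by (auto simp: families_def fun_algebra_def)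

lemma families_add: "p \<in> families R \<Longrightarrow> q \<in> families R \<Longrightarrow> (\<lambda>u. p u + q u) \<in> families R"
proof -
  assume *: "p \<in> families R" "q \<in> families R"
  then obtain d e where "\<forall>u. p u \<in> deg_le d" "\<forall>u. q u \<in> deg_le e" by (auto simp: families_def)
  hence "\<forall>u. p u + q u \<in> deg_le (max d e)" by (auto intro!: deg_le_add intro: deg_le_mono)
  thus ?thesis using * R by (auto simp: families_def lookup_add fun_algebra_def)
qed

lemma families_mult: 
  assumes "p \<in> families R" "q \<in> families R" 
  shows "(\<lambda>u. p u * q u) \<in> families R"
proof -
  obtain d e where "\<forall>u. p u \<in> deg_le d" "\<forall>u. q u \<in> deg_le e" using assms by (auto simp: families_def)
  hence deg: "\<forall>u. p u * q u \<in> deg_le (d + e)" by (auto intro!: deg_le_mult)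
  obtain S where S: "\<forall>u. p u = (\<Sum>m\<in>S. mterm m (coef (p u) m))" using families_terms assms by blast
  obtain T where T: "\<forall>u. q u = (\<Sum>m\<in>T. mterm m (coef (q u) m))" using families_terms assms by blast
  have pq: "p u * q u = (\<Sum>m\<in>S. \<Sum>n\<in>T. mterm (m + n) (coef (p u) m * coef (q u) n))" for u
    by (subst S[rule_format], subst T[rule_format]) (simp add: sum_product mult_single)
  have "(\<lambda>u. coef (p u * q u) k) = (\<lambda>u. \<Sum>m\<in>S. \<Sum>n\<in>T. if m + n = k then coef (p u) m * coef (q u) n else 0)" for k
    unfolding pq by (simp add: lookup_sum lookup_single when_def)
  moreover have "(\<lambda>u. \<Sum>m\<in>S. \<Sum>n\<in>T. if m + n = k then coef (p u) m * coef (q u) n else 0) \<in> R" for k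
  proof (intro fun_algebra_sum[OF R])
    fix m n show "(\<lambda>u. if m + n = k then coef (p u) m * coef (q u) n else 0) \<in> R"
      by (cases "m + n = k") (use assms R in \<open>auto simp: families_def fun_algebra_def\<close>)
  qed
  ultimately show ?thesis using deg by (auto simp: families_def)
qed

lemma families_sum: "(\<And>i. i \<in> S \<Longrightarrow> p i \<in> families R) \<Longrightarrow> (\<lambda>u. \<Sum>i\<in>S. p i u) \<in> families R"
  by (induction S rule: infinite_finite_induct) (auto intro: families_const families_add)

lemma families_prod: "(\<And>i. i \<in> S \<Longrightarrow> p i \<in> families R) \<Longrightarrow> (\<lambda>u. \<Prod>i\<in>S. p i u) \<in> families R"
  by (induction S rule: infinite_finite_induct) (auto intro: families_const families_mult)

lemma families_power: "p \<in> families R \<Longrightarrow> (\<lambda>u. p u ^ k) \<in> families R"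
  by (induction k) (auto intro: families_const families_mult)

lemma families_endo:
  assumes "\<And>u. alg_hom (F u)" "\<And>v. (\<lambda>u. F u (pvar v)) \<in> families R"
  shows "(\<lambda>u. F u p) \<in> families R"
  by (subst alg_hom_conv[OF assms(1)], unfold pol_eval_def)
     (intro families_sum families_mult families_const families_prod families_power assms)

text \<open>In contrast to \<open>families_endo\<close> the homomorphism is fixed and its argument
  moves; it acts on the finitely many monomials that occur and leaves their coefficients
  alone.\<close>

lemma families_map:
  assumes "alg_hom f" "p \<in> families R"
  shows "(\<lambda>u. f (p u)) \<in> families R"
proof -
  obtain S where S: "\<forall>u. p u = (\<Sum>m\<in>S. mterm m (coef (p u) m))" using families_terms assms by blast
  have eq: "f (p u) = (\<Sum>m\<in>S. pconst (coef (p u) m) * f (mono_eval pvar m))" for u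
    by (subst S[rule_format]) (simp add: alg_hom_simps[OF assms(1)] mterm_conv)
  have *: "(\<lambda>u. pconst (coef (p u) m)) \<in> families R" for m
  proof -
    have "(\<lambda>u. if n = 0 then coef (p u) m else 0) \<in> R" for n :: "'v \<Rightarrow>\<^sub>0 nat"
      by (cases "n = 0") (use assms R in \<open>auto simp: families_def fun_algebra_def\<close>)
    thus ?thesis by (auto simp: families_def coef_pconst)
  qed
  show ?thesis unfolding eq by (intro families_sum families_mult families_const *)
qed

lemma families_conj:
  assumes "g \<in> alg_aut" "\<And>u. alg_hom (F u)" "\<And>v. (\<lambda>u. F u (pvar v)) \<in> families R"
  shows "(\<lambda>u. (finv g \<circ> F u \<circ> g) p) \<in> families R"
  using families_map[OF alg_aut_hom[OF alg_aut_inv[OF assms(1)]] families_endo[OF assms(2,3), of "g p"]] by simp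

end

lemma fun_algebra_flat: "fun_algebra {h. \<exists>H. flat M H \<and> h = poly H}"
  unfolding fun_algebra_def
proof (intro conjI allI ballI)
  fix c :: 'a show "(\<lambda>_. c) \<in> {h. \<exists>H. flat M H \<and> h = poly H}"
    by (auto intro!: exI[of _ "[:c:]"])
next
  fix f g :: "'a \<Rightarrow> 'a" assume "f \<in> {h. \<exists>H. flat M H \<and> h = poly H}" "g \<in> {h. \<exists>H. flat M H \<and> h = poly H}"
  then obtain F G where *: "flat M F" "flat M G" "f = poly F" "g = poly G" by auto
  thus "(\<lambda>u. f u + g u) \<in> {h. \<exists>H. flat M H \<and> h = poly H}"
    by (auto intro!: exI[of _ "F + G"] flat_add)
  show "(\<lambda>u. f u * g u) \<in> {h. \<exists>H. flat M H \<and> h = poly H}"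
    using * by (auto intro!: exI[of _ "F * G"] flat_mult)
qed

definition laurent :: "('a::field \<Rightarrow> 'a) set"
  where "laurent = {h. \<exists>N H. \<forall>u. u \<noteq> 0 \<longrightarrow> h u * u ^ N = poly H u}"

lemma fun_algebra_laurent: "fun_algebra laurent"
  unfolding fun_algebra_def
proof (intro conjI allI ballI)
  fix c :: 'a show "(\<lambda>_. c) \<in> laurent"
    unfolding laurent_def by (auto intro!: exI[of _ 0] exI[of _ "[:c:]"])
next
  fix f g :: "'a \<Rightarrow> 'a" assume "f \<in> laurent" "g \<in> laurent"
  then obtain N F K G where *: "\<And>u. u \<noteq> 0 \<Longrightarrow> f u * u ^ N = poly F u" "\<And>u. u \<noteq> 0 \<Longrightarrow> g u * u ^ K = poly G u" 
    by (auto simp: laurent_def)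
  have "(f u + g u) * u ^ (N + K) = poly (F * Polynomial.monom 1 K + G * Polynomial.monom 1 N) u" 
    "(f u * g u) * u ^ (N + K) = poly (F * G) u" if "u \<noteq> 0" for u
    unfolding poly_add poly_mult poly_monom *[OF that, symmetric] by (simp_all add: algebra_simps power_add)
  thus "(\<lambda>u. f u + g u) \<in> laurent" "(\<lambda>u. f u * g u) \<in> laurent" unfolding laurent_def by blast+
qed

section \<open>Weight spaces of a torus action\<close>

interpretation pol: vector_space "\<lambda>(c :: 'k::field) (p :: ('v, 'k) pol). pconst c * p"
  by unfold_locales (simp_all add: pconst_simps algebra_simps)

definition chr :: "('v::finite \<Rightarrow> int) \<Rightarrow> ('v \<Rightarrow> 'a::field) \<Rightarrow> 'a"
  where "chr \<mu> t = (\<Prod>v\<in>UNIV. t v powi \<mu> v)"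

text \<open>The one-parameter subgroup of the torus in direction \<open>i\<close>.\<close>

definition cochar :: "'v \<Rightarrow> 'a \<Rightarrow> 'v \<Rightarrow> 'a::one"
  where "cochar i u = (\<lambda>v. if v = i then u else 1)"

lemma cochar_nz [simp]: "u \<noteq> 0 \<Longrightarrow> cochar i u v \<noteq> (0 :: 'a::field)"
  by (simp add: cochar_def)

lemma chr_cochar [simp]: "chr \<mu> (cochar i u) = u powi \<mu> i"
  by (simp add: chr_def cochar_def if_distrib[of "\<lambda>x. x powi _"] cong: if_cong)

lemma chr_add: "\<forall>v. t v \<noteq> 0 \<Longrightarrow> chr (\<lambda>v. \<mu> v + \<psi> v) t = chr \<mu> t * chr \<psi> t"
  by (simp add: chr_def power_int_add prod.distrib)

lemma chr_mult: "chr \<mu> (\<lambda>v. s v * t v) = chr \<mu> s * chr \<mu> t"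
  by (simp add: chr_def power_int_mult_distrib prod.distrib)

lemma chr_0 [simp]: "chr (\<lambda>_. 0) t = 1"
  by (simp add: chr_def)

lemma chr_nz: "\<forall>v. t v \<noteq> 0 \<Longrightarrow> chr \<mu> t \<noteq> 0"
  by (simp add: chr_def)

lemma mono_eval_chr: "mono_eval t m = chr (\<lambda>v. int (coef m v)) t" for t :: "'v::finite \<Rightarrow> 'a::field"
  by (simp add: mono_eval_UNIV chr_def)

text \<open>Otherwise every nonzero element of an infinite field would be a root of X^n - 1, where n
  > 0 is the absolute value of \<open>k\<close>.\<close>

lemma powi_eq_1_imp:
  assumes "\<And>u :: 'a::alg_closed_field. u \<noteq> 0 \<Longrightarrow> u powi k = 1"
  shows "k = 0"
proof (rule ccontr)
  assume "k \<noteq> 0"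
  define n where "n = nat \<bar>k\<bar>"
  have n: "n > 0" using \<open>k \<noteq> 0\<close> by (simp add: n_def)
  have *: "u ^ n = 1" if "u \<noteq> 0" for u :: 'a
  proof -
    have "u ^ n = u powi k \<or> u ^ n = inverse (u powi k)"
      by (cases "k \<ge> 0") (auto simp: n_def power_int_def power_inverse)
    thus ?thesis using assms[OF that] by auto
  qed
  have "Polynomial.monom 1 n = (1 :: 'a poly)"
    by (rule poly_eqI_cofinite[of "- {0}"])
       (use * alg_closed_infinite_Compl[of "{0 :: 'a}"] in \<open>auto simp: poly_monom\<close>)
  thus False using n by (metis degree_1 degree_monom_eq less_irrefl zero_neq_one)
qed

lemma powi_inj:
  assumes "\<And>u :: 'a::alg_closed_field. u \<noteq> 0 \<Longrightarrow> u powi k = u powi l"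
  shows "k = l"
proof -
  have "k - l = 0" by (rule powi_eq_1_imp[where 'a = 'a]) (simp add: power_int_diff assms)
  thus ?thesis by simp
qed

lemma chr_inj:
  assumes "\<And>t :: 'v::finite \<Rightarrow> 'a::alg_closed_field. \<forall>v. t v \<noteq> 0 \<Longrightarrow> chr \<mu> t = chr \<psi> t"
  shows "\<mu> = \<psi>"
proof
  fix i
  have "u powi \<mu> i = u powi \<psi> i" if "u \<noteq> 0" for u :: 'a
    using assms[of "cochar i u"] that by simp
  thus "\<mu> i = \<psi> i" by (rule powi_inj)
qed

text \<open>Regrouping by powers of the parameter. One exponent \<open>N\<close> clears all
  denominators because the supports of all members lie in one finite set.\<close>

lemma families_laurent_expand:
  fixes p :: "'a::field \<Rightarrow> ('v::finite, 'a) pol"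
  assumes "p \<in> families laurent"
  shows "\<exists>N K q. \<forall>u. u \<noteq> 0 \<longrightarrow> pconst (u ^ N) * p u = (\<Sum>k\<le>K. pconst (u ^ k) * q k)"
proof -
  obtain S where S: "finite S" "\<forall>u. p u = (\<Sum>m\<in>S. mterm m (coef (p u) m))" 
    using families_terms[OF assms] by blast
  have "\<forall>m. \<exists>N H. \<forall>u. u \<noteq> 0 \<longrightarrow> coef (p u) m * u ^ N = poly H u"
    using assms by (auto simp: families_def laurent_def)
  then obtain N H where NH: "\<And>m u. u \<noteq> 0 \<Longrightarrow> coef (p u) m * u ^ N m = poly (H m) u" by metis
  define N' where "N' = (\<Sum>m\<in>S. N m)"
  define H' where "H' = (\<lambda>m. H m * Polynomial.monom 1 (N' - N m))"
  define K where "K = (\<Sum>m\<in>S. Polynomial.degree (H' m))"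
  have H': "u ^ N' * coef (p u) m = poly (H' m) u" if "u \<noteq> 0" "m \<in> S" for u m
  proof -
    have "N m \<le> N'" unfolding N'_def using that S(1) by (intro member_le_sum) auto
    hence "u ^ N' = u ^ N m * u ^ (N' - N m)" by (simp flip: power_add)
    thus ?thesis using NH[OF that(1), of m] by (simp add: H'_def poly_monom mult_ac)
  qed
  have poly_H': "poly (H' m) u = (\<Sum>k\<le>K. u ^ k * Polynomial.coeff (H' m) k)" if "m \<in> S" for m u
  proof -
    have "Polynomial.degree (H' m) \<le> K" unfolding K_def using that S(1) by (intro member_le_sum) auto
    thus ?thesis unfolding poly_altdef mult.commute[of _ "u ^ _"]
      by (intro sum.mono_neutral_left) (auto simp: coeff_eq_0)
  qed
  have main: "pconst (u ^ N') * p u = (\<Sum>k\<le>K. pconst (u ^ k) * (\<Sum>m\<in>S. mterm m (Polynomial.coeff (H' m) k)))"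
    if "u \<noteq> 0" for u
  proof -
    have "pconst (u ^ N') * p u = (\<Sum>m\<in>S. mterm m (poly (H' m) u))"
      by (subst S(2)[rule_format]) (use that in \<open>simp add: sum_distrib_left pconst_mult_single H'\<close>)
    also have "\<dots> = (\<Sum>m\<in>S. \<Sum>k\<le>K. mterm m (u ^ k * Polynomial.coeff (H' m) k))"
      by (intro sum.cong refl poly_mapping_eqI) (simp add: poly_H' lookup_single when_def lookup_sum)
    also have "\<dots> = (\<Sum>k\<le>K. pconst (u ^ k) * (\<Sum>m\<in>S. mterm m (Polynomial.coeff (H' m) k)))"
      by (subst sum.swap) (simp add: sum_distrib_left pconst_mult_single)
    finally show ?thesis .
  qed
  show ?thesis
    by (intro exI[of _ N'] exI[of _ K] exI[of _ "\<lambda>k. \<Sum>m\<in>S. mterm m (Polynomial.coeff (H' m) k)"] allI impI)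
       (rule main)
qed

text \<open>For each monomial both sides give polynomials in \<open>u\<close> that agree at
  infinitely many values.\<close>

lemma pol_coeff_compare:
  fixes a b :: "nat \<Rightarrow> ('v, 'a::alg_closed_field) pol"
  assumes "\<And>u. u \<noteq> 0 \<Longrightarrow> (\<Sum>k\<le>K. pconst (u ^ k) * a k) = (\<Sum>k\<le>K. pconst (u ^ k) * b k)" "k \<le> K"
  shows "a k = b k"
proof (rule poly_mapping_eqI)
  fix m
  define P where "P = (\<lambda>a. (\<Sum>k\<le>K. Polynomial.monom (coef (a k :: ('v, 'a) pol) m) k))"
  have P: "poly (P a) u = coef (\<Sum>k\<le>K. pconst (u ^ k) * a k) m" for a u
    by (simp add: P_def poly_sum poly_monom lookup_sum coef_pconst_mult) (simp add: mult.commute)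
  have "P a = P b"
    by (rule poly_eqI_cofinite[of "- {0}"]) (use P assms alg_closed_infinite_Compl[of "{0 :: 'a}"] in auto)
  moreover have "Polynomial.coeff (P a) k = coef (a k) m" for a
    using assms(2) by (simp add: P_def coeff_sum coeff_monom)
  ultimately show "coef (a k) m = coef (b k) m" by metis
qed

section \<open>Weight decomposition of algebraic torus actions\<close>

text \<open>Algebraicity is asked of the coordinate one-parameter subgroups alone. The value
  \<open>id\<close> at u = 0 is a placeholder, since this point lies outside the torus and
  \<open>laurent\<close> ignores it.\<close>

locale torus_action =
  fixes \<rho> :: "('v::finite \<Rightarrow> 'a::alg_closed_field) \<Rightarrow> ('v, 'a) endo"
  assumes aut: "\<forall>v. t v \<noteq> 0 \<Longrightarrow> \<rho> t \<in> alg_aut"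
    and comp: "\<forall>v. s v \<noteq> 0 \<Longrightarrow> \<forall>v. t v \<noteq> 0 \<Longrightarrow> \<rho> (\<lambda>v. s v * t v) = \<rho> s \<circ> \<rho> t"
    and laurent: "(\<lambda>u. (if u = 0 then id else \<rho> (cochar i u)) (pvar v)) \<in> families laurent"
begin

definition wt :: "('v \<Rightarrow> int) \<Rightarrow> ('v, 'a) pol set"
  where "wt \<mu> = {p. \<forall>t. (\<forall>v. t v \<noteq> 0) \<longrightarrow> \<rho> t p = pconst (chr \<mu> t) * p}"

lemmas aut_simps = alg_aut_simps[OF aut]

lemma commute: "\<forall>v. s v \<noteq> 0 \<Longrightarrow> \<forall>v. t v \<noteq> 0 \<Longrightarrow> \<rho> s (\<rho> t p) = \<rho> t (\<rho> s p)"
  using comp[of s t] comp[of t s] by (simp add: mult.commute fun_eq_iff)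

lemma rho_one: "\<rho> (\<lambda>_. 1) = id"
proof -
  have 1: "\<rho> (\<lambda>_. 1) \<in> alg_aut" by (rule aut) simp
  have "\<rho> (\<lambda>_. 1) (\<rho> (\<lambda>_. 1) p) = \<rho> (\<lambda>_. 1) p" for p using comp[of "\<lambda>_. 1" "\<lambda>_. 1"] by (simp add: fun_eq_iff)
  hence "\<rho> (\<lambda>_. 1) p = p" for p using alg_aut_inv_simps(2)[OF 1] by metis
  thus ?thesis by auto
qed

lemma wt_add: "p \<in> wt \<mu> \<Longrightarrow> q \<in> wt \<mu> \<Longrightarrow> p + q \<in> wt \<mu>"
  by (simp add: wt_def aut_simps distrib_left)

lemma wt_scale: "p \<in> wt \<mu> \<Longrightarrow> pconst c * p \<in> wt \<mu>"
  by (simp add: wt_def aut_simps mult_ac)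

lemma wt_0 [simp]: "0 \<in> wt \<mu>"
  by (simp add: wt_def aut_simps)

lemma wt_sum: "(\<And>i. i \<in> S \<Longrightarrow> p i \<in> wt \<mu>) \<Longrightarrow> sum p S \<in> wt \<mu>"
  by (induction S rule: infinite_finite_induct) (auto intro: wt_add)

lemma wt_mult: "p \<in> wt \<mu> \<Longrightarrow> q \<in> wt \<psi> \<Longrightarrow> p * q \<in> wt (\<lambda>v. \<mu> v + \<psi> v)"
  by (simp add: wt_def aut_simps chr_add pconst_simps mult_ac)

lemma wt_pconst: "pconst c \<in> wt (\<lambda>_. 0)"
  by (simp add: wt_def aut_simps pconst_simps)

lemma wt_power: "p \<in> wt \<mu> \<Longrightarrow> p ^ k \<in> wt (\<lambda>v. int k * \<mu> v)"
proof (induction k)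
  case (Suc k)
  from wt_mult[OF Suc.prems Suc.IH[OF Suc.prems]] show ?case by (simp add: algebra_simps)
qed (use wt_pconst[of 1] in \<open>simp add: pconst_simps\<close>)

lemma wt_prod: "(\<And>i. i \<in> S \<Longrightarrow> p i \<in> wt (\<mu> i)) \<Longrightarrow> prod p S \<in> wt (\<lambda>v. \<Sum>i\<in>S. \<mu> i v)"
  by (induction S rule: infinite_finite_induct) 
     (use wt_pconst[of 1] in \<open>auto simp: pconst_simps intro: wt_mult\<close>)

text \<open>An invariant subspace contains the weight components of its elements: for suitable
  \<open>t\<close> the operator \<rho> t - chr x t kills the component of weight \<open>x\<close>
  and multiplies that of another weight by a nonzero scalar. With W = {0} this is the independence
  of vectors of distinct weights.\<close>

lemma wt_isolate:
  assumes W: "pol.subspace W" "\<And>t p. \<forall>v. t v \<noteq> 0 \<Longrightarrow> p \<in> W \<Longrightarrow> \<rho> t p \<in> W"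
    and S: "finite S" "\<And>\<mu>. \<mu> \<in> S \<Longrightarrow> p \<mu> \<in> wt \<mu>" "(\<Sum>\<mu>\<in>S. p \<mu>) \<in> W" "\<mu> \<in> S"
  shows "p \<mu> \<in> W"
  using S
proof (induction S arbitrary: p \<mu>)
  case (insert x S)
  have S: "p \<mu> \<in> W" if \<mu>: "\<mu> \<in> S" for \<mu>
  proof -
    have "x \<noteq> \<mu>" using insert \<mu> by auto
    then obtain t where t: "\<forall>v. t v \<noteq> (0 :: 'a)" "chr x t \<noteq> chr \<mu> t" using chr_inj by blast
    have "(\<Sum>\<psi>\<in>S. pconst (chr \<psi> t - chr x t) * p \<psi>) = \<rho> t (\<Sum>\<psi>\<in>insert x S. p \<psi>) - pconst (chr x t) * (\<Sum>\<psi>\<in>insert x S. p \<psi>)"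
    proof -
      have "\<rho> t (p \<psi>) = pconst (chr \<psi> t) * p \<psi>" if "\<psi> \<in> insert x S" for \<psi>
        using insert.prems(1)[OF that] t by (simp add: wt_def)
      thus ?thesis using insert.hyps t(1)
        by (simp add: aut_simps sum_distrib_left distrib_left pconst_simps left_diff_distrib sum_subtractf)
    qed
    also have "\<dots> \<in> W" using W insert.prems t by (intro pol.subspace_diff pol.subspace_scale) auto
    finally have "pconst (chr \<mu> t - chr x t) * p \<mu> \<in> W"
      using insert.IH[of "\<lambda>\<psi>. pconst (chr \<psi> t - chr x t) * p \<psi>" \<mu>] insert.prems \<mu> by (simp add: wt_scale)
    from pol.subspace_scale[OF W(1) this, of "inverse (chr \<mu> t - chr x t)"] t(2) show ?thesis
      by (simp add: mult.assoc[symmetric] pconst_simps(4)[symmetric])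
  qed
  show ?case
  proof (cases "\<mu> = x")
    case True
    have "(\<Sum>\<psi>\<in>S. p \<psi>) \<in> W" using S by (intro pol.subspace_sum W)
    with insert.prems(2) have "(\<Sum>\<psi>\<in>insert x S. p \<psi>) - (\<Sum>\<psi>\<in>S. p \<psi>) \<in> W"
      by (intro pol.subspace_diff W)
    thus ?thesis using True insert.hyps by simp
  qed (use S insert.prems in auto)
qed auto

text \<open>Expand the orbit of \<open>p\<close> in powers of \<open>u\<close>. Comparing
  coefficients in \<rho>(w) \<rho>(u) p = \<rho>(w u) p makes each coefficient an eigenvector, u = 1
  gives the sum, and commutativity of the torus transfers the eigenvalues already known for
  \<open>J\<close>.\<close>

lemma one_parameter_decomposition:
  assumes p: "\<And>j u. j \<in> J \<Longrightarrow> u \<noteq> 0 \<Longrightarrow> \<rho> (cochar j u) p = pconst (u powi \<mu> j) * p"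
  shows "\<exists>K N q. p = (\<Sum>k\<le>K. q k) \<and> (\<forall>k\<le>K. \<forall>u. u \<noteq> 0 \<longrightarrow> 
      \<rho> (cochar i u) (q k) = pconst (u powi (int k - int N)) * q k \<and>
      (\<forall>j\<in>J. \<rho> (cochar j u) (q k) = pconst (u powi \<mu> j) * q k))"
proof -
  have "(\<lambda>u. (if u = 0 then id else \<rho> (cochar i u)) p) \<in> families laurent"
    by (rule families_endo[OF fun_algebra_laurent, where F = "\<lambda>u. if u = 0 then id else \<rho> (cochar i u)"])
       (simp_all add: laurent alg_aut_hom aut)
  then obtain N K q where "\<forall>u. u \<noteq> 0 \<longrightarrow> pconst (u ^ N) * (if u = 0 then id else \<rho> (cochar i u)) p = (\<Sum>k\<le>K. pconst (u ^ k) * q k)"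
    using families_laurent_expand by blast
  hence q: "pconst (u ^ N) * \<rho> (cochar i u) p = (\<Sum>k\<le>K. pconst (u ^ k) * q k)" if "u \<noteq> 0" for u
    using that by auto
  have cc: "\<rho> (cochar i 1) = id"
    using rho_one by (simp add: cochar_def if_distrib cong: if_cong)
  have "p = (\<Sum>k\<le>K. q k)" using q[of 1] by (simp add: pconst_simps cc)
  moreover have "\<rho> (cochar i w) (q k) = pconst (w powi (int k - int N)) * q k" if k: "k \<le> K" and w: "w \<noteq> 0" for k w
  proof -
    define A where "A = \<rho> (cochar i w)"
    have A: "alg_hom A" unfolding A_def using w by (intro alg_aut_hom aut) simp
    have "pconst (w ^ N) * A (q k) = pconst (w ^ k) * q k"
    proof (rule pol_coeff_compare[where K = K and a = "\<lambda>k. pconst (w ^ N) * A (q k)" and b = "\<lambda>k. pconst (w ^ k) * q k", OF _ k])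
      fix u :: 'a assume u: "u \<noteq> 0"
      have comp': "A (\<rho> (cochar i u) p) = \<rho> (cochar i (w * u)) p"
      proof -
        have "(\<lambda>v. cochar i w v * cochar i u v) = cochar i (w * u)" by (auto simp: cochar_def)
        with comp[of "cochar i w" "cochar i u"] w u show ?thesis by (simp add: fun_eq_iff A_def)
      qed
      have "(\<Sum>k\<le>K. pconst (u ^ k) * (pconst (w ^ N) * A (q k))) = pconst (w ^ N) * A (\<Sum>k\<le>K. pconst (u ^ k) * q k)"
        by (simp add: alg_hom_simps[OF A] sum_distrib_left mult.left_commute)
      also have "A (\<Sum>k\<le>K. pconst (u ^ k) * q k) = pconst (u ^ N) * \<rho> (cochar i (w * u)) p"
        by (simp only: q[OF u, symmetric] alg_hom_simps(4)[OF A] alg_hom_simps(10)[OF A] comp')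
      also have "pconst (w ^ N) * (pconst (u ^ N) * \<rho> (cochar i (w * u)) p) = pconst ((w * u) ^ N) * \<rho> (cochar i (w * u)) p"
        by (simp only: power_mult_distrib pconst_simps(4) mult.assoc)
      also have "\<dots> = (\<Sum>k\<le>K. pconst (u ^ k) * (pconst (w ^ k) * q k))"
        using q[of "w * u"] w u by (simp only: mult_eq_0_iff simp_thms power_mult_distrib[of w u] pconst_simps(4) mult.assoc mult.left_commute[of "pconst (w ^ _)"] refl)
      finally show "(\<Sum>k\<le>K. pconst (u ^ k) * (pconst (w ^ N) * A (q k))) = (\<Sum>k\<le>K. pconst (u ^ k) * (pconst (w ^ k) * q k))" .
    qed
    hence "pconst (inverse (w ^ N)) * (pconst (w ^ N) * A (q k)) = pconst (inverse (w ^ N)) * (pconst (w ^ k) * q k)" by simp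
    hence "A (q k) = pconst (inverse (w ^ N) * w ^ k) * q k" using w
      unfolding mult.assoc[symmetric] pconst_simps(4)[symmetric] by (simp add: pconst_simps(2))
    thus ?thesis using w by (simp add: A_def power_int_diff field_simps)
  qed
  moreover have "\<rho> (cochar j w) (q k) = pconst (w powi \<mu> j) * q k" if k: "k \<le> K" and w: "w \<noteq> 0" and j: "j \<in> J" for k w j
  proof -
    define A where "A = \<rho> (cochar j w)"
    have A: "alg_hom A" unfolding A_def using w by (intro alg_aut_hom aut) simp
    have "A (q k) = pconst (w powi \<mu> j) * q k"
    proof (rule pol_coeff_compare[where K = K and a = "\<lambda>k. A (q k)" and b = "\<lambda>k. pconst (w powi \<mu> j) * q k", OF _ k])
      fix u :: 'a assume u: "u \<noteq> 0"
      have B: "alg_hom (\<rho> (cochar i u))" using u by (intro alg_aut_hom aut) simp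
      have "(\<Sum>k\<le>K. pconst (u ^ k) * A (q k)) = A (\<Sum>k\<le>K. pconst (u ^ k) * q k)"
        by (simp add: alg_hom_simps[OF A])
      also have "\<dots> = pconst (u ^ N) * \<rho> (cochar i u) (A p)"
        using w u commute[of "cochar i u" "cochar j w" p] by (simp add: q[OF u, symmetric] alg_hom_simps[OF A] A_def[symmetric])
      also have "A p = pconst (w powi \<mu> j) * p" using p[OF j w] by (simp add: A_def)
      also have "pconst (u ^ N) * \<rho> (cochar i u) (pconst (w powi \<mu> j) * p) = pconst (w powi \<mu> j) * (\<Sum>k\<le>K. pconst (u ^ k) * q k)"
        unfolding q[OF u, symmetric] alg_hom_simps[OF B] by (rule mult.left_commute)
      finally show "(\<Sum>k\<le>K. pconst (u ^ k) * A (q k)) = (\<Sum>k\<le>K. pconst (u ^ k) * (pconst (w powi \<mu> j) * q k))"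
        by (simp add: sum_distrib_left mult.left_commute)
    qed
    thus ?thesis by (simp add: A_def)
  qed
  ultimately show ?thesis by blast
qed

text \<open>The coordinate one-parameter subgroups generate the torus; a torus element is multiplied
  together one coordinate at a time.\<close>

lemma wt_alt: "wt \<mu> = {p. \<forall>j u. u \<noteq> 0 \<longrightarrow> \<rho> (cochar j u) p = pconst (u powi \<mu> j) * p}"
proof safe
  fix p j and u :: 'a assume "p \<in> wt \<mu>" "u \<noteq> 0"
  thus "\<rho> (cochar j u) p = pconst (u powi \<mu> j) * p" by (simp add: wt_def)
next
  fix p assume p: "\<forall>j u. u \<noteq> 0 \<longrightarrow> \<rho> (cochar j u) p = pconst (u powi \<mu> j) * p"
  have "\<rho> (\<lambda>v. if v \<in> S then t v else 1) p = pconst (chr \<mu> (\<lambda>v. if v \<in> S then t v else 1)) * p" 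
    if t: "\<forall>v. t v \<noteq> 0" and "finite S" for t S
    using that(2)
  proof induction
    case empty show ?case by (simp add: rho_one chr_def pconst_simps)
  next
    case (insert x S)
    have eq: "(\<lambda>v. if v \<in> insert x S then t v else 1) = (\<lambda>v. cochar x (t x) v * (if v \<in> S then t v else 1))"
      using insert by (auto simp: cochar_def)
    have "\<rho> (\<lambda>v. if v \<in> insert x S then t v else 1) p = \<rho> (cochar x (t x)) (\<rho> (\<lambda>v. if v \<in> S then t v else 1) p)"
      unfolding eq using t by (subst comp) auto
    also have "\<dots> = pconst (chr \<mu> (\<lambda>v. if v \<in> S then t v else 1)) * (pconst (t x powi \<mu> x) * p)"
      using t p by (simp add: insert aut_simps)
    also have "\<dots> = pconst (chr \<mu> (\<lambda>v. if v \<in> insert x S then t v else 1)) * p"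
      unfolding eq chr_mult by (simp add: pconst_simps mult_ac)
    finally show ?case .
  qed
  from this[of _ UNIV] show "p \<in> wt \<mu>" by (simp add: wt_def)
qed

text \<open>The coordinate subgroups are diagonalised one after another: \<open>B J\<close> consists
  of the common eigenvectors of those indexed by \<open>J\<close>.\<close>

lemma span_wt: "p \<in> pol.span (\<Union>\<mu>. wt \<mu>)"
proof -
  define B where "B = (\<lambda>J. \<Union>\<mu>. {p. \<forall>j\<in>J. \<forall>u. u \<noteq> 0 \<longrightarrow> \<rho> (cochar j u) p = pconst (u powi \<mu> j) * p})"
  have "p \<in> pol.span (B J)" if "finite J" for J
    using that
  proof induction
    case empty show ?case by (rule pol.span_base) (simp add: B_def)
  next
    case (insert i J)
    have "B J \<subseteq> pol.span (B (insert i J))"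
    proof
      fix p assume "p \<in> B J"
      then obtain \<mu> where \<mu>: "\<And>j u. j \<in> J \<Longrightarrow> u \<noteq> 0 \<Longrightarrow> \<rho> (cochar j u) p = pconst (u powi \<mu> j) * p" 
        by (auto simp: B_def)
      obtain K N q where q: "p = (\<Sum>k\<le>K. q k)" "\<And>k u. k \<le> K \<Longrightarrow> u \<noteq> 0 \<Longrightarrow> 
          \<rho> (cochar i u) (q k) = pconst (u powi (int k - int N)) * q k"
          "\<And>k u j. k \<le> K \<Longrightarrow> u \<noteq> 0 \<Longrightarrow> j \<in> J \<Longrightarrow> \<rho> (cochar j u) (q k) = pconst (u powi \<mu> j) * q k"
        using one_parameter_decomposition[of J p \<mu> i, OF \<mu>] by blast
      have "q k \<in> B (insert i J)" if "k \<le> K" for k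
        unfolding B_def UN_iff using q that insert.hyps
        by (intro bexI[of _ "\<mu>(i := int k - int N)"]) auto
      thus "p \<in> pol.span (B (insert i J))" unfolding q(1) by (intro pol.span_sum pol.span_base) auto
    qed
    thus ?case using insert.IH pol.span_minimal[OF _ pol.subspace_span] by blast
  qed
  from this[of UNIV] show ?thesis by (simp add: B_def wt_alt)
qed

lemma span_wt_decomposition:
  assumes "p \<in> pol.span (\<Union>(wt ` Y))"
  shows "\<exists>S q. finite S \<and> S \<subseteq> Y \<and> (\<forall>\<mu>. q \<mu> \<in> wt \<mu>) \<and> p = (\<Sum>\<mu>\<in>S. q \<mu>)"
  using assms
proof (induction rule: pol.span_induct_alt)
  case base show ?case by (intro exI[of _ "{}"] exI[of _ "\<lambda>_. 0"]) simp
next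
  case (step c x y)
  then obtain S q \<psi> where *: "finite S" "S \<subseteq> Y" "\<psi> \<in> Y" "\<forall>\<mu>. q \<mu> \<in> wt \<mu>" "y = (\<Sum>\<mu>\<in>S. q \<mu>)" "x \<in> wt \<psi>" by auto
  define q' where "q' = (\<lambda>\<mu>. (if \<mu> \<in> S then q \<mu> else 0) + (if \<mu> = \<psi> then pconst c * x else 0))"
  have "(\<Sum>\<mu>\<in>insert \<psi> S. q' \<mu>) = (\<Sum>\<mu>\<in>insert \<psi> S. if \<mu> \<in> S then q \<mu> else 0) + pconst c * x"
    unfolding q'_def sum.distrib using * by simp
  also have "(\<Sum>\<mu>\<in>insert \<psi> S. if \<mu> \<in> S then q \<mu> else 0) = y"
    unfolding *(5) using *(1) by (intro sum.mono_neutral_cong_right) auto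
  finally have "pconst c * x + y = (\<Sum>\<mu>\<in>insert \<psi> S. q' \<mu>)" by (simp add: add.commute)
  moreover have "\<forall>\<mu>. q' \<mu> \<in> wt \<mu>" using * by (auto simp: q'_def intro!: wt_add wt_scale)
  ultimately show ?case using *(1-3) by (intro exI[of _ "insert \<psi> S"] exI[of _ q']) auto
qed

lemma wt_decomposition: "\<exists>S q. finite S \<and> (\<forall>\<mu>. q \<mu> \<in> wt \<mu>) \<and> p = (\<Sum>\<mu>\<in>S. q \<mu>)"
proof -
  have "p \<in> pol.span (\<Union>(wt ` UNIV))" by (rule span_wt)
  from span_wt_decomposition[OF this] show ?thesis by (elim exE conjE) (intro exI conjI; assumption)
qed

end

section \<open>Linearisation of torus actions with one-dimensional weight spaces\<close>

text \<open>The sum is a binary form of degree \<open>N\<close> in f and g, with dehomogenisation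
  \<open>q\<close>. Over an algebraically closed field it splits into factors f - r g and g, none of
  which is zero. Hence the products f^k g^(N - k) are linearly independent.\<close>

lemma binary_form_nonzero:
  fixes f g :: "('v::finite, 'a::alg_closed_field) pol"
  assumes "\<And>c. f \<noteq> pconst c * g" "g \<noteq> 0" "q \<noteq> 0" "Polynomial.degree q \<le> N"
  shows "(\<Sum>k\<le>N. pconst (Polynomial.coeff q k) * (f ^ k * g ^ (N - k))) \<noteq> 0"
  using assms(3,4)
proof (induction N arbitrary: q)
  case 0
  then obtain c where "q = [:c:]" by (auto elim: degree_eq_zeroE)
  thus ?case using 0 pconst_eq_iff[of c 0] by (simp add: pconst_simps)
next
  case (Suc N)
  show ?case
  proof (cases "Polynomial.degree q = 0")
    case True
    then obtain c where c: "q = [:c:]" by (auto elim: degree_eq_zeroE)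
    have eq: "(\<Sum>k\<le>Suc N. pconst (Polynomial.coeff q k) * (f ^ k * g ^ (Suc N - k))) = pconst c * g ^ Suc N"
      unfolding sum.atMost_Suc_shift by (simp add: c pconst_simps)
    have "pconst c \<noteq> (0 :: ('v, 'a) pol)" using Suc.prems c pconst_eq_iff[of c 0] by (simp add: pconst_simps)
    thus ?thesis unfolding eq by (rule pol_mult_nonzero[OF _ pol_power_nonzero[OF assms(2)]])
  next
    case False
    then obtain r where "poly q r = 0" using alg_closed_imp_poly_has_root by blast
    then obtain q1 where q1: "q = [:-r, 1:] * q1" by (auto simp: poly_eq_0_iff_dvd dvd_def)
    have "q1 \<noteq> 0" using Suc.prems q1 by auto
    hence deg: "Polynomial.degree q1 \<le> N" using Suc.prems(2) unfolding q1 by (subst (asm) degree_mult_eq) auto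
    let ?H = "\<Sum>k\<le>N. pconst (Polynomial.coeff q1 k) * (f ^ k * g ^ (N - k))"
    have c0: "Polynomial.coeff q1 (Suc N) = 0" using deg by (simp add: coeff_eq_0)
    have coeff_q: "Polynomial.coeff q k = (if k = 0 then 0 else Polynomial.coeff q1 (k - 1)) - r * Polynomial.coeff q1 k" for k
      unfolding q1 by (cases k) simp_all
    have "(\<Sum>k\<le>Suc N. pconst (Polynomial.coeff q k) * (f ^ k * g ^ (Suc N - k)))
      = (\<Sum>k\<le>Suc N. pconst (if k = 0 then 0 else Polynomial.coeff q1 (k - 1)) * (f ^ k * g ^ (Suc N - k)))
        - pconst r * (\<Sum>k\<le>Suc N. pconst (Polynomial.coeff q1 k) * (f ^ k * g ^ (Suc N - k)))"
      unfolding coeff_q by (simp only: pconst_simps left_diff_distrib sum_subtractf sum_distrib_left mult.assoc)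
    also have "(\<Sum>k\<le>Suc N. pconst (if k = 0 then 0 else Polynomial.coeff q1 (k - 1)) * (f ^ k * g ^ (Suc N - k))) = f * ?H"
      unfolding sum.atMost_Suc_shift by (simp add: sum_distrib_left pconst_simps mult_ac)
    also have "(\<Sum>k\<le>Suc N. pconst (Polynomial.coeff q1 k) * (f ^ k * g ^ (Suc N - k))) = g * ?H"
      by (simp add: c0 pconst_simps sum_distrib_left Suc_diff_le mult_ac)
    also have "f * ?H - pconst r * (g * ?H) = (f - pconst r * g) * ?H" by (simp add: algebra_simps)
    finally have eq: "(\<Sum>k\<le>Suc N. pconst (Polynomial.coeff q k) * (f ^ k * g ^ (Suc N - k))) = (f - pconst r * g) * ?H" .
    have "f - pconst r * g \<noteq> 0" using assms(1)[of r] by simp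
    thus ?thesis unfolding eq by (rule pol_mult_nonzero[OF _ Suc.IH[OF \<open>q1 \<noteq> 0\<close> deg]])
  qed
qed

lemma binary_form_eq_0:
  fixes f g :: "('v::finite, 'a::alg_closed_field) pol"
  assumes "\<And>c. f \<noteq> pconst c * g" "g \<noteq> 0" "(\<Sum>k\<le>N. pconst (c k) * (f ^ k * g ^ (N - k))) = 0" "k \<le> N"
  shows "c k = 0"
proof (rule ccontr)
  assume "c k \<noteq> 0"
  define q where "q = (\<Sum>k\<le>N. Polynomial.monom (c k) k)"
  have q: "Polynomial.coeff q j = (if j \<le> N then c j else 0)" for j
    by (simp add: q_def coeff_sum coeff_monom)
  have "q \<noteq> 0" using \<open>c k \<noteq> 0\<close> assms(4) q[of k] by auto
  moreover have "Polynomial.degree q \<le> N" by (rule degree_le) (simp add: q)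
  ultimately show False using binary_form_nonzero[OF assms(1,2), of q N] assms(3) by (simp add: q)
qed

text \<open>An independent family of polynomials of degree at most \<open>d\<close> lies in the span
  of the monomials with all exponents at most \<open>d\<close>. This box is cruder than the space of
  polynomials of bounded degree, but has the same order of growth in \<open>d\<close>.\<close>

lemma pol_family_card_le:
  fixes e :: "'i \<Rightarrow> ('v::finite, 'a::field) pol"
  assumes "finite I" "\<And>c. (\<Sum>i\<in>I. pconst (c i) * e i) = 0 \<Longrightarrow> \<forall>i\<in>I. c i = 0" "\<And>i. i \<in> I \<Longrightarrow> e i \<in> deg_le d"
  shows "card I \<le> Suc d ^ CARD('v)"
proof -
  have inj: "inj_on e I"
  proof (rule inj_onI, rule ccontr)
    fix x y assume xy: "x \<in> I" "y \<in> I" "e x = e y" "x \<noteq> y"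
    define c where "c = (\<lambda>i. if i = x then 1 else if i = y then -1 else (0::'a))"
    have "(\<Sum>i\<in>I. pconst (c i) * e i) = (\<Sum>i\<in>{x, y}. pconst (c i) * e i)"
      using xy assms(1) by (intro sum.mono_neutral_right) (auto simp: c_def pconst_simps)
    also have "\<dots> = 0" using xy by (simp add: c_def pconst_simps)
    finally show False using assms(2)[of c] xy by (auto simp: c_def)
  qed
  have ind: "pol.independent (e ` I)"
  proof
    assume "pol.dependent (e ` I)"
    then obtain u where u: "\<exists>v\<in>e ` I. u v \<noteq> 0" "(\<Sum>v\<in>e ` I. pconst (u v) * v) = 0"
      using pol.dependent_finite[of "e ` I"] assms(1) by auto
    have "(\<Sum>i\<in>I. pconst (u (e i)) * e i) = 0" using u(2) by (simp add: sum.reindex[OF inj])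
    from assms(2)[OF this] u(1) show False by auto
  qed
  let ?M = "{m :: 'v \<Rightarrow>\<^sub>0 nat. \<forall>v. coef m v < Suc d}"
  have fin: "finite ((\<lambda>m. mterm m (1::'a)) ` ?M)" by (intro finite_imageI card_exponents_less(1))
  have "e ` I \<subseteq> pol.span ((\<lambda>m. mterm m 1) ` ?M)"
  proof (rule image_subsetI)
    fix i assume i: "i \<in> I"
    have "(\<Sum>m\<in>supp (e i). pconst (coef (e i) m) * mterm m 1) \<in> pol.span ((\<lambda>m. mterm m 1) ` ?M)"
    proof (intro pol.span_sum pol.span_scale pol.span_base imageI CollectI allI)
      fix m v assume "m \<in> supp (e i)"
      hence "mon_degree m \<le> d" using assms(3)[OF i] by (simp add: deg_le_def)
      thus "coef m v < Suc d" using coef_le_mon_degree[of m v] by simp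
    qed
    thus "e i \<in> pol.span ((\<lambda>m. mterm m 1) ` ?M)"
      using pol_sum_terms[of "e i"] by (simp add: pconst_mult_single)
  qed
  from pol.independent_span_bound[OF fin ind this]
  have "card (e ` I) \<le> card ((\<lambda>m. mterm m (1::'a)) ` ?M)" by simp
  also have "\<dots> \<le> card ?M" by (rule card_image_le[OF card_exponents_less(1)])
  also have "\<dots> \<le> Suc d ^ CARD('v)" by (rule card_exponents_less(2))
  finally show ?thesis by (simp add: card_image[OF inj])
qed

context torus_action
begin

lemma wt_isolate_family:
  assumes W: "pol.subspace W" "\<And>t p. \<forall>v. t v \<noteq> 0 \<Longrightarrow> p \<in> W \<Longrightarrow> \<rho> t p \<in> W"
    and I: "finite I" "inj_on w I" "\<And>i. i \<in> I \<Longrightarrow> p i \<in> wt (w i)" "(\<Sum>i\<in>I. p i) \<in> W" "i \<in> I"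
  shows "p i \<in> W"
proof -
  have inv: "the_inv_into I w (w j) = j" if "j \<in> I" for j using the_inv_into_f_f[OF I(2) that] .
  have "p (the_inv_into I w (w i)) \<in> W"
  proof (rule wt_isolate[where S = "w ` I" and p = "\<lambda>x. p (the_inv_into I w x)", OF W])
    show "(\<Sum>x\<in>w ` I. p (the_inv_into I w x)) \<in> W"
      using I(4) by (simp add: sum.reindex[OF I(2)] inv cong: sum.cong)
  qed (use I inv in auto)
  thus ?thesis using inv I by simp
qed

lemma trivial_subspace: "pol.subspace {0}" "\<forall>v. t v \<noteq> 0 \<Longrightarrow> p \<in> {0} \<Longrightarrow> \<rho> t p \<in> {0}"
proof -
  show "pol.subspace {0}" by (rule pol.subspace_single_0)
  show "\<rho> t p \<in> {0}" if "\<forall>v. t v \<noteq> 0" "p \<in> {0}"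
    using aut_simps(1)[OF that(1)] that(2) by (simp only: singleton_iff)
qed

lemma wt_unique: "p \<in> wt \<mu> \<Longrightarrow> p \<in> wt \<psi> \<Longrightarrow> p \<noteq> 0 \<Longrightarrow> \<mu> = \<psi>"
proof (rule chr_inj)
  fix t :: "'v \<Rightarrow> 'a" assume *: "p \<in> wt \<mu>" "p \<in> wt \<psi>" "p \<noteq> 0" "\<forall>v. t v \<noteq> 0"
  have "pconst (chr \<mu> t) * p = \<rho> t p" "\<rho> t p = pconst (chr \<psi> t) * p"
    using *(1,2,4) unfolding wt_def by simp_all
  hence "p * pconst (chr \<mu> t) = p * pconst (chr \<psi> t)" by (simp only: mult.commute[of p])
  hence "pconst (chr \<mu> t) = (pconst (chr \<psi> t) :: ('v, 'a) pol)" using *(3) by (rule pol_mult_cancel)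
  thus "chr \<mu> t = chr \<psi> t" by simp
qed

end

text \<open>A form of faithfulness: the differences of occurring weights contain a nonzero multiple
  of every coordinate vector.\<close>

locale spread_torus_action = torus_action \<rho> for \<rho> :: "('v::finite \<Rightarrow> 'a::alg_closed_field) \<Rightarrow> ('v, 'a) endo" +
  assumes spread: "\<exists>\<mu> \<psi> a b. a \<in> wt \<mu> \<and> b \<in> wt \<psi> \<and> a \<noteq> 0 \<and> b \<noteq> 0 \<and> \<mu> i \<noteq> \<psi> i \<and> (\<forall>j. j \<noteq> i \<longrightarrow> \<mu> j = \<psi> j)"
begin

text \<open>If \<open>f\<close>, \<open>g\<close> of the same weight were linearly independent, then the products of powers of \<open>f\<close>,
  \<open>g\<close> and of \<open>n\<close> pairs witnessing \<open>spread\<close> would give \<open>(N + 1) ^ (n + 1)\<close> independent polynomials of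
  degree \<open>O(N)\<close> in \<open>n\<close> variables.\<close>

lemma wt_one_dimensional:
  assumes f: "f \<in> wt \<mu>" and g: "g \<in> wt \<mu>" "g \<noteq> 0"
  shows "\<exists>c. f = pconst c * g"
proof (rule ccontr)
  assume "\<not> (\<exists>c. f = pconst c * g)"
  hence fg: "\<And>c. f \<noteq> pconst c * g" by blast
  obtain A B a b where AB: "\<And>i. a i \<in> wt (A i)" "\<And>i. b i \<in> wt (B i)" "\<And>i. a i \<noteq> 0" "\<And>i. b i \<noteq> 0"
    "\<And>i. A i i \<noteq> B i i" "\<And>i j. j \<noteq> i \<Longrightarrow> A i j = B i j"
    using spread by metis
  have "\<forall>i. \<exists>d. a i \<in> deg_le d" "\<forall>i. \<exists>d. b i \<in> deg_le d" using deg_le_ex by blast+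
  then obtain da db where dab: "\<And>i. a i \<in> deg_le (da i)" "\<And>i. b i \<in> deg_le (db i)" by metis
  obtain df dg where dfg: "f \<in> deg_le df" "g \<in> deg_le dg" using deg_le_ex by meson
  define d where "d = df + dg + (\<Sum>i\<in>UNIV. da i + db i)"
  have dle: "da i + db i \<le> (\<Sum>i\<in>UNIV. da i + db i)" for i by (rule member_le_sum) auto
  have deg: "f \<in> deg_le d" "g \<in> deg_le d" "a i \<in> deg_le d" "b i \<in> deg_le d" for i
    using dle[of i] by (auto intro!: deg_le_mono[OF dfg(1)] deg_le_mono[OF dfg(2)] 
      deg_le_mono[OF dab(1)] deg_le_mono[OF dab(2)] simp: d_def)
  let ?n = "CARD('v)"
  \<comment> \<open>The products below have degree at most N (n + 1) d, and N (n + 1) d + 1 \<le> D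
    (N + 1). The count then reads (N + 1)^(n + 1) \<le> D^n (N + 1)^n, which fails as soon as D^n
    \<le> N.\<close>
  define D where "D = Suc ((Suc ?n) * d)"
  define N where "N = D ^ ?n"
  let ?K = "Pi\<^sub>E (UNIV :: 'v set) (\<lambda>_. {..N})"
  have K: "finite ?K" "card ?K = Suc N ^ ?n"
    using finite_PiE[of "UNIV :: 'v set" "\<lambda>_. {..N}"] card_PiE[of "UNIV :: 'v set" "\<lambda>_. {..N}"] by simp_all
  define M where "M = (\<lambda>\<kappa>. \<Prod>i\<in>UNIV. a i ^ \<kappa> i * b i ^ (N - \<kappa> i))"
  define w where "w = (\<lambda>(\<kappa> :: 'v \<Rightarrow> nat) v. \<Sum>i\<in>UNIV. int (\<kappa> i) * A i v + int (N - \<kappa> i) * B i v)"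
  have M_wt: "M \<kappa> \<in> wt (w \<kappa>)" for \<kappa>
    unfolding M_def w_def by (intro wt_prod wt_mult wt_power AB)
  have M_nz: "M \<kappa> \<noteq> 0" for \<kappa>
    unfolding M_def by (intro pol_prod_nonzero pol_mult_nonzero pol_power_nonzero AB)
  \<comment> \<open>\<open>A i\<close> and \<open>B i\<close> agree off \<open>i\<close>, so
    coordinate \<open>j\<close> of the weight sees \<kappa> only through \<open>\<kappa> j\<close>;
    as A j j and B j j differ, \<kappa> can be recovered from the weight.\<close>
  have w_i: "w \<kappa> j = (\<Sum>i\<in>UNIV. int N * B i j) + int (\<kappa> j) * (A j j - B j j)" if "\<kappa> \<in> ?K" for \<kappa> j
  proof -
    have eq: "int (\<kappa> i) * A i j + int (N - \<kappa> i) * B i j = int N * B i j + (if i = j then int (\<kappa> j) * (A j j - B j j) else 0)" for i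
    proof -
      have "\<kappa> i \<le> N" using that by auto
      thus ?thesis using AB(6)[of j i] by (auto simp: algebra_simps of_nat_diff)
    qed
    show ?thesis unfolding w_def eq by (simp add: sum.distrib)
  qed
  have w_inj: "inj_on (\<lambda>\<kappa> v. int N * \<mu> v + w \<kappa> v) ?K"
  proof (rule inj_onI)
    fix \<kappa> \<kappa>' assume *: "\<kappa> \<in> ?K" "\<kappa>' \<in> ?K" "(\<lambda>v. int N * \<mu> v + w \<kappa> v) = (\<lambda>v. int N * \<mu> v + w \<kappa>' v)"
    show "\<kappa> = \<kappa>'"
    proof
      fix j
      have "int N * \<mu> j + w \<kappa> j = int N * \<mu> j + w \<kappa>' j" using *(3) by (rule fun_cong)
      thus "\<kappa> j = \<kappa>' j" unfolding w_i[OF *(1)] w_i[OF *(2)] using AB(5)[of j] by simp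
    qed
  qed
  define e where "e = (\<lambda>(k, \<kappa>). (f ^ k * g ^ (N - k)) * M \<kappa>)"
  have "card ({..N} \<times> ?K) \<le> Suc (N * (Suc ?n * d)) ^ ?n"
  proof (rule pol_family_card_le)
    show "finite ({..N} \<times> ?K)" using K(1) by simp
  next
    fix i assume "i \<in> {..N} \<times> ?K"
    then obtain k \<kappa> where i: "i = (k, \<kappa>)" "k \<le> N" "\<kappa> \<in> ?K" by auto
    have pw: "p ^ k * q ^ (N - k) \<in> deg_le (N * d)" if "p \<in> deg_le d" "q \<in> deg_le d" "k \<le> N" for p q :: "('v, 'a) pol" and k
    proof -
      have "p ^ k * q ^ (N - k) \<in> deg_le (k * d + (N - k) * d)" by (intro deg_le_mult deg_le_power that)
      thus ?thesis using that(3) by (simp add: add_mult_distrib[symmetric])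
    qed
    have "M \<kappa> \<in> deg_le (\<Sum>i\<in>(UNIV :: 'v set). N * d)" unfolding M_def
      using i(3) by (intro deg_le_prod pw deg) auto
    from deg_le_mult[OF pw[OF deg(1,2) i(2)] this]
    show "e i \<in> deg_le (N * (Suc ?n * d))" by (simp add: e_def i(1) algebra_simps)
  next
    fix c assume c: "(\<Sum>i\<in>{..N} \<times> ?K. pconst (c i) * e i) = 0"
    define P where "P = (\<lambda>\<kappa>. \<Sum>k\<le>N. pconst (c (k, \<kappa>)) * (f ^ k * g ^ (N - k)))"
    have "(\<Sum>\<kappa>\<in>?K. P \<kappa> * M \<kappa>) = (\<Sum>i\<in>{..N} \<times> ?K. pconst (c i) * e i)"
      unfolding P_def e_def sum_distrib_right by (subst sum.swap) (simp add: sum.cartesian_product mult.assoc case_prod_unfold)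
    hence sum0: "(\<Sum>\<kappa>\<in>?K. P \<kappa> * M \<kappa>) \<in> {0}" using c by simp
    \<comment> \<open>\<open>f\<close> and \<open>g\<close> have the same weight, so each summand is
      homogeneous, and distinct \<kappa> give distinct weights.\<close>
    have "P \<kappa> * M \<kappa> \<in> {0}" if "\<kappa> \<in> ?K" for \<kappa>
    proof (rule wt_isolate_family[OF trivial_subspace K(1) w_inj _ sum0 that])
      fix \<kappa> assume "\<kappa> \<in> ?K"
      have "f ^ k * g ^ (N - k) \<in> wt (\<lambda>v. int N * \<mu> v)" if "k \<le> N" for k
      proof -
        have "(\<lambda>v. int k * \<mu> v + int (N - k) * \<mu> v) = (\<lambda>v. int N * \<mu> v)"
          using that by (auto simp: of_nat_diff algebra_simps)
        thus ?thesis using wt_mult[OF wt_power[OF f, of k] wt_power[OF g(1), of "N - k"]] by simp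
      qed
      hence "P \<kappa> \<in> wt (\<lambda>v. int N * \<mu> v)" unfolding P_def by (intro wt_sum wt_scale) auto
      thus "P \<kappa> * M \<kappa> \<in> wt (\<lambda>v. int N * \<mu> v + w \<kappa> v)" by (intro wt_mult M_wt)
    qed
    hence "P \<kappa> = 0" if "\<kappa> \<in> ?K" for \<kappa> using that M_nz[of \<kappa>] pol_mult_eq_0[of "P \<kappa>" "M \<kappa>"] by auto
    hence "c (k, \<kappa>) = 0" if "k \<le> N" "\<kappa> \<in> ?K" for k \<kappa>
      using binary_form_eq_0[OF fg g(2), where N = N and c = "\<lambda>k. c (k, \<kappa>)" and k = k] that by (auto simp: P_def)
    thus "\<forall>i\<in>{..N} \<times> ?K. c i = 0" by auto
  qed
  hence "Suc N * Suc N ^ ?n \<le> Suc (N * (Suc ?n * d)) ^ ?n"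
    by (simp only: card_cartesian_product card_atMost K(2))
  also have "\<dots> \<le> (D * Suc N) ^ ?n" by (rule power_mono) (simp_all add: D_def)
  also have "\<dots> = N * Suc N ^ ?n" by (simp only: N_def power_mult_distrib)
  finally show False by simp
qed

section \<open>The fixed point and its maximal ideal\<close>

lemma wt_zero_const: "p \<in> wt (\<lambda>_. 0) \<Longrightarrow> \<exists>c. p = pconst c"
  using wt_one_dimensional[of p "\<lambda>_. 0" 1] wt_pconst[of 1] by (simp add: pconst_simps)

lemma wt_pointed:
  assumes "a \<in> wt \<mu>" "b \<in> wt \<psi>" "a \<noteq> 0" "b \<noteq> 0" "\<And>v. \<mu> v + \<psi> v = 0"
  shows "\<mu> = (\<lambda>_. 0)"
proof -
  have "a * b \<in> wt (\<lambda>_. 0)" using wt_mult[OF assms(1,2)] assms(5) by simp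
  then obtain c where c: "a * b = pconst c" using wt_zero_const by blast
  have "c \<noteq> 0" using c assms(3,4) pol_mult_eq_0[of a b] by (auto simp: pconst_simps)
  have "a * (b * pconst (inverse c)) = pconst (c * inverse c)"
    unfolding mult.assoc[symmetric] c by (simp add: pconst_simps)
  also have "\<dots> = 1" using \<open>c \<noteq> 0\<close> by (simp add: pconst_simps)
  finally obtain d where "a = pconst d" using pol_unit_const by blast
  thus ?thesis using wt_unique[of a \<mu> "\<lambda>_. 0"] assms wt_pconst by auto
qed

text \<open>The maximal ideal of the fixed point. Pointedness of the weights makes this span an
  ideal, and its codimension is one because vectors of weight zero are constant.\<close>

definition aug :: "('v, 'a) pol set" where "aug = pol.span (\<Union>(wt ` (- {\<lambda>_. 0})))"

lemma aug_mult: "p \<in> aug \<Longrightarrow> q * p \<in> aug"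
proof -
  have hom: "q * p \<in> aug" if "q \<in> wt \<psi>" "p \<in> wt \<mu>" "\<mu> \<noteq> (\<lambda>_. 0)" for p q \<psi> \<mu>
  proof (cases "q * p = 0")
    case False
    hence nz: "p \<noteq> 0" "q \<noteq> 0" by auto
    have "(\<lambda>v. \<psi> v + \<mu> v) \<noteq> (\<lambda>_. 0)"
    proof
      assume "(\<lambda>v. \<psi> v + \<mu> v) = (\<lambda>_. 0)"
      hence "\<mu> v + \<psi> v = 0" for v by (metis add.commute)
      thus False using wt_pointed[OF that(2,1) nz] that(3) by blast
    qed
    thus ?thesis using wt_mult[OF that(1,2)] unfolding aug_def by (intro pol.span_base) blast
  qed (simp add: aug_def pol.span_zero)
  have hom': "q * p \<in> aug" if "q \<in> wt \<psi>" "p \<in> aug" for p q \<psi>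
    using that(2) unfolding aug_def
  proof (induction rule: pol.span_induct_alt)
    case (step c x y)
    have "q * x \<in> pol.span (\<Union>(wt ` (- {\<lambda>_. 0})))" using hom[OF that(1), of x] step by (auto simp: aug_def)
    from pol.span_add[OF pol.span_scale[OF this, of c] step(2)] show ?case 
      by (simp add: distrib_left mult.left_commute)
  qed (simp add: pol.span_zero)
  assume p: "p \<in> aug"
  show "q * p \<in> aug" using span_wt[of q]
  proof (induction rule: pol.span_induct_alt)
    case (step c x y)
    have "x * p \<in> aug" using hom' step p by auto
    from pol.span_add[OF pol.span_scale[OF this[unfolded aug_def], of c] step(2)[unfolded aug_def]] show ?case
      by (simp add: aug_def distrib_right mult.assoc)
  qed (simp add: aug_def pol.span_zero)
qed

text \<open>Constants have weight zero, and vectors of distinct weights are independent.\<close>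

lemma aug_const: "pconst c \<in> aug \<Longrightarrow> c = 0"
proof -
  assume "pconst c \<in> aug"
  from span_wt_decomposition[OF this[unfolded aug_def]]
  obtain S q where S: "finite S" "S \<subseteq> - {\<lambda>_. 0}" "\<forall>\<mu>. q \<mu> \<in> wt \<mu>" "pconst c = (\<Sum>\<mu>\<in>S. q \<mu>)"
    by (elim exE conjE)
  define q' where "q' = (\<lambda>\<mu>. if \<mu> = (\<lambda>_. 0) then pconst (- c) else q \<mu>)"
  have "(\<Sum>\<mu>\<in>insert (\<lambda>_. 0) S. q' \<mu>) = pconst (- c) + (\<Sum>\<mu>\<in>S. q' \<mu>)"
    using S(1,2) by (subst sum.insert) (auto simp: q'_def)
  also have "(\<Sum>\<mu>\<in>S. q' \<mu>) = (\<Sum>\<mu>\<in>S. q \<mu>)" using S(2) by (intro sum.cong) (auto simp: q'_def)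
  also have "pconst (- c) + (\<Sum>\<mu>\<in>S. q \<mu>) = 0"
    unfolding S(4)[symmetric] pconst_simps(5) by (rule left_minus)
  finally have 0: "(\<Sum>\<mu>\<in>insert (\<lambda>_. 0) S. q' \<mu>) \<in> {0}" by (simp only: singleton_iff)
  have "q' (\<lambda>_. 0) \<in> {0}"
  proof (rule wt_isolate[OF trivial_subspace _ _ 0])
    show "q' \<mu> \<in> wt \<mu>" for \<mu> using S(3) wt_pconst by (simp add: q'_def)
  qed (use S(1) in simp_all)
  hence "pconst c = (pconst 0 :: ('v, 'a) pol)" by (simp add: q'_def pconst_simps)
  thus "c = 0" by (simp only: pconst_eq_iff)
qed

text \<open>The coordinates of the fixed point: the residue of \<open>pvar v\<close> modulo
  \<open>aug\<close> is its component of weight zero, which is constant.\<close>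

definition point :: "'v \<Rightarrow> 'a" where "point v = (SOME c. pvar v - pconst c \<in> aug)"

lemma point: "pvar v - pconst (point v) \<in> aug"
proof -
  obtain S q where S: "finite S" "\<forall>\<mu>. q \<mu> \<in> wt \<mu>" "pvar v = (\<Sum>\<mu>\<in>S. q \<mu>)" using wt_decomposition by blast
  obtain c where c: "q (\<lambda>_. 0) = pconst c" using S(2) wt_zero_const by blast
  have aug: "(\<Sum>\<mu>\<in>S - {\<lambda>_. 0}. q \<mu>) \<in> aug" unfolding aug_def
    using S(2) by (intro pol.span_sum pol.span_base) auto
  have "\<exists>c. pvar v - pconst c \<in> aug"
  proof (cases "(\<lambda>_. 0) \<in> S")
    case True
    thus ?thesis using aug sum.remove[OF S(1) True, of q] by (intro exI[of _ c]) (simp add: S(3) c)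
  next
    case False
    thus ?thesis using aug by (intro exI[of _ 0]) (simp add: S(3) pconst_simps)
  qed
  thus ?thesis unfolding point_def by (rule someI_ex)
qed

text \<open>Reduction modulo \<open>aug\<close> and evaluation at \<open>point\<close> are both
  compatible with sums and products, so agreement on constants and variables suffices.\<close>

lemma point_eval: "p - pconst (coef (shift point p) 0) \<in> aug"
proof -
  define P where "P = (\<lambda>p. p - pconst (coef (shift point p) 0) \<in> aug)"
  note h = ring_hom_fun_simps[OF ring_hom_fun_comp[OF ring_hom_coef_0 alg_homD(1)[OF alg_hom_shift[of point]]]]
  have P_mult: "P (p * q)" if "P p" "P q" for p q
  proof -
    have "p * q - pconst (coef (shift point (p * q)) 0) = 
       q * (p - pconst (coef (shift point p) 0)) + pconst (coef (shift point p) 0) * (q - pconst (coef (shift point q) 0))"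
      unfolding h(4) pconst_simps(4) by (simp add: algebra_simps)
    also have "\<dots> \<in> aug" using aug_mult[of _ q] aug_mult[of "q - _"] that
      unfolding P_def aug_def by (intro pol.span_add) auto
    finally show ?thesis by (simp add: P_def)
  qed
  have P_add: "P (p + q)" if "P p" "P q" for p q
    unfolding P_def aug_def h(3) pconst_simps(3) add_diff_add
    by (rule pol.span_add[OF that[unfolded P_def aug_def]])
  have P_const: "P (pconst c)" for c
    using pol.span_zero by (simp add: P_def alg_hom_simps[OF alg_hom_shift] coef_pconst aug_def)
  have "coef (pvar v + pconst c) 0 = c" for v :: 'v and c :: 'a
    by (simp add: lookup_add coef_pvar coef_pconst)
  hence P_var: "P (pvar v)" for v using point by (simp add: P_def)
  have "P p" by (induction p rule: pol_ring_induct) (rule P_const P_var P_add P_mult; assumption?)+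
  thus ?thesis by (simp add: P_def)
qed

lemma aug_iff: "p \<in> aug \<longleftrightarrow> shift point p \<in> ord_ge 1"
proof -
  have "shift point p \<in> ord_ge 1 \<longleftrightarrow> coef (shift point p) 0 = 0"
    by (auto simp: ord_ge_iff mon_degree_eq_0_iff)
  moreover have "p \<in> aug \<longleftrightarrow> coef (shift point p) 0 = 0"
  proof
    assume "p \<in> aug"
    from pol.span_diff[OF this[unfolded aug_def] point_eval[of p, unfolded aug_def]]
    have "pconst (coef (shift point p) 0) \<in> aug" by (simp add: aug_def)
    thus "coef (shift point p) 0 = 0" by (rule aug_const)
  next
    assume "coef (shift point p) 0 = 0"
    thus "p \<in> aug" using point_eval[of p] by (simp add: pconst_simps)
  qed
  ultimately show ?thesis by simp
qed

lemma aug_rho: 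
  assumes t: "\<forall>v. t v \<noteq> 0" and "p \<in> aug"
  shows "\<rho> t p \<in> aug"
  using assms(2) unfolding aug_def
proof (induction rule: pol.span_induct_alt)
  case (step c x y)
  then obtain \<mu> where "x \<in> wt \<mu>" "\<mu> \<noteq> (\<lambda>_. 0)" by auto
  hence "\<rho> t x \<in> pol.span (\<Union>(wt ` (- {\<lambda>_. 0})))" using t by (simp add: wt_def[of \<mu>]) (intro pol.span_scale pol.span_base, auto simp: wt_def)
  thus ?case using step t by (simp add: aut_simps pol.span_add pol.span_scale)
qed (simp add: aut_simps t pol.span_zero)

end

section \<open>Tangent-to-identity substitutions\<close>

lemma mon_degree_eq_1: "mon_degree m = 1 \<Longrightarrow> \<exists>j. m = mterm j 1"
proof -
  assume 1: "mon_degree m = 1"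
  then obtain j where j: "coef m j \<noteq> 0" by (metis mon_degree_eq_0_iff one_neq_zero poly_mapping_eqI lookup_zero)
  define m' where "m' = m - mterm j 1"
  have eq: "m = m' + mterm j 1" by (rule poly_mapping_eqI) (use j in \<open>auto simp: m'_def lookup_add lookup_minus lookup_single when_def\<close>)
  hence "mon_degree m' = 0" using 1 mon_degree_add[of m' "mterm j 1"] by simp
  thus ?thesis using eq by (auto simp: mon_degree_eq_0_iff)
qed

lemma close_mult:
  assumes "p - q \<in> ord_ge (Suc d)" "q \<in> ord_ge d" "p' - q' \<in> ord_ge (Suc e)" "q' \<in> ord_ge e"
  shows "p * p' - q * q' \<in> ord_ge (Suc (d + e))"
proof -
  have "p * p' - q * q' = (p - q) * (p' - q') + (p - q) * q' + q * (p' - q')" by (simp add: algebra_simps)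
  moreover have "(p - q) * (p' - q') \<in> ord_ge (Suc (d + e))"
    using ord_ge_mult[OF assms(1,3)] by (rule ord_ge_mono) simp
  moreover have "(p - q) * q' \<in> ord_ge (Suc (d + e))" "q * (p' - q') \<in> ord_ge (Suc (d + e))"
    using ord_ge_mult[OF assms(1,4)] ord_ge_mult[OF assms(2,3)] by simp_all
  ultimately show ?thesis by (simp only: ord_ge_add)
qed

text \<open>The power z_v^k has leading form x_v^k, so the substitution acts trivially on the
  quotients of successive powers of the ideal of the origin.\<close>

lemma sub_tangent:
  fixes z :: "'v::finite \<Rightarrow> ('v, 'a::comm_ring_1) pol"
  assumes z: "\<And>v. z v - pvar v \<in> ord_ge 2" and p: "p \<in> ord_ge N"
  shows "sub z p - p \<in> ord_ge (Suc N)"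
proof -
  have pw: "z v ^ k - pvar v ^ k \<in> ord_ge (Suc k) \<and> (pvar v :: ('v, 'a) pol) ^ k \<in> ord_ge k" for v k
  proof (induction k)
    case (Suc k)
    have 1: "z v - pvar v \<in> ord_ge (Suc 1)" using z by (simp add: numeral_2_eq_2)
    have "z v * z v ^ k - pvar v * pvar v ^ k \<in> ord_ge (Suc (1 + k))"
      by (rule close_mult[OF 1]) (use Suc ord_ge_pvar[of v] in blast)+
    moreover have "(pvar v :: ('v, 'a) pol) * pvar v ^ k \<in> ord_ge (1 + k)"
      by (rule ord_ge_mult) (use Suc ord_ge_pvar[of v] in blast)+
    ultimately show ?case by simp
  qed (use ord_ge_0 in simp)
  have pr: "(\<Prod>v\<in>S. z v ^ k v) - (\<Prod>v\<in>S. pvar v ^ k v) \<in> ord_ge (Suc (\<Sum>v\<in>S. k v)) \<and> (\<Prod>v\<in>S. (pvar v :: ('v, 'a) pol) ^ k v) \<in> ord_ge (\<Sum>v\<in>S. k v)"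
    if "finite S" for S and k :: "'v \<Rightarrow> nat"
    using that
  proof induction
    case (insert x S)
    from close_mult[OF conjunct1[OF pw] conjunct2[OF pw] conjunct1[OF insert.IH] conjunct2[OF insert.IH]]
      ord_ge_mult[OF conjunct2[OF pw] conjunct2[OF insert.IH]] insert.hyps
    show ?case by simp
  qed simp
  have "sub z p - p = (\<Sum>m\<in>supp p. pconst (coef p m) * (mono_eval z m - mono_eval pvar m))"
    using sub_id[of p] unfolding pol_eval_alt right_diff_distrib sum_subtractf by simp
  also have "\<dots> \<in> ord_ge (Suc N)"
  proof (intro ord_ge_sum ord_ge_pconst_mult)
    fix m assume m: "m \<in> supp p"
    have "mono_eval z m - mono_eval pvar m \<in> ord_ge (Suc (mon_degree m))"
      using pr[of UNIV "coef m"] by (simp add: mono_eval_UNIV mon_degree_def)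
    thus "mono_eval z m - mono_eval pvar m \<in> ord_ge (Suc N)"
      by (rule ord_ge_mono) (use p m in \<open>auto simp: ord_ge_def\<close>)
  qed
  finally show ?thesis .
qed

text \<open>By \<open>sub_tangent\<close> the order of an element of the kernel can be raised
  indefinitely, which a nonzero polynomial does not allow.\<close>

lemma sub_tangent_inj:
  fixes z :: "'v::finite \<Rightarrow> ('v, 'a::comm_ring_1) pol"
  assumes z: "\<And>v. z v - pvar v \<in> ord_ge 2" and "sub z p = 0"
  shows "p = 0"
proof -
  have "p \<in> ord_ge N" for N
  proof (induction N)
    case (Suc N)
    from ord_ge_diff[OF ord_ge_0(2) sub_tangent[OF z Suc]] show ?case by (simp add: assms(2))
  qed simp
  moreover obtain d where "p \<in> deg_le d" using deg_le_ex by meson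
  ultimately show ?thesis using ord_ge_eq_0 by blast
qed

text \<open>Repeated correction by the current error. This gives surjectivity only modulo each power
  of the ideal; without further input the inverse substitution is a formal power series.\<close>

lemma sub_tangent_approx:
  fixes z :: "'v::finite \<Rightarrow> ('v, 'a::comm_ring_1) pol"
  assumes z: "\<And>v. z v - pvar v \<in> ord_ge 2"
  shows "\<exists>b. p - sub z b \<in> ord_ge N"
proof (induction N)
  case (Suc N)
  then obtain b where b: "p - sub z b \<in> ord_ge N" by blast
  have "p - sub z (b + (p - sub z b)) = 0 - (sub z (p - sub z b) - (p - sub z b))"
    by (simp add: alg_hom_simps[OF alg_hom_sub])
  also have "\<dots> \<in> ord_ge (Suc N)" by (intro ord_ge_diff ord_ge_0 sub_tangent z b)
  finally show ?case by blast
qed simp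

definition lin_sub :: "'a ^ 'v ^ 'v \<Rightarrow> ('v::finite, 'a::field) endo"
  where "lin_sub A = sub (\<lambda>v. \<Sum>j\<in>UNIV. pconst (vec_nth (vec_nth A v) j) * pvar j)"

lemma alg_hom_lin_sub [simp]: "alg_hom (lin_sub A)"
  by (simp add: lin_sub_def)

lemma lin_sub_pvar: "lin_sub A (pvar v) = (\<Sum>j\<in>UNIV. pconst (vec_nth (vec_nth A v) j) * pvar j)"
  by (simp add: lin_sub_def)

lemma lin_sub_inverse:
  assumes "C ** B = mat 1"
  shows "lin_sub B (lin_sub C (pvar v)) = pvar v"
proof -
  have "lin_sub B (lin_sub C (pvar v)) = (\<Sum>j\<in>UNIV. \<Sum>k\<in>UNIV. pconst (vec_nth (vec_nth C v) j * vec_nth (vec_nth B j) k) * pvar k)"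
    by (simp only: lin_sub_pvar alg_hom_simps(4,8,10)[OF alg_hom_lin_sub] sum_distrib_left pconst_simps(4) mult.assoc)
  also have "\<dots> = (\<Sum>k\<in>UNIV. pconst (vec_nth (vec_nth (C ** B) v) k) * pvar k)"
    unfolding matrix_matrix_mult_def vec_lambda_beta ring_hom_fun_simps(8)[OF ring_hom_pconst] sum_distrib_right
    by (rule sum.swap)
  also have "\<dots> = pvar v"
    by (simp add: assms mat_def if_distrib[of pconst] if_distrib[of "\<lambda>x. x * _"] pconst_simps cong: if_cong)
  finally show ?thesis .
qed

lemma lin_sub_aut: 
  assumes "A ** A' = mat 1" "A' ** A = mat 1"
  shows "lin_sub A \<in> alg_aut"
  by (rule alg_autI[of "lin_sub A" "lin_sub A'"]) (simp_all add: lin_sub_inverse assms)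

section \<open>Homogeneous coordinates from the cotangent space\<close>

context spread_torus_action
begin

text \<open>The differential at the fixed point; for an element of \<open>aug\<close> this is its
  class in the cotangent space.\<close>

definition lin :: "('v, 'a) pol \<Rightarrow> 'a ^ 'v"
  where "lin p = (\<chi> v. coef (shift point p) (mterm v 1))"

lemma lin_add: "lin (p + q) = lin p + lin q"
  by (simp add: lin_def vec_eq_iff alg_hom_simps[OF alg_hom_shift] lookup_add)

lemma lin_scale: "lin (pconst c * p) = c *s lin p"
  by (simp add: lin_def vec_eq_iff alg_hom_simps[OF alg_hom_shift] coef_pconst_mult)

lemma lin_span: "p \<in> pol.span S \<Longrightarrow> lin p \<in> vec.span (lin ` S)"
proof (induction rule: pol.span_induct_alt)
  case base
  have "lin 0 = 0" by (simp add: lin_def vec_eq_iff alg_hom_simps[OF alg_hom_shift])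
  thus ?case by (simp add: vec.span_zero)
next
  case (step c x y)
  thus ?case unfolding lin_add lin_scale
    by (intro vec.span_add[OF vec.span_scale[OF vec.span_base[OF imageI]]])
qed

lemma lin_homogeneous_span: "vec.span (lin ` (\<Union>(wt ` (- {\<lambda>_. 0})))) = UNIV"
proof -
  have "axis v 1 \<in> vec.span (lin ` (\<Union>(wt ` (- {\<lambda>_. 0}))))" for v :: 'v
  proof -
    have "lin (pvar v - pconst (point v)) = axis v 1"
    proof -
      have "coef (pvar v + pconst (point v) - pconst (point v) :: ('v, 'a) pol) (mterm i 1) = (if i = v then 1 else 0)" for i
        by (simp add: coef_pvar)
      thus ?thesis by (simp add: lin_def vec_eq_iff alg_hom_simps[OF alg_hom_shift] axis_def del: One_nat_def add_diff_cancel_right')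
    qed
    thus ?thesis using lin_span[OF point[unfolded aug_def], of v] by simp
  qed
  hence "vec.span (range (\<lambda>v. axis v 1)) \<subseteq> vec.span (lin ` (\<Union>(wt ` (- {\<lambda>_. 0}))))"
    by (intro vec.span_minimal vec.subspace_span) auto
  moreover have "(range (\<lambda>v. axis v 1) :: ('a ^ 'v) set) = cart_basis" by (auto simp: cart_basis_def)
  ultimately show ?thesis using span_cart_basis by auto
qed

text \<open>The classes of weight vectors span the cotangent space, so a basis can be chosen among
  them; the rows of \<open>A\<close> are the linear parts of the chosen vectors.\<close>

lemma homogeneous_coordinates:
  "\<exists>y \<mu> (A :: 'a ^ 'v ^ 'v) (A' :: 'a ^ 'v ^ 'v). (\<forall>v. y v \<in> wt (\<mu> v) \<and> \<mu> v \<noteq> (\<lambda>_. 0)) \<and> (\<forall>v. lin (y v) = row v A) \<and>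
     A ** A' = mat 1 \<and> A' ** A = mat 1"
proof -
  let ?H = "lin ` (\<Union>(wt ` (- {\<lambda>_. 0})))"
  obtain B where B: "B \<subseteq> ?H" "vec.independent B" "?H \<subseteq> vec.span B"
    using vec.maximal_independent_subset by blast
  have span: "vec.span B = UNIV" using vec.span_minimal[OF B(3) vec.subspace_span] lin_homogeneous_span by auto
  have "card B = vec.dim (UNIV :: ('a ^ 'v) set)"
    using span B(2) by (intro vec.basis_card_eq_dim) auto
  also have "\<dots> = card (cart_basis :: ('a ^ 'v) set)"
    by (rule vec.basis_card_eq_dim[symmetric]) (simp_all add: independent_cart_basis)
  finally have "card B = CARD('v)" by (simp add: card_cart_basis)
  moreover have "finite B" using B(2) vec.finiteI_independent by blast
  ultimately obtain b where b: "bij_betw b (UNIV :: 'v set) B" using finite_same_card_bij[OF finite] by metis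
  define A where "A = (\<chi> v. b v)"
  have "rows A = B" using b by (auto simp: rows_def A_def row_def bij_betw_def vec_nth_inverse)
  hence "\<exists>A'. A' ** A = mat 1" using matrix_left_invertible_span_rows_gen[of A] span by simp
  then obtain A' where A': "A' ** A = mat 1" by blast
  hence A'': "A ** A' = mat 1" using matrix_left_right_inverse by blast
  have "\<forall>v. \<exists>y \<mu>. y \<in> wt \<mu> \<and> \<mu> \<noteq> (\<lambda>_. 0) \<and> lin y = b v"
  proof
    fix v
    have "b v \<in> ?H" using b B(1) by (auto simp: bij_betw_def)
    then obtain y where y: "y \<in> \<Union>(wt ` (- {\<lambda>_. 0}))" "b v = lin y" by blast
    then obtain \<mu> where "\<mu> \<in> - {\<lambda>_. 0}" "y \<in> wt \<mu>" by blast
    hence "y \<in> wt \<mu> \<and> \<mu> \<noteq> (\<lambda>_. 0) \<and> lin y = b v" using y(2) by simp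
    thus "\<exists>y \<mu>. y \<in> wt \<mu> \<and> \<mu> \<noteq> (\<lambda>_. 0) \<and> lin y = b v" by - (rule exI[of _ y], rule exI[of _ \<mu>], assumption)
  qed
  from choice[OF this] obtain y where "\<forall>v. \<exists>\<mu>. y v \<in> wt \<mu> \<and> \<mu> \<noteq> (\<lambda>_. 0) \<and> lin (y v) = b v" ..
  from choice[OF this] obtain \<mu> where y: "\<forall>v. y v \<in> wt (\<mu> v) \<and> \<mu> v \<noteq> (\<lambda>_. 0) \<and> lin (y v) = b v" ..
  have "row v A = b v" for v by (simp add: row_def A_def vec_eq_iff)
  with y A' A'' have "(\<forall>v. y v \<in> wt (\<mu> v) \<and> \<mu> v \<noteq> (\<lambda>_. 0)) \<and> (\<forall>v. lin (y v) = row v A) \<and>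
     A ** A' = mat 1 \<and> A' ** A = mat 1" by simp
  thus ?thesis by - (rule exI[of _ y], rule exI[of _ \<mu>], rule exI[of _ A], rule exI[of _ A'], assumption)
qed

text \<open>Substituting the homogeneous vectors \<open>y\<close> is injective because, up to an
  affine change of coordinates, it is tangent to the identity. For surjectivity, a weight vector is
  approximated by polynomials in \<open>y\<close>; its weight must then be that of a monomial in
  \<open>y\<close>, and one-dimensionality makes it a multiple of this monomial. This replaces
  convergence of the formal inverse.\<close>

theorem linearisable: "\<exists>g\<in>alg_aut. \<exists>\<mu>. \<forall>v. g (pvar v) \<in> wt (\<mu> v)"
proof -
  obtain y \<mu> and A A' :: "'a ^ 'v ^ 'v" where y0: "\<forall>v. y v \<in> wt (\<mu> v) \<and> \<mu> v \<noteq> (\<lambda>_. 0)" "\<forall>v. lin (y v) = row v A"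
    and A: "A ** A' = mat 1" "A' ** A = (mat 1 :: 'a ^ 'v ^ 'v)"
    using homogeneous_coordinates by (elim exE conjE)
  have y: "y v \<in> wt (\<mu> v)" "\<mu> v \<noteq> (\<lambda>_. 0)" "lin (y v) = row v A" for v
    by (rule conjunct1[OF spec[OF y0(1)]], rule conjunct2[OF spec[OF y0(1)]], rule spec[OF y0(2)])
  have L_aut: "lin_sub A \<in> alg_aut" "lin_sub A' \<in> alg_aut"
    by (rule lin_sub_aut, fact, fact)+
  \<comment> \<open>\<open>G\<close> moves the fixed point to the origin and the linear part of each
    \<open>y v\<close> to \<open>pvar v\<close>.\<close>
  define G where "G = lin_sub A' \<circ> shift point"
  have G: "G \<in> alg_aut" unfolding G_def by (intro alg_aut_comp L_aut shift_aut)
  note G_simps = alg_aut_simps[OF G]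
  have L_ord: "lin_sub A' p \<in> ord_ge N" if "p \<in> ord_ge N" for p N
    unfolding lin_sub_def by (rule sub_ord_ge[OF _ that]) (intro ord_ge_sum ord_ge_pconst_mult ord_ge_pvar)
  define z where "z = (\<lambda>v. G (y v))"
  have z: "z v - pvar v \<in> ord_ge 2" for v
  proof -
    have "y v \<in> aug" unfolding aug_def using y(1,2)[of v] by (intro pol.span_base) auto
    hence y0: "coef (shift point (y v)) 0 = 0" unfolding aug_iff ord_ge_iff by simp
    have "shift point (y v) - lin_sub A (pvar v) \<in> ord_ge 2"
      unfolding ord_ge_iff
    proof (intro allI impI)
      fix m :: "'v \<Rightarrow>\<^sub>0 nat" assume m: "mon_degree m < 2"
      show "coef (shift point (y v) - lin_sub A (pvar v)) m = 0"
      proof (cases "mon_degree m = 0")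
        case True
        hence "m = 0" by (simp add: mon_degree_eq_0_iff)
        moreover have "coef (pvar j :: ('v, 'a) pol) 0 = 0" for j
          unfolding coef_pvar using mterm_eq_0_iff[of j "1 :: nat"] by (metis one_neq_zero)
        ultimately show ?thesis using y0 by (simp add: lin_sub_def lookup_minus lookup_sum coef_pconst_mult)
      next
        case False
        then obtain j where j: "m = mterm j 1" using m mon_degree_eq_1[of m] by auto
        have "coef (pvar k :: ('v, 'a) pol) (mterm j 1) = (if k = j then 1 else 0)" for k
          by (auto simp: coef_pvar)
        moreover have "coef (shift point (y v)) (mterm j 1) = vec_nth (vec_nth A v) j"
          using arg_cong[OF y(3)[of v], of "\<lambda>x. vec_nth x j"] by (simp add: lin_def row_def)
        ultimately show ?thesis
          by (simp add: j lin_sub_def lookup_minus lookup_sum coef_pconst_mult if_distrib[of "\<lambda>x. _ * x"] del: One_nat_def cong: if_cong)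
      qed
    qed
    from L_ord[OF this] show ?thesis
      by (simp add: z_def G_def alg_aut_simps[OF L_aut(2)] lin_sub_inverse[OF A(1)])
  qed
  have Gy: "G (sub y p) = sub z p" for p unfolding z_def by (rule sub_comp[OF alg_aut_hom[OF G]])
  have inj0: "p = 0" if "sub y p = 0" for p
    by (rule sub_tangent_inj[OF z]) (simp add: Gy[symmetric] that G_simps)
  \<comment> \<open>The powers of the ideal of the fixed point. They are invariant because the torus
    fixes that point.\<close>
  define I where "I = (\<lambda>k. {p. G p \<in> ord_ge k})"
  have I_sub: "pol.subspace (I k)" for k
    unfolding pol.subspace_def I_def by (auto simp: G_simps ord_ge_add ord_ge_pconst_mult)
  have I1: "I 1 = aug"
  proof -
    have "G p \<in> ord_ge 1 \<longleftrightarrow> shift point p \<in> ord_ge 1" for p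
    proof
      assume *: "G p \<in> ord_ge 1"
      have "lin_sub A (G p) \<in> ord_ge 1"
        unfolding lin_sub_def by (rule sub_ord_ge[OF _ *]) (intro ord_ge_sum ord_ge_pconst_mult ord_ge_pvar)
      moreover have "lin_sub A (lin_sub A' q) = q" for q
        using alg_hom_eqI[of "lin_sub A \<circ> lin_sub A'" id] L_aut by (simp add: lin_sub_inverse A alg_hom_comp alg_aut_hom fun_eq_iff)
      ultimately show "shift point p \<in> ord_ge 1" by (simp add: G_def)
    qed (simp add: G_def L_ord)
    thus ?thesis unfolding I_def set_eq_iff aug_iff mem_Collect_eq by (intro allI)
  qed
  have I_rho: "\<rho> t p \<in> I k" if t: "\<forall>v. t v \<noteq> 0" and p: "p \<in> I k" for t p k
  proof -
    define F where "F = G \<circ> \<rho> t \<circ> finv G"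
    have F: "alg_hom F" unfolding F_def by (intro alg_hom_comp alg_aut_hom G aut t alg_aut_inv)
    have "F (pvar v) \<in> ord_ge 1" for v
    proof -
      have "finv G (pvar v) \<in> aug" unfolding I1[symmetric] I_def using G by (simp del: One_nat_def)
      from aug_rho[OF t this] show ?thesis unfolding I1[symmetric] I_def by (simp add: F_def)
    qed
    hence "sub (\<lambda>v. F (pvar v)) (G p) \<in> ord_ge k" using p by (intro sub_ord_ge) (auto simp: I_def)
    hence "F (G p) \<in> ord_ge k" using alg_hom_conv[OF F, of "G p"] by simp
    thus ?thesis using G by (simp add: I_def F_def)
  qed
  have range: "p \<in> range (sub y)" if p: "p \<in> wt \<nu>" for p \<nu>
  proof (cases "p = 0")
    case False
    obtain d where d: "G p \<in> deg_le d" using deg_le_ex by meson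
    \<comment> \<open>The order \<open>Suc d\<close> lies just above the degree of
      \<open>G p\<close>, so that only 0 can satisfy both bounds.\<close>
    obtain b where b: "G p - sub z b \<in> ord_ge (Suc d)" using sub_tangent_approx[OF z] by blast
    have pb: "p - sub y b \<in> I (Suc d)" using b by (simp add: I_def G_simps Gy)
    define w where "w = (\<lambda>m v. \<Sum>i\<in>UNIV. int (coef m i) * \<mu> i v)"
    have w: "mono_eval y m \<in> wt (w m)" for m
      unfolding mono_eval_UNIV w_def by (intro wt_prod wt_power y)
    \<comment> \<open>If no monomial in \<open>y\<close> had weight \<nu>, then \<open>p\<close>
      itself would be the \<nu>-component of the error p - sub y b, hence would lie in
      \<open>I (Suc d)\<close> and vanish.\<close>
    have "\<exists>m. w m = \<nu>"
    proof (rule ccontr)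
      assume no: "\<not> (\<exists>m. w m = \<nu>)"
      define q where "q = (\<lambda>\<psi>. (if \<psi> = \<nu> then p else 0) - (\<Sum>m\<in>{m\<in>supp b. w m = \<psi>}. pconst (coef b m) * mono_eval y m))"
      let ?S = "insert \<nu> (w ` supp b)"
      have "(\<Sum>\<psi>\<in>?S. q \<psi>) = (\<Sum>\<psi>\<in>?S. if \<psi> = \<nu> then p else 0) - (\<Sum>\<psi>\<in>?S. \<Sum>m\<in>{m\<in>supp b. w m = \<psi>}. pconst (coef b m) * mono_eval y m)"
        unfolding q_def sum_subtractf ..
      also have "(\<Sum>\<psi>\<in>?S. if \<psi> = \<nu> then p else 0) = p" by (subst sum.delta) simp_all
      also have "(\<Sum>\<psi>\<in>?S. \<Sum>m\<in>{m\<in>supp b. w m = \<psi>}. pconst (coef b m) * mono_eval y m) = sub y b"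
        unfolding pol_eval_alt by (rule sum.group) auto
      finally have qs: "(\<Sum>\<psi>\<in>?S. q \<psi>) \<in> I (Suc d)" using pb by (simp only:)
      have "q \<nu> \<in> I (Suc d)"
      proof (rule wt_isolate[OF I_sub I_rho _ _ qs])
        fix \<psi>
        have "(\<Sum>m\<in>{m\<in>supp b. w m = \<psi>}. pconst (coef b m) * mono_eval y m) \<in> wt \<psi>"
          using w by (intro wt_sum wt_scale) auto
        from wt_scale[OF this, of "-1"] have "- (\<Sum>m\<in>{m\<in>supp b. w m = \<psi>}. pconst (coef b m) * mono_eval y m) \<in> wt \<psi>"
          by (simp add: pconst_simps)
        from wt_add[OF _ this] show "q \<psi> \<in> wt \<psi>" unfolding q_def diff_conv_add_uminus using p by simp
      qed simp_all
      moreover have "q \<nu> = p" using no by (auto simp: q_def)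
      ultimately have "G p \<in> ord_ge (Suc d)" by (simp add: I_def)
      hence "G p = 0" using ord_ge_eq_0[OF d] by blast
      hence "p = 0" using G by (metis G_simps(1) alg_aut_inv_simps(2))
      with False show False by simp
    qed
    then obtain m where m: "w m = \<nu>" by blast
    have m1: "sub y (mterm m 1) = mono_eval y m" by (simp add: sub_mterm pconst_simps)
    have "mono_eval y m \<noteq> 0" using inj0[of "mterm m 1"] m1 by auto
    from wt_one_dimensional[OF p w[of m, unfolded m] this] obtain c where "p = pconst c * mono_eval y m" by blast
    hence "p = sub y (pconst c * mterm m 1)" by (simp add: alg_hom_simps[OF alg_hom_sub] m1)
    thus ?thesis by blast
  qed (metis alg_hom_simps(1)[OF alg_hom_sub] rangeI)
  have "p \<in> range (sub y)" for p
    using span_wt[of p]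
  proof (induction rule: pol.span_induct_alt)
    case base show ?case by (metis alg_hom_simps(1)[OF alg_hom_sub] rangeI)
  next
    case (step c x y')
    then obtain a a' where "x = sub y a" "y' = sub y a'" using range by blast
    hence "pconst c * x + y' = sub y (pconst c * a + a')" by (simp add: alg_hom_simps[OF alg_hom_sub])
    thus ?case by blast
  qed
  hence surj: "surj (sub y)" by auto
  moreover have "inj (sub y)"
  proof (rule injI)
    fix p q assume "sub y p = sub y q"
    hence "sub y (p - q) = 0" by (simp add: alg_hom_simps[OF alg_hom_sub])
    from inj0[OF this] show "p = q" by simp
  qed
  ultimately have "sub y \<in> alg_aut" by (simp add: alg_aut_iff bij_def)
  moreover have "\<forall>v. sub y (pvar v) \<in> wt (\<mu> v)" using y(1) by simp
  ultimately show ?thesis by blast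
qed

end

section \<open>Regular maps along curves of automorphisms\<close>

text \<open>What is extracted from a morphism of Ind-varieties: its restriction to curves over the
  line without finitely many points, together with the order \<open>M\<close> of contact with a
  constant at 0.\<close>

definition curve_regular :: "(('v::finite, 'a::alg_closed_field) endo \<Rightarrow> ('v, 'a) endo) \<Rightarrow> bool"
  where "curve_regular F \<longleftrightarrow> (\<forall>D M C d. finite (- D) \<longrightarrow> C ` D \<subseteq> NAut_le d \<longrightarrow>
     (\<forall>x. \<exists>q. flat M q \<and> (\<forall>u\<in>D. aut_coords (C u) x = poly q u)) \<longrightarrow>
     (\<exists>j. \<forall>u\<in>D. F (C u) \<in> NAut_le j) \<and> (\<forall>x. loc_rational D M (\<lambda>u. aut_coords (F (C u)) x)))"

definition polys :: "nat \<Rightarrow> ('a::comm_ring_1 \<Rightarrow> 'a) set"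
  where "polys M = {h. \<exists>H. flat M H \<and> h = poly H}"

lemma fun_algebra_polys: "fun_algebra (polys M)"
  using fun_algebra_flat by (simp add: polys_def)

lemma families_polysI:
  assumes "\<And>u m. coef (p u) m = poly (H m) u" "\<And>m. flat M (H m)" "\<And>u. p u \<in> deg_le d"
  shows "p \<in> families (polys M)"
proof -
  have "(\<lambda>u. coef (p u) m) = poly (H m)" for m using assms(1) by blast
  hence "(\<lambda>u. coef (p u) m) \<in> polys M" for m using assms(2) unfolding polys_def by blast
  thus ?thesis unfolding families_def using assms(3) by blast
qed

lemma NAut_leI:
  fixes C :: "'u \<Rightarrow> ('v::finite, 'a::field) endo"
  assumes "\<And>v. (\<lambda>u. C u (pvar v)) \<in> families R"
  shows "\<exists>d. \<forall>u. C u \<in> NAut \<longrightarrow> C u \<in> NAut_le d"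
proof -
  have "\<forall>v. \<exists>d. \<forall>u. C u (pvar v) \<in> deg_le d" using assms by (auto simp: families_def)
  from choice[OF this] obtain d where d: "\<And>v u. C u (pvar v) \<in> deg_le (d v)" by blast
  have "d v \<le> (\<Sum>v\<in>UNIV. d v)" for v by (rule member_le_sum) auto
  hence "C u (pvar v) \<in> deg_le (\<Sum>v\<in>UNIV. d v)" for u v by (rule deg_le_mono[OF d])
  thus ?thesis by (auto simp: NAut_le_def deg_le_def)
qed

lemma families_coords:
  assumes "\<And>v. (\<lambda>u. C u (pvar v)) \<in> families (polys M)"
  shows "\<exists>q. flat M q \<and> (\<forall>u. aut_coords (C u) x = poly q u)"
proof -
  obtain v m where x: "x = (v, m)" by force
  have "(\<lambda>u. coef (C u (pvar v)) m) \<in> polys M" using assms[of v] by (auto simp: families_def)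
  thus ?thesis by (auto simp: polys_def aut_coords_def x fun_eq_iff)
qed

lemma NAut_le_families:
  assumes "\<And>u. F u \<in> NAut_le j" "\<And>m. (\<lambda>u. coef (F u (pvar v)) m) \<in> R"
  shows "(\<lambda>u. F u (pvar v)) \<in> families R"
  using assms by (auto simp: families_def NAut_le_def deg_le_def)

lemma curve_regular_polys:
  fixes F :: "('v::finite, 'a::alg_closed_field) endo \<Rightarrow> ('v, 'a) endo"
  assumes F: "curve_regular F" and C: "\<And>u. C u \<in> NAut" "\<And>v. (\<lambda>u. C u (pvar v)) \<in> families (polys M)"
  shows "(\<lambda>u. F (C u) (pvar v)) \<in> families (polys M)"
proof -
  obtain d where d: "C ` UNIV \<subseteq> NAut_le d" using NAut_leI[where C = C, OF C(2)] C(1) by blast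
  have "\<forall>x. \<exists>q. flat M q \<and> (\<forall>u\<in>UNIV. aut_coords (C u) x = poly q u)"
    using families_coords[where C = C, OF C(2)] by simp
  from F[unfolded curve_regular_def, rule_format, OF _ d this[rule_format]]
  obtain j where j: "\<forall>u\<in>UNIV. F (C u) \<in> NAut_le j" and 
    lr: "\<forall>x. loc_rational UNIV M (\<lambda>u. aut_coords (F (C u)) x)" by auto
  show ?thesis
  proof (rule NAut_le_families[where F = "\<lambda>u. F (C u)"])
    show "F (C u) \<in> NAut_le j" for u using j by simp
    show "(\<lambda>u. coef (F (C u) (pvar v)) m) \<in> polys M" for m
      using loc_rational_UNIV[OF lr[rule_format, of "(v, m)"]] by (auto simp: polys_def aut_coords_def)
  qed
qed

text \<open>At u = 0 the curve may leave the group, as a degenerate diagonal map does; only the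
  punctured line is available, and powers of \<open>u\<close> can occur in denominators.\<close>

lemma curve_regular_laurent:
  fixes F :: "('v::finite, 'a::alg_closed_field) endo \<Rightarrow> ('v, 'a) endo"
  assumes F: "curve_regular F" and C: "\<And>u. u \<noteq> 0 \<Longrightarrow> C u \<in> NAut" "\<And>v. (\<lambda>u. C u (pvar v)) \<in> families (polys 0)"
  shows "(\<lambda>u. (if u = 0 then id else F (C u)) (pvar v)) \<in> families laurent"
proof -
  have D: "finite (- (- {0 :: 'a}))" by simp
  obtain d where d: "C ` (- {0}) \<subseteq> NAut_le d" using NAut_leI[where C = C, OF C(2)] C(1) by blast
  have "\<forall>x. \<exists>q. flat 0 q \<and> (\<forall>u\<in>- {0}. aut_coords (C u) x = poly q u)"
    using families_coords[where C = C, OF C(2)] by blast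
  from F[unfolded curve_regular_def, rule_format, OF D d this[rule_format]]
  obtain j where j: "\<forall>u\<in>- {0}. F (C u) \<in> NAut_le j" and 
    lr: "\<forall>x. loc_rational (- {0}) 0 (\<lambda>u. aut_coords (F (C u)) x)" by auto
  \<comment> \<open>The bound \<open>Suc j\<close> also accommodates degree 1 of the placeholder
    \<open>id\<close>.\<close>
  have "\<forall>u. (if u = 0 then id else F (C u)) (pvar v) \<in> deg_le (Suc j)"
  proof
    fix u :: 'a
    show "(if u = 0 then id else F (C u)) (pvar v) \<in> deg_le (Suc j)"
    proof (cases "u = 0")
      case True thus ?thesis by (simp add: deg_le_def pvar_def)
    next
      case False
      hence "F (C u) (pvar v) \<in> deg_le j" using j by (auto simp: NAut_le_def deg_le_def)
      from deg_le_mono[OF this, of "Suc j"] show ?thesis using False by simp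
    qed
  qed
  moreover have "(\<lambda>u. coef ((if u = 0 then id else F (C u)) (pvar v)) m) \<in> laurent" for m
  proof -
    obtain N H where "\<forall>u. u \<noteq> 0 \<longrightarrow> aut_coords (F (C u)) (v, m) * u ^ N = poly H u"
      using loc_rational_nonzero[OF lr[rule_format, of "(v, m)"]] by blast
    thus ?thesis unfolding laurent_def by (auto simp: aut_coords_def intro!: exI[of _ N] exI[of _ H])
  qed
  ultimately show ?thesis unfolding families_def by blast
qed

lemma families_dil_cochar:
  "(\<lambda>u :: 'a::field. dil (cochar i u) (pvar v)) \<in> families (polys 0)" for i v :: "'v::finite"
proof (rule families_polysI)
  show "coef (dil (cochar i u) (pvar v)) m = poly (if m = mterm v 1 then if v = i then [:0, 1:] else 1 else 0) u" for u :: 'a and m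
    by (auto simp: coef_pconst_mult coef_pvar cochar_def)
  show "dil (cochar i u) (pvar v) \<in> deg_le 1" for u :: 'a
    by (auto simp: deg_le_iff coef_pconst_mult coef_pvar)
qed simp

lemma families_elmt:
  fixes i v :: "'v::finite"
  shows "(\<lambda>c :: 'a::field. elmt i (mterm m c) (pvar v)) \<in> families (polys 0)"
proof -
  have "(\<lambda>c :: 'a. mterm m c) \<in> families (polys 0)"
  proof (rule families_polysI)
    show "coef (mterm m c) n = poly (if n = m then [:0, 1:] else 0) c" for c :: 'a and n
      by (auto simp: lookup_single when_def)
    show "mterm m c \<in> deg_le (mon_degree m)" for c :: 'a by (auto simp: deg_le_def split: if_splits)
  qed simp
  from families_add[OF fun_algebra_polys families_const[OF fun_algebra_polys, of "pvar v"] this]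
  show ?thesis by (cases "v = i") (simp_all add: elmt_pvar families_const[OF fun_algebra_polys])
qed

section \<open>Automorphisms of the Ind-group over an algebraically closed field\<close>

locale ind_automorphism =
  fixes \<Phi> :: "('v::finite, 'a::alg_closed_field) endo \<Rightarrow> ('v, 'a) endo"
  assumes hom: "f \<in> NAut \<Longrightarrow> h \<in> NAut \<Longrightarrow> \<Phi> (f \<circ> h) = \<Phi> f \<circ> \<Phi> h"
    and bij: "bij_betw \<Phi> NAut NAut"
    and regular: "curve_regular \<Phi>"
    and inv_regular: "curve_regular (inv_into NAut \<Phi>)"
begin

lemma Phi_NAut: "f \<in> NAut \<Longrightarrow> \<Phi> f \<in> NAut"
  using bij by (auto simp: bij_betw_def)

lemma Phi_aut: "f \<in> NAut \<Longrightarrow> \<Phi> f \<in> alg_aut"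
  by (rule NAut_aut[OF Phi_NAut])

lemma Phi_inj: "f \<in> NAut \<Longrightarrow> h \<in> NAut \<Longrightarrow> \<Phi> f = \<Phi> h \<Longrightarrow> f = h"
  using bij by (auto simp: bij_betw_def inj_on_def)

lemma Phi_id: "\<Phi> id = id"
proof -
  have "\<Phi> id \<circ> \<Phi> id = \<Phi> id" using hom[OF NAut_id NAut_id] by simp
  hence "finv (\<Phi> id) \<circ> (\<Phi> id \<circ> \<Phi> id) = finv (\<Phi> id) \<circ> \<Phi> id" by simp
  thus ?thesis using Phi_aut[OF NAut_id] by simp
qed

lemma dil_NAut: "\<forall>v. t v \<noteq> 0 \<Longrightarrow> dil t \<in> NAut"
  by simp

lemma elmt_NAut: "var_free i P \<Longrightarrow> elmt i P \<in> NAut"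
  by simp

sublocale torus_action "\<lambda>t. \<Phi> (dil t)"
proof
  fix t :: "'v \<Rightarrow> 'a" assume t: "\<forall>v. t v \<noteq> 0"
  show "\<Phi> (dil t) \<in> alg_aut" by (rule Phi_aut[OF dil_NAut[OF t]])
next
  fix s t :: "'v \<Rightarrow> 'a" assume s: "\<forall>v. s v \<noteq> 0" and t: "\<forall>v. t v \<noteq> 0"
  show "\<Phi> (dil (\<lambda>v. s v * t v)) = \<Phi> (dil s) \<circ> \<Phi> (dil t)"
    unfolding dil_comp[symmetric] by (rule hom[OF dil_NAut[OF s] dil_NAut[OF t]])
next
  fix i v
  show "(\<lambda>u. (if u = 0 then id else \<Phi> (dil (cochar i u))) (pvar v)) \<in> families laurent"
    by (rule curve_regular_laurent[where C = "\<lambda>u. dil (cochar i u)", OF regular _ families_dil_cochar]) simp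
qed

text \<open>If the image of the translation preserved all weight spaces, it would commute with the
  image of the torus. By injectivity the translation would then commute with every diagonal
  automorphism, which fails when t_i differs from 1.\<close>

lemma translation_not_homogeneous:
  "\<exists>\<mu> a. a \<in> wt \<mu> \<and> \<Phi> (elmt i (pconst 1)) a \<notin> wt \<mu>"
proof (rule ccontr)
  let ?E = "elmt i (pconst (1 :: 'a))"
  assume "\<not> (\<exists>\<mu> a. a \<in> wt \<mu> \<and> \<Phi> ?E a \<notin> wt \<mu>)"
  hence *: "\<Phi> ?E a \<in> wt \<mu>" if "a \<in> wt \<mu>" for a \<mu> using that by blast
  have E: "?E \<in> NAut" by (rule elmt_NAut) simp
  note E_simps = alg_aut_simps[OF Phi_aut[OF E]]
  have "- {0, 1 :: 'a} \<noteq> {}" by (rule infinite_imp_nonempty[OF alg_closed_infinite_Compl]) simp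
  then obtain u :: 'a where u: "u \<noteq> 0" "u \<noteq> 1" by blast
  define t where "t = cochar i u"
  have t: "\<forall>v. t v \<noteq> 0" using u by (simp add: t_def)
  have "\<Phi> (dil t) (\<Phi> ?E p) = \<Phi> ?E (\<Phi> (dil t) p)" for p
    using span_wt[of p]
  proof (induction rule: pol.span_induct_alt)
    case base show ?case by (simp add: E_simps aut_simps[OF t])
  next
    case (step c x y)
    then obtain \<mu> where x: "x \<in> wt \<mu>" by blast
    have "\<Phi> (dil t) (\<Phi> ?E x) = pconst (chr \<mu> t) * \<Phi> ?E x" using *[OF x] t unfolding wt_def by blast
    also have "\<dots> = \<Phi> ?E (\<Phi> (dil t) x)" using x t unfolding wt_def by (simp add: E_simps)
    finally show ?case by (simp only: aut_simps(3,4,10)[OF t] E_simps(3,4,10) step(2))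
  qed
  hence "\<Phi> (dil t \<circ> ?E) = \<Phi> (?E \<circ> dil t)" using hom[OF dil_NAut[OF t] E] hom[OF E dil_NAut[OF t]] by (simp add: fun_eq_iff)
  hence "dil t \<circ> ?E = ?E \<circ> dil t"
    by (rule Phi_inj[rotated 2]) (use NAut_TAut t in \<open>simp_all add: TAut_comp\<close>)
  hence "(dil t \<circ> ?E) (pvar i) = (?E \<circ> dil t) (pvar i)" by (rule fun_cong)
  hence "pconst u * pvar i + pconst 1 = pconst u * pvar i + (pconst u :: ('v, 'a) pol)"
    by (simp add: elmt_pvar t_def cochar_def alg_hom_simps[OF alg_hom_dil] alg_hom_simps[OF alg_hom_elmt] 
        distrib_left pconst_simps(4)[symmetric])
  hence "pconst 1 = (pconst u :: ('v, 'a) pol)" by (rule add_left_imp_eq)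
  thus False using u(2) unfolding pconst_eq_iff by blast
qed

text \<open>The translation of x_i commutes with the subtorus t_i = 1, so its image can change
  weights only in coordinate \<open>i\<close>; by \<open>translation_not_homogeneous\<close> it does
  change some weight.\<close>

sublocale spread_torus_action "\<lambda>t. \<Phi> (dil t)"
proof
  fix i :: 'v
  let ?E = "elmt i (pconst (1 :: 'a))"
  have E: "?E \<in> NAut" by (rule elmt_NAut) simp
  note E_simps = alg_aut_simps[OF Phi_aut[OF E]]
  obtain \<mu> a where a: "a \<in> wt \<mu>" "\<Phi> ?E a \<notin> wt \<mu>" using translation_not_homogeneous by blast
  \<comment> \<open>The vectors on which the subtorus t_i = 1 acts through \<mu>. The image of
    \<open>a\<close> lies here, and so do its weight components.\<close>
  define W where "W = {p. \<forall>t. (\<forall>v. t v \<noteq> 0) \<longrightarrow> t i = 1 \<longrightarrow> \<Phi> (dil t) p = pconst (chr \<mu> t) * p}"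
  have W: "pol.subspace W"
    unfolding pol.subspace_def W_def by (simp add: aut_simps distrib_left mult.left_commute)
  have W_rho: "\<Phi> (dil t) p \<in> W" if t: "\<forall>v. t v \<noteq> 0" and "p \<in> W" for t p
    unfolding W_def
  proof (intro CollectI allI impI)
    fix s assume s: "\<forall>v. s v \<noteq> 0" "s i = (1 :: 'a)"
    have "\<Phi> (dil s) (\<Phi> (dil t) p) = \<Phi> (dil t) (\<Phi> (dil s) p)" by (rule commute[OF s(1) t])
    also have "\<Phi> (dil s) p = pconst (chr \<mu> s) * p" using that(2) s unfolding W_def by blast
    finally show "\<Phi> (dil s) (\<Phi> (dil t) p) = pconst (chr \<mu> s) * \<Phi> (dil t) p" by (simp only: aut_simps(4,10)[OF t])
  qed
  have "\<Phi> ?E a \<in> W"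
    unfolding W_def
  proof (intro CollectI allI impI)
    fix t assume t: "\<forall>v. t v \<noteq> 0" "t i = (1 :: 'a)"
    have "dil t \<circ> ?E = ?E \<circ> dil t" using dil_elmt_mterm[of t i 0 1] t by (simp add: pconst_def)
    hence "\<Phi> (dil t) (\<Phi> ?E a) = \<Phi> ?E (\<Phi> (dil t) a)"
      using hom[OF dil_NAut[OF t(1)] E] hom[OF E dil_NAut[OF t(1)]] by (metis comp_apply)
    also have "\<Phi> (dil t) a = pconst (chr \<mu> t) * a" using a(1) t unfolding wt_def by blast
    finally show "\<Phi> (dil t) (\<Phi> ?E a) = pconst (chr \<mu> t) * \<Phi> ?E a" by (simp only: E_simps(4,10))
  qed
  moreover obtain S q where S: "finite S" "\<forall>\<psi>. q \<psi> \<in> wt \<psi>" "\<Phi> ?E a = (\<Sum>\<psi>\<in>S. q \<psi>)"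
    using wt_decomposition[of "\<Phi> ?E a"] by blast
  ultimately have sum: "(\<Sum>\<psi>\<in>S. q \<psi>) \<in> W" by (simp only:)
  have qW: "q \<psi> \<in> W" if "\<psi> \<in> S" for \<psi>
    by (rule wt_isolate[OF W W_rho S(1) _ sum that]) (use S(2) in blast)+
  have "\<exists>\<psi>\<in>S. \<psi> \<noteq> \<mu> \<and> q \<psi> \<noteq> 0"
  proof (rule ccontr)
    assume no: "\<not> (\<exists>\<psi>\<in>S. \<psi> \<noteq> \<mu> \<and> q \<psi> \<noteq> 0)"
    have "(\<Sum>\<psi>\<in>S. q \<psi>) \<in> wt \<mu>"
    proof (rule wt_sum)
      fix \<psi> assume "\<psi> \<in> S"
      thus "q \<psi> \<in> wt \<mu>" using no S(2) wt_0 by metis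
    qed
    thus False using a(2) S(3) by simp
  qed
  then obtain \<psi> where \<psi>: "\<psi> \<in> S" "\<psi> \<noteq> \<mu>" "q \<psi> \<noteq> 0" by blast
  have eq: "\<psi> j = \<mu> j" if j: "j \<noteq> i" for j
  proof (rule powi_inj)
    fix u :: 'a assume u: "u \<noteq> 0"
    have c: "\<forall>v. cochar j u v \<noteq> 0" "cochar j u i = 1" using u j by (simp_all add: cochar_def)
    have "pconst (chr \<psi> (cochar j u)) * q \<psi> = \<Phi> (dil (cochar j u)) (q \<psi>)"
      using S(2) c(1) unfolding wt_def by simp
    also have "\<dots> = pconst (chr \<mu> (cochar j u)) * q \<psi>" using qW[OF \<psi>(1)] c unfolding W_def by simp
    finally have "q \<psi> * pconst (u powi \<psi> j) = q \<psi> * pconst (u powi \<mu> j)" by (simp only: chr_cochar mult.commute)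
    from pol_mult_cancel[OF this \<psi>(3)] show "u powi \<psi> j = u powi \<mu> j" by (simp only: pconst_eq_iff)
  qed
  hence "\<mu> i \<noteq> \<psi> i" using \<psi>(2) by (metis ext)
  moreover have "a \<noteq> 0" using a by (auto simp: E_simps)
  ultimately show "\<exists>\<mu> \<psi> a b. a \<in> wt \<mu> \<and> b \<in> wt \<psi> \<and> a \<noteq> 0 \<and> b \<noteq> 0 \<and> \<mu> i \<noteq> \<psi> i \<and> (\<forall>j. j \<noteq> i \<longrightarrow> \<mu> j = \<psi> j)"
    using a(1) S(2) \<psi>(3) eq by (intro exI[of _ \<mu>] exI[of _ \<psi>] exI[of _ a] exI[of _ "q \<psi>"]) simp
qed

end

section \<open>The action on root subgroups\<close>

text \<open>The weight of the monomial \<open>x\<^sup>m\<close> in the image of \<open>x\<^sub>k\<close> under conjugation by diagonal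
  automorphisms; for \<open>coef m k = 0\<close> it is the root of the subgroup \<open>x\<^sub>k \<mapsto> x\<^sub>k + c x\<^sup>m\<close>.\<close>

definition wroot :: "'v \<Rightarrow> ('v \<Rightarrow>\<^sub>0 nat) \<Rightarrow> 'v \<Rightarrow> int"
  where "wroot k m v = int (coef m v) - (if v = k then 1 else 0)"

lemma wroot_eq_0_iff: "wroot k m = (\<lambda>_. 0) \<longleftrightarrow> m = mterm k 1"
proof
  assume eq: "wroot k m = (\<lambda>_. 0)"
  show "m = mterm k 1"
  proof (rule poly_mapping_eqI)
    fix v
    have "wroot k m v = 0" using eq by (rule fun_cong)
    thus "coef m v = coef (mterm k 1) v" by (auto simp: wroot_def lookup_single when_def split: if_splits)
  qed
qed (auto simp: wroot_def lookup_single when_def fun_eq_iff)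

lemma wroot_inj_mono: "wroot k m = wroot k m' \<Longrightarrow> m = m'"
proof (rule poly_mapping_eqI)
  fix v assume "wroot k m = wroot k m'"
  hence "wroot k m v = wroot k m' v" by (rule fun_cong)
  thus "coef m v = coef m' v" by (simp add: wroot_def)
qed

lemma chr_wroot:
  fixes t :: "'v::finite \<Rightarrow> 'a::field"
  assumes t: "\<forall>v. t v \<noteq> 0"
  shows "chr (wroot k m) t = mono_eval t m / t k"
proof -
  have "chr (\<lambda>v. wroot k m v + (if v = k then 1 else 0)) t = chr (wroot k m) t * chr (\<lambda>v. if v = k then 1 else 0) t"
    by (rule chr_add[OF t])
  moreover have "chr (\<lambda>v. if v = k then 1 else 0) t = t k"
    by (simp add: chr_def if_distrib[of "\<lambda>x. _ powi x"] cong: if_cong)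
  moreover have "chr (\<lambda>v. wroot k m v + (if v = k then 1 else 0)) t = mono_eval t m"
    unfolding mono_eval_chr by (rule arg_cong[of _ _ "\<lambda>x. chr x t"]) (auto simp: wroot_def)
  ultimately show ?thesis using t by (simp add: field_simps)
qed

lemma pvar_dvd:
  assumes "\<And>m. m \<in> supp p \<Longrightarrow> coef m k \<ge> 1"
  shows "\<exists>q. p = pvar k * q"
proof
  have "p = (\<Sum>m\<in>supp p. mterm m (coef p m))" by (rule pol_sum_terms)
  also have "\<dots> = (\<Sum>m\<in>supp p. pvar k * mterm (m - mterm k 1) (coef p m))"
  proof (rule sum.cong[OF refl])
    fix m assume "m \<in> supp p"
    hence "m = mterm k 1 + (m - mterm k 1)"
      using assms[of m] by (intro poly_mapping_eqI) (auto simp: lookup_add lookup_minus lookup_single when_def)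
    thus "mterm m (coef p m) = pvar k * mterm (m - mterm k 1) (coef p m)"
      by (simp add: pvar_def mult_single)
  qed
  finally show "p = pvar k * (\<Sum>m\<in>supp p. mterm (m - mterm k 1) (coef p m))" by (simp only: sum_distrib_left)
qed

text \<open>Semi-invariance under scaling makes \<open>H\<close> agree with a power function off 0;
  a negative exponent is excluded by clearing it and evaluating at 0.\<close>

lemma poly_homogeneous:
  fixes H :: "'a::alg_closed_field poly"
  assumes H: "\<And>u. u \<noteq> 0 \<Longrightarrow> poly H u = u powi e * poly H 1" and "H \<noteq> 0"
  shows "\<exists>n. e = int n \<and> poly H 1 \<noteq> 0 \<and> (\<forall>u. poly H u = poly H 1 * u ^ n)"
proof -
  have inf: "infinite (- {0 :: 'a})" by (rule alg_closed_infinite_Compl) simp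
  have 1: "poly H 1 \<noteq> 0"
  proof
    assume H1: "poly H 1 = 0"
    have "H = 0"
    proof (rule poly_eqI_cofinite[OF inf])
      fix u :: 'a assume "u \<in> - {0}"
      thus "poly H u = poly 0 u" using H[of u] by (simp add: H1)
    qed
    thus False using assms(2) by simp
  qed
  have "e \<ge> 0"
  proof (rule ccontr)
    assume "\<not> e \<ge> 0"
    define n where "n = nat (- e)"
    have n: "n > 0" "e = - int n" using \<open>\<not> e \<ge> 0\<close> by (auto simp: n_def)
    have "H * Polynomial.monom 1 n = [:poly H 1:]"
    proof (rule poly_eqI_cofinite[OF inf])
      fix u :: 'a assume u: "u \<in> - {0}"
      hence "poly H u = inverse (u ^ n) * poly H 1" using H[of u] by (simp add: n(2) power_int_minus)
      thus "poly (H * Polynomial.monom 1 n) u = poly [:poly H 1:] u" using u by (simp add: poly_monom)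
    qed
    from arg_cong[OF this, of "\<lambda>p. poly p 0"] show False using 1 n(1) by (simp add: poly_monom power_0_left)
  qed
  define n where "n = nat e"
  have n: "e = int n" using \<open>e \<ge> 0\<close> by (simp add: n_def)
  have "H = Polynomial.monom (poly H 1) n"
  proof (rule poly_eqI_cofinite[OF inf])
    fix u :: 'a assume "u \<in> - {0}"
    thus "poly H u = poly (Polynomial.monom (poly H 1) n) u" using H[of u] by (simp add: poly_monom n)
  qed
  hence "poly H u = poly H 1 * u ^ n" for u using poly_monom[of "poly H 1" n u] by simp
  thus ?thesis using n 1 by blast
qed

text \<open>Row \<open>v\<close> of \<open>M\<close> is the weight of the coordinate g(x_v). Its
  invertibility is not assumed: it is extracted from the action on translations in
  \<open>pull_inj\<close>.\<close>

locale diagonalised = ind_automorphism \<Phi> for \<Phi> :: "('v::finite, 'a::alg_closed_field) endo \<Rightarrow> ('v, 'a) endo" +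
  fixes g :: "('v, 'a) endo" and M :: "'v \<Rightarrow> 'v \<Rightarrow> int"
  assumes g: "g \<in> alg_aut"
    and diag: "\<forall>v. t v \<noteq> 0 \<Longrightarrow> finv g \<circ> \<Phi> (dil t) \<circ> g = dil (\<lambda>v. chr (M v) t)"
begin

definition \<Psi> :: "('v, 'a) endo \<Rightarrow> ('v, 'a) endo" where "\<Psi> f = finv g \<circ> \<Phi> f \<circ> g"

lemma Psi_aut: "f \<in> NAut \<Longrightarrow> \<Psi> f \<in> alg_aut"
  unfolding \<Psi>_def by (intro alg_aut_comp alg_aut_inv g Phi_aut)

lemma Psi_comp: "f \<in> NAut \<Longrightarrow> h \<in> NAut \<Longrightarrow> \<Psi> (f \<circ> h) = \<Psi> f \<circ> \<Psi> h"
  using g by (simp add: \<Psi>_def hom fun_eq_iff)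

lemma Psi_id: "\<Psi> id = id"
  using g by (simp add: \<Psi>_def Phi_id fun_eq_iff)

lemma Phi_Psi: "f \<in> NAut \<Longrightarrow> \<Phi> f = g \<circ> \<Psi> f \<circ> finv g"
  using g by (simp add: \<Psi>_def fun_eq_iff)

lemma Psi_inj: "f \<in> NAut \<Longrightarrow> h \<in> NAut \<Longrightarrow> \<Psi> f = \<Psi> h \<Longrightarrow> f = h"
  by (rule Phi_inj) (simp_all add: Phi_Psi)

lemma Psi_dil: "\<forall>v. t v \<noteq> 0 \<Longrightarrow> \<Psi> (dil t) = dil (\<lambda>v. chr (M v) t)"
  unfolding \<Psi>_def by (rule diag)

lemma Psi_families:
  assumes C: "\<And>u. C u \<in> NAut" "\<And>v. (\<lambda>u. C u (pvar v)) \<in> families (polys N)"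
  shows "(\<lambda>u. \<Psi> (C u) p) \<in> families (polys N)"
  unfolding \<Psi>_def
  by (rule families_conj[where F = "\<lambda>u. \<Phi> (C u)", OF fun_algebra_polys g alg_aut_hom[OF Phi_aut[OF C(1)]]
        curve_regular_polys[where C = C, OF regular C]])

text \<open>Pullback of characters along the homomorphism of tori with components
  \<open>chr (M v)\<close>.\<close>

definition pull :: "('v \<Rightarrow> int) \<Rightarrow> 'v \<Rightarrow> int" where "pull \<beta> w = (\<Sum>v\<in>UNIV. \<beta> v * M v w)"

lemma pull_scale: "pull (\<lambda>v. c * \<beta> v) w = c * pull \<beta> w"
  by (simp add: pull_def sum_distrib_left mult.assoc)

lemma pull_diff: "pull (\<lambda>v. \<beta> v - \<gamma> v) w = pull \<beta> w - pull \<gamma> w"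
  by (simp add: pull_def left_diff_distrib sum_subtractf)

lemma pull_minus_single: "pull (\<lambda>v. if v = k then -1 else 0) w = - M k w"
  by (simp add: pull_def if_distrib[of "\<lambda>x. x * _"] cong: if_cong)

lemma chr_M_nz: "\<forall>v. t v \<noteq> 0 \<Longrightarrow> \<forall>v. chr (M v) t \<noteq> 0"
  using chr_nz by blast

lemma chr_pull:
  assumes t: "\<forall>v. t v \<noteq> (0 :: 'a)"
  shows "chr \<beta> (\<lambda>v. chr (M v) t) = chr (pull \<beta>) t"
proof -
  have p: "(\<Prod>w\<in>UNIV. f w) powi k = (\<Prod>w\<in>UNIV. f w powi k)" for f :: "'v \<Rightarrow> 'a" and k
  proof -
    have "(\<Prod>w\<in>S. f w) powi k = (\<Prod>w\<in>S. f w powi k)" if "finite S" for S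
      using that by induction (simp_all add: power_int_mult_distrib)
    thus ?thesis by simp
  qed
  have s: "x powi (\<Sum>v\<in>UNIV. k v) = (\<Prod>v\<in>UNIV. x powi k v)" if "x \<noteq> 0" for x :: 'a and k :: "'v \<Rightarrow> int"
  proof -
    have "x powi (\<Sum>v\<in>S. k v) = (\<Prod>v\<in>S. x powi k v)" if "finite S" for S
      using that by induction (simp_all add: power_int_add \<open>x \<noteq> 0\<close>)
    thus ?thesis by simp
  qed
  have "chr \<beta> (\<lambda>v. chr (M v) t) = (\<Prod>v\<in>UNIV. \<Prod>w\<in>UNIV. t w powi (\<beta> v * M v w))"
    by (simp add: chr_def p power_int_mult[symmetric] mult.commute)
  also have "\<dots> = (\<Prod>w\<in>UNIV. \<Prod>v\<in>UNIV. t w powi (\<beta> v * M v w))" by (rule prod.swap)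
  also have "\<dots> = chr (pull \<beta>) t" unfolding chr_def pull_def using t by (simp add: s)
  finally show ?thesis .
qed

context
  fixes i :: 'v and \<alpha> :: "'v \<Rightarrow>\<^sub>0 nat"
  assumes \<alpha>: "coef \<alpha> i = 0"
begin

text \<open>The image of the root subgroup with root \<open>wroot i \<alpha>\<close>, as a
  homomorphism from the additive group.\<close>

definition F :: "'a \<Rightarrow> ('v, 'a) endo" where "F c = \<Psi> (elmt i (mterm \<alpha> c))"

lemma elmt_N: "elmt i (mterm \<alpha> c) \<in> NAut"
  by (rule elmt_NAut) (simp add: \<alpha>)

lemma F_aut: "F c \<in> alg_aut"
  unfolding F_def by (rule Psi_aut[OF elmt_N])

lemma F_comp: "F c \<circ> F d = F (c + d)"
  unfolding F_def Psi_comp[OF elmt_N elmt_N, symmetric]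
  by (subst elmt_comp) (simp_all add: \<alpha> single_add)

lemma F_0: "F 0 = id"
  by (simp add: F_def Psi_id)

lemma F_1: "F 1 \<noteq> id"
proof
  assume "F 1 = id"
  hence "\<Psi> (elmt i (mterm \<alpha> 1)) = \<Psi> id" by (simp only: F_def Psi_id)
  from Psi_inj[OF elmt_N NAut_id this] have "elmt i (mterm \<alpha> (1 :: 'a)) (pvar i) = pvar i" by simp
  hence "mterm \<alpha> (1 :: 'a) = 0" by (simp add: elmt_pvar)
  thus False by simp
qed

lemma F_coef_poly: "\<exists>H. \<forall>c. coef (F c (pvar k)) m = poly H c"
proof -
  have "(\<lambda>c. \<Psi> (elmt i (mterm \<alpha> c)) (pvar k)) \<in> families (polys 0)"
    by (rule Psi_families[where C = "\<lambda>c. elmt i (mterm \<alpha> c)", OF elmt_N families_elmt])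
  hence "(\<lambda>c. coef (F c (pvar k)) m) \<in> polys 0" unfolding families_def F_def by blast
  thus ?thesis unfolding polys_def by (auto simp: fun_eq_iff)
qed

lemma F_equivariant:
  assumes t: "\<forall>v. t v \<noteq> (0 :: 'a)"
  shows "coef (F (c * chr (wroot i \<alpha>) t) (pvar k)) m = chr (pull (wroot k m)) t * coef (F c (pvar k)) m"
proof -
  define s where "s = (\<lambda>v. chr (M v) t)"
  have s: "\<forall>v. s v \<noteq> 0" unfolding s_def by (rule chr_M_nz[OF t])
  let ?c = "c * chr (wroot i \<alpha>) t"
  have "dil t \<circ> elmt i (mterm \<alpha> c) = elmt i (mterm \<alpha> ?c) \<circ> dil t"
    using dil_elmt_mterm[of t i \<alpha> c] t \<alpha> by (simp add: chr_wroot[OF t])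
  hence "\<Psi> (dil t) \<circ> F c = F ?c \<circ> \<Psi> (dil t)"
    unfolding F_def using Psi_comp[OF dil_NAut[OF t] elmt_N, of c] Psi_comp[OF elmt_N dil_NAut[OF t], of ?c] by simp
  hence "(dil s \<circ> F c) (pvar k) = (F ?c \<circ> dil s) (pvar k)" unfolding Psi_dil[OF t] s_def by (rule fun_cong)
  hence "dil s (F c (pvar k)) = pconst (s k) * F ?c (pvar k)" by (simp add: alg_aut_simps[OF F_aut])
  from arg_cong[OF this, of "\<lambda>p. coef p m"] 
  have "mono_eval s m * coef (F c (pvar k)) m = s k * coef (F ?c (pvar k)) m" by (simp only: coef_dil coef_pconst_mult)
  hence "coef (F ?c (pvar k)) m = (mono_eval s m / s k) * coef (F c (pvar k)) m" using s by (simp add: field_simps)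
  moreover have "mono_eval s m / s k = chr (pull (wroot k m)) t"
    using chr_wroot[OF s, of k m] chr_pull[OF t, of "wroot k m"] by (simp only: s_def)
  ultimately show ?thesis by (simp only:)
qed

text \<open>As a function of the parameter, each coefficient is a polynomial that the torus
  multiplies by a character, hence a monomial. That character is trivial on the kernel of the root,
  so it is a multiple of the root.\<close>

lemma F_coef:
  assumes "coef (F c0 (pvar k)) m \<noteq> 0"
  shows "\<exists>n a. a \<noteq> 0 \<and> (\<forall>c. coef (F c (pvar k)) m = a * c ^ n) \<and> pull (wroot k m) = (\<lambda>w. int n * wroot i \<alpha> w)"
proof -
  obtain H where H: "\<And>c. coef (F c (pvar k)) m = poly H c" using F_coef_poly by blast
  have "H \<noteq> 0" using assms H by auto
  define P where "P = pull (wroot k m)"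
  have equiv: "poly H (c * chr (wroot i \<alpha>) t) = chr P t * poly H c" if "\<forall>v. t v \<noteq> 0" for c t
    using F_equivariant[OF that, of c k m] by (simp only: H P_def)
  have ri: "wroot i \<alpha> i = -1" by (simp add: wroot_def \<alpha>)
  \<comment> \<open>The root has coordinate -1 at \<open>i\<close>, so the inverse of
    \<open>u\<close> in direction \<open>i\<close> scales the parameter by \<open>u\<close>.\<close>
  have "poly H u = u powi (- P i) * poly H 1" if "u \<noteq> 0" for u
  proof -
    have "\<forall>v. cochar i (inverse u) v \<noteq> 0" using that by simp
    from equiv[OF this, of 1] show ?thesis using that by (simp add: ri power_int_minus power_int_inverse)
  qed
  from poly_homogeneous[OF this \<open>H \<noteq> 0\<close>] obtain n where n: "- P i = int n" "poly H 1 \<noteq> 0" "\<forall>u. poly H u = poly H 1 * u ^ n" by blast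
  have "P j = int n * wroot i \<alpha> j" for j
  proof (cases "j = i")
    case False
    have "P j + int (coef \<alpha> j) * P i = 0"
    proof (rule powi_eq_1_imp)
      fix u :: 'a assume u: "u \<noteq> 0"
      \<comment> \<open>A one-parameter subgroup in the kernel of the root: the factor u^(coef
        \<alpha> j) coming from x^\<alpha> cancels against t_i.\<close>
      define t where "t = (\<lambda>v. if v = j then u else if v = i then u ^ coef \<alpha> j else 1)"
      have t: "\<forall>v. t v \<noteq> 0" using u by (simp add: t_def)
      have chr_t: "chr Q t = u powi Q j * u powi (int (coef \<alpha> j) * Q i)" for Q
      proof -
        have "chr Q t = (\<Prod>v\<in>{j, i}. t v powi Q v)"
          unfolding chr_def by (rule prod.mono_neutral_right) (auto simp: t_def)
        thus ?thesis using False by (simp add: t_def power_int_mult)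
      qed
      have "chr (wroot i \<alpha>) t = 1" unfolding chr_t using u False
        by (simp add: ri  wroot_def \<alpha> power_int_minus)
      with equiv[OF t, of 1] have "poly H 1 = chr P t * poly H 1" by simp
      hence "chr P t = 1" using n(2) by simp
      thus "u powi (P j + int (coef \<alpha> j) * P i) = 1" using u unfolding chr_t by (simp add: power_int_add)
    qed
    thus ?thesis using False n(1) by (simp add: wroot_def) (metis add_eq_0_iff2 minus_mult_right mult.commute)
  qed (use n(1) ri in simp)
  hence "P = (\<lambda>w. int n * wroot i \<alpha> w)" by blast
  moreover have "coef (F c (pvar k)) m = poly H 1 * c ^ n" for c
    using H[of c] n(3)[rule_format, of c] by (rule trans)
  ultimately show ?thesis using n(2) unfolding P_def by blast
qed

text \<open>The image is nontrivial, so some coefficient differs between the parameters 0 and 1; by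
  \<open>F_coef\<close> it is a monomial of positive degree in the parameter.\<close>

lemma F_moving:
  "\<exists>k m n a. a \<noteq> 0 \<and> n > 0 \<and> (\<forall>c. coef (F c (pvar k)) m = a * c ^ n) \<and> pull (wroot k m) = (\<lambda>w. int n * wroot i \<alpha> w)"
proof -
  have "\<exists>k. F 1 (pvar k) \<noteq> pvar k"
  proof (rule ccontr)
    assume "\<not> (\<exists>k. F 1 (pvar k) \<noteq> pvar k)"
    hence "F 1 = id" by (intro alg_aut_eqI F_aut) simp_all
    thus False using F_1 by blast
  qed
  then obtain k m where km: "coef (F 1 (pvar k)) m \<noteq> coef (F 0 (pvar k)) m"
    unfolding F_0 by (metis id_apply poly_mapping_eqI)
  hence "coef (F 1 (pvar k)) m \<noteq> 0 \<or> coef (F 0 (pvar k)) m \<noteq> 0" by auto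
  then obtain c0 where "coef (F c0 (pvar k)) m \<noteq> 0" by blast
  from F_coef[OF this] obtain n a where na: "a \<noteq> 0" "\<forall>c. coef (F c (pvar k)) m = a * c ^ n"
    "pull (wroot k m) = (\<lambda>w. int n * wroot i \<alpha> w)" by blast
  have "n > 0" using km na(2) by (cases n) simp_all
  thus ?thesis using na by blast
qed

end

text \<open>For \<alpha> = 0 the roots are the negatives of the coordinate vectors, so
  \<open>F_moving\<close> puts a nonzero multiple of each of them into the image of
  \<open>pull\<close>. Hence the weight matrix has a rational inverse.\<close>

lemma pull_inj:
  assumes "pull \<beta> = (\<lambda>_. 0)"
  shows "\<beta> = (\<lambda>_. 0)"
proof -
  have "\<forall>i. \<exists>b :: 'v \<Rightarrow> int. \<exists>n. n > 0 \<and> pull b = (\<lambda>w. if w = i then - int n else 0)"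
  proof
    fix i
    obtain k m n where n: "n > 0" "pull (wroot k m) = (\<lambda>w. int n * wroot i 0 w)"
      using F_moving[of 0 i] by auto
    have "(\<lambda>w. int n * wroot i 0 w) = (\<lambda>w. if w = i then - int n else 0)" by (auto simp: wroot_def)
    thus "\<exists>b :: 'v \<Rightarrow> int. \<exists>n. n > 0 \<and> pull b = (\<lambda>w. if w = i then - int n else 0)" using n by metis
  qed
  from choice[OF this] obtain b where "\<forall>i. \<exists>n. n > 0 \<and> pull (b i) = (\<lambda>w. if w = i then - int n else 0)" ..
  from choice[OF this] obtain n where bn: "\<And>i. n i > 0" "\<And>i. pull (b i) = (\<lambda>w. if w = i then - int (n i) else 0)" by blast
  define A :: "rat ^ 'v ^ 'v" where "A = (\<chi> v. \<chi> w. of_int (M v w))"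
  define B :: "rat ^ 'v ^ 'v" where "B = (\<chi> i. \<chi> v. - of_int (b i v) / of_nat (n i))"
  have "vec_nth (vec_nth (B ** A) i) w = vec_nth (vec_nth (mat 1) i) w" for i w
  proof -
    have "vec_nth (vec_nth (B ** A) i) w = (\<Sum>v\<in>UNIV. - of_int (b i v) / of_nat (n i) * of_int (M v w))"
      by (simp add: matrix_matrix_mult_def A_def B_def)
    also have "\<dots> = - of_int (pull (b i) w) / of_nat (n i)"
      by (simp add: pull_def sum_divide_distrib sum_negf)
    also have "\<dots> = vec_nth (vec_nth (mat 1) i) w" using bn(1)[of i] by (auto simp: bn(2) mat_def)
    finally show ?thesis .
  qed
  hence "B ** A = mat 1" by (simp add: vec_eq_iff)
  hence AB: "A ** B = mat 1" using matrix_left_right_inverse by blast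
  show ?thesis
  proof
    fix u
    have "(of_int (\<beta> u) :: rat) = (\<Sum>v\<in>UNIV. of_int (\<beta> v) * vec_nth (vec_nth (mat 1) v) u)"
      by (simp add: mat_def if_distrib[of "\<lambda>x. _ * x"] cong: if_cong)
    also have "\<dots> = (\<Sum>v\<in>UNIV. \<Sum>w\<in>UNIV. of_int (\<beta> v) * (of_int (M v w) * vec_nth (vec_nth B w) u))"
      unfolding AB[symmetric] by (simp add: matrix_matrix_mult_def A_def sum_distrib_left)
    also have "\<dots> = (\<Sum>w\<in>UNIV. of_int (pull \<beta> w) * vec_nth (vec_nth B w) u)"
      by (subst sum.swap) (simp add: pull_def sum_distrib_right mult.assoc)
    also have "\<dots> = 0" by (simp add: assms)
    finally show "\<beta> u = 0" by simp
  qed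
qed

lemma pull_cancel:
  assumes "pull \<beta> = pull \<gamma>"
  shows "\<beta> = \<gamma>"
proof -
  have "pull (\<lambda>v. \<beta> v - \<gamma> v) = (\<lambda>_. 0)" unfolding pull_diff[abs_def] assms by simp
  from pull_inj[OF this] show ?thesis by (simp add: fun_eq_iff)
qed

end

lemma finv_finv: "f \<in> alg_aut \<Longrightarrow> finv (finv f) = f"
  by (rule inv_inv_eq[OF alg_aut_bij])

section \<open>Images of root subgroups and of translations\<close>

context diagonalised
begin

text \<open>By injectivity of \<open>pull\<close> all terms that occur have weights proportional to
  that of one moving term m0 in the image of x_k0. This weight is negative at \<open>k0\<close>, and
  a weight of the form \<open>wroot v m\<close> can be negative only at \<open>v\<close>; so no
  other term moves.\<close>

lemma root_image_power:
  assumes \<alpha>: "coef \<alpha> i = 0"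
  shows "\<exists>k m n a. coef m k = 0 \<and> a \<noteq> 0 \<and> n > 0 \<and> pull (wroot k m) = (\<lambda>w. int n * wroot i \<alpha> w) \<and>
    (\<forall>c. \<Psi> (elmt i (mterm \<alpha> c)) = elmt k (mterm m (a * c ^ n)))"
proof -
  obtain k0 m0 n0 a0 where a0: "a0 \<noteq> 0" and n0: "n0 > 0" and co0: "\<And>c. coef (F i \<alpha> c (pvar k0)) m0 = a0 * c ^ n0"
    and pull0: "pull (wroot k0 m0) = (\<lambda>w. int n0 * wroot i \<alpha> w)"
    using F_moving[OF \<alpha>] by blast
  have ratio: "\<exists>n a. a \<noteq> 0 \<and> (\<forall>c. coef (F i \<alpha> c (pvar k)) m = a * c ^ n) \<and> (\<forall>v. int n0 * wroot k m v = int n * wroot k0 m0 v)"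
    if nz: "coef (F i \<alpha> c (pvar k)) m \<noteq> 0" for k m c
  proof -
    obtain n a where na: "a \<noteq> 0" "\<forall>c. coef (F i \<alpha> c (pvar k)) m = a * c ^ n" 
      and p: "pull (wroot k m) = (\<lambda>w. int n * wroot i \<alpha> w)"
      using F_coef[OF \<alpha> nz] by blast
    have "pull (\<lambda>v. int n0 * wroot k m v) = pull (\<lambda>v. int n * wroot k0 m0 v)"
      unfolding pull_scale[abs_def] p pull0 by (simp add: mult.left_commute)
    from pull_cancel[OF this] have "int n0 * wroot k m v = int n * wroot k0 m0 v" for v by (rule fun_cong)
    thus ?thesis using na by blast
  qed
  have ne: "m0 \<noteq> mterm k0 1"
  proof
    assume "m0 = mterm k0 1"
    hence "wroot k0 m0 = (\<lambda>_. 0)" by (simp only: wroot_eq_0_iff)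
    hence "pull (wroot k0 m0) i = 0" by (simp add: pull_def)
    thus False using pull0 n0 by (simp add: wroot_def \<alpha>)
  qed
  \<comment> \<open>Otherwise all occurring weights are nonnegative, so the image of each variable
    is divisible by that variable. Since F(-1) inverts F(1), the cofactor is a unit, hence constant,
    and the term m0 could not occur.\<close>
  have k0: "coef m0 k0 = 0"
  proof (rule ccontr)
    assume ge: "coef m0 k0 \<noteq> 0"
    have "coef m k \<ge> 1" if "m \<in> supp (F i \<alpha> c (pvar k))" for m k c
    proof -
      have "coef (F i \<alpha> c (pvar k)) m \<noteq> 0" using that by (simp add: in_keys_iff)
      from ratio[OF this] obtain n where "int n0 * wroot k m k = int n * wroot k0 m0 k" by blast
      moreover have "wroot k0 m0 k \<ge> 0" using ge by (simp add: wroot_def)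
      ultimately have "0 \<le> int n0 * wroot k m k" by simp
      hence "0 \<le> wroot k m k" using n0 by (simp add: zero_le_mult_iff)
      thus ?thesis by (simp add: wroot_def)
    qed
    hence "\<exists>q. F i \<alpha> c (pvar k) = pvar k * q" for c k by (intro pvar_dvd)
    then obtain q q' where q: "F i \<alpha> 1 (pvar k0) = pvar k0 * q" "F i \<alpha> (- 1) (pvar k0) = pvar k0 * q'" by metis
    have "pvar k0 = F i \<alpha> (- 1) (F i \<alpha> 1 (pvar k0))"
      using F_comp[OF \<alpha>, of "- 1" 1] F_0[OF \<alpha>] by (simp add: fun_eq_iff)
    also have "\<dots> = pvar k0 * (q' * F i \<alpha> (- 1) q)"
      by (simp add: q alg_aut_simps[OF F_aut[OF \<alpha>]] mult.assoc)
    finally have "pvar k0 * 1 = pvar k0 * (q' * F i \<alpha> (- 1) q)" by simp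
    moreover have "pvar k0 \<noteq> (0 :: ('v, 'a) pol)" by (simp add: pvar_def)
    ultimately have "1 = q' * F i \<alpha> (- 1) q" by (rule pol_mult_cancel)
    then obtain d where d: "q' = pconst d" using pol_unit_const[of q'] by metis
    have "coef (F i \<alpha> (- 1) (pvar k0)) m0 = d * coef (pvar k0) m0"
      unfolding q d by (simp only: mult.commute[of "pvar k0"] coef_pconst_mult)
    also have "\<dots> = 0" using ne by (simp add: coef_pvar)
    finally show False unfolding co0 using a0 by simp
  qed
  have F0: "coef (F i \<alpha> 0 (pvar v)) m = coef (pvar v) m" for v m by (simp add: F_0[OF \<alpha>])
  have e_aut: "elmt k0 (mterm m0 c) \<in> alg_aut" for c :: 'a by (rule elmt_aut) (simp add: k0)
  have "F i \<alpha> c = elmt k0 (mterm m0 (a0 * c ^ n0))" for c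
  proof (rule alg_aut_eqI[OF F_aut[OF \<alpha>] e_aut], rule poly_mapping_eqI)
    fix v m
    have rhs: "coef (elmt k0 (mterm m0 (a0 * c ^ n0)) (pvar v)) m = coef (pvar v) m + (if v = k0 \<and> m = m0 then a0 * c ^ n0 else 0)"
      by (auto simp: elmt_pvar lookup_add lookup_single when_def)
    show "coef (F i \<alpha> c (pvar v)) m = coef (elmt k0 (mterm m0 (a0 * c ^ n0)) (pvar v)) m"
    proof (cases "\<forall>c'. coef (F i \<alpha> c' (pvar v)) m = 0")
      case True
      have "\<not> (v = k0 \<and> m = m0)" using co0[of 1] True a0 by auto
      moreover have "coef (pvar v :: ('v, 'a) pol) m = 0" using True F0[of v m] by metis
      ultimately show ?thesis unfolding rhs using True by auto
    next
      case False
      then obtain c' where "coef (F i \<alpha> c' (pvar v)) m \<noteq> 0" by blast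
      from ratio[OF this] obtain n a where na: "a \<noteq> 0" "\<And>c. coef (F i \<alpha> c (pvar v)) m = a * c ^ n" 
        "\<And>w. int n0 * wroot v m w = int n * wroot k0 m0 w" by blast
      show ?thesis
      proof (cases "n = 0")
        case True
        have "\<not> (v = k0 \<and> m = m0)"
        proof
          assume "v = k0 \<and> m = m0"
          hence "a0 * 0 ^ n0 = a * 0 ^ n" using co0[of 0] na(2)[of 0] by simp
          thus False using True na(1) n0 by (simp add: power_0_left)
        qed
        moreover have "coef (pvar v) m = a" using na(2)[of 0] F0[of v m] True by simp
        moreover have "coef (F i \<alpha> c (pvar v)) m = a" using na(2)[of c] True by simp
        ultimately show ?thesis unfolding rhs by auto
      next
        case n: False
        have z: "coef (pvar v :: ('v, 'a) pol) m = 0" using na(2)[of 0] F0[of v m] n by (simp add: power_0_left)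
        have eq: "int n0 * wroot v m k0 = - int n" using na(3)[of k0] by (simp add: wroot_def[of k0 m0] k0)
        have neg: "wroot v m k0 < 0"
        proof (rule ccontr)
          assume "\<not> wroot v m k0 < 0"
          hence "0 \<le> int n0 * wroot v m k0" by simp
          thus False using eq n by simp
        qed
        hence v: "v = k0" "coef m k0 = 0" by (auto simp: wroot_def split: if_splits)
        hence "n0 = n" using eq by (simp add: wroot_def)
        hence "wroot v m w = wroot k0 m0 w" for w using na(3)[of w] n0 by simp
        hence "m = m0" using wroot_inj_mono[of k0 m m0] v(1) by blast
        thus ?thesis unfolding rhs using v(1) co0[of c] z by simp
      qed
    qed
  qed
  hence "\<forall>c. \<Psi> (elmt i (mterm \<alpha> c)) = elmt k0 (mterm m0 (a0 * c ^ n0))"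
    using F_def[OF \<alpha>] by simp
  with k0 a0 n0 pull0 show ?thesis by blast
qed

text \<open>Regularity of \<open>\<Phi>\<inverse>\<close> excludes proper powers \<open>n\<close>, which are those of the characteristic: the
  Frobenius on coefficients is a bijective regular endomorphism.\<close>

lemma root_image:
  assumes \<alpha>: "coef \<alpha> i = 0"
  shows "\<exists>k m a. coef m k = 0 \<and> a \<noteq> 0 \<and> pull (wroot k m) = wroot i \<alpha> \<and>
    (\<forall>c. \<Psi> (elmt i (mterm \<alpha> c)) = elmt k (mterm m (a * c)))"
proof -
  obtain k m n a where k: "coef m k = 0" and a: "a \<noteq> 0" and n: "n > 0" 
    and p: "pull (wroot k m) = (\<lambda>w. int n * wroot i \<alpha> w)"
    and E: "\<And>c. \<Psi> (elmt i (mterm \<alpha> c)) = elmt k (mterm m (a * c ^ n))"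
    using root_image_power[OF \<alpha>] by blast
  define G where "G = (\<lambda>b. g \<circ> elmt k (mterm m b) \<circ> finv g)"
  have N: "elmt i (mterm \<alpha> c) \<in> NAut" for c :: 'a by (rule elmt_NAut) (simp add: \<alpha>)
  have G_Phi: "G (a * c ^ n) = \<Phi> (elmt i (mterm \<alpha> c))" for c
    unfolding Phi_Psi[OF N] E G_def ..
  have G_NAut: "G b \<in> NAut" for b
  proof -
    obtain c where "c ^ n = b / a" using nth_root_exists[OF n] by blast
    hence "b = a * c ^ n" using a by simp
    thus ?thesis using Phi_NAut[OF N] by (simp only: G_Phi)
  qed
  have e_aut: "elmt k (mterm m b) \<in> alg_aut" for b :: 'a by (rule elmt_aut) (simp add: k)
  have "(\<lambda>b. G b (pvar v)) \<in> families (polys 0)" for v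
    using families_conj[where F = "\<lambda>b. elmt k (mterm m b)", OF fun_algebra_polys alg_aut_inv[OF g] alg_aut_hom[OF e_aut] families_elmt, of "pvar v"]
    by (simp add: finv_finv[OF g] G_def)
  from curve_regular_polys[where C = G, OF inv_regular G_NAut this]
  have "(\<lambda>b. inv_into NAut \<Phi> (G b) (pvar i)) \<in> families (polys 0)" .
  hence "(\<lambda>b. coef (inv_into NAut \<Phi> (G b) (pvar i)) \<alpha>) \<in> polys 0" unfolding families_def by blast
  then obtain H where H: "\<And>b. coef (inv_into NAut \<Phi> (G b) (pvar i)) \<alpha> = poly H b"
    unfolding polys_def by (auto simp: fun_eq_iff)
  have "\<alpha> \<noteq> mterm i 1" using \<alpha> by auto
  hence c: "poly H (a * c ^ n) = c" for c
    unfolding H[symmetric] G_Phi bij_betw_inv_into_left[OF bij N]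
    by (simp add: elmt_pvar lookup_add coef_pvar)
  \<comment> \<open>The inverse reads off the parameter \<open>c\<close> as a polynomial in a c^n;
    comparing degrees gives n = 1.\<close>
  have "pcompose H (Polynomial.monom a n) = [:0, 1:]"
    by (rule poly_eqI_cofinite[OF alg_closed_infinite]) (simp add: poly_pcompose poly_monom c)
  from arg_cong[OF this, of Polynomial.degree] have "Polynomial.degree H * n = 1"
    using a by (simp add: degree_pcompose degree_monom_eq)
  hence n1: "n = 1" by simp
  have "pull (wroot k m) = wroot i \<alpha>" using p by (simp add: n1)
  moreover have "\<forall>c. \<Psi> (elmt i (mterm \<alpha> c)) = elmt k (mterm m (a * c))" using E by (simp add: n1)
  ultimately show ?thesis using k a by blast
qed

text \<open>Let the image root of the translation of x_j be positive at some \<open>w\<close>. For i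
  different from j, all -e_i + n e_j are roots, and their images have coordinates at
  \<open>w\<close> that tend to minus infinity, whereas no root has a coordinate below -1.\<close>

lemma translation_image:
  assumes card: "CARD('v) \<ge> 2"
  shows "\<exists>k a. a \<noteq> 0 \<and> pull (wroot k 0) = wroot j 0 \<and> (\<forall>c. \<Psi> (elmt j (pconst c)) = elmt k (pconst (a * c)))"
proof -
  obtain k m a where k: "coef m k = 0" "a \<noteq> 0" and p: "pull (wroot k m) = wroot j 0"
    and E: "\<forall>c. \<Psi> (elmt j (mterm 0 c)) = elmt k (mterm m (a * c))"
    using root_image[of 0 j] by auto
  have "\<exists>i. i \<noteq> j"
  proof (rule ccontr)
    assume "\<not> (\<exists>i. i \<noteq> j)"
    hence "(UNIV :: 'v set) = {j}" by blast
    hence "CARD('v) = card {j}" by (simp only:)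
    thus False using card by simp
  qed
  then obtain i where i: "i \<noteq> j" by blast
  obtain k' m' where p': "pull (wroot k' m') = wroot i 0" using root_image[of 0 i] by auto
  have "coef m w = 0" for w
  proof (rule ccontr)
    assume nz: "coef m w \<noteq> 0"
    hence w: "wroot k m w \<ge> 1" using k(1) by (auto simp: wroot_def)
    \<comment> \<open>With \<open>n\<close> so chosen the coordinate at \<open>w\<close> is at most
      -2; the sum under \<open>nat\<close> is at least 1, because coordinates of roots are at least
      -1.\<close>
    define n where "n = nat (wroot k' m' w + 2)"
    have n: "int n = wroot k' m' w + 2" unfolding n_def by (simp add: wroot_def)
    obtain k'' m'' where p'': "pull (wroot k'' m'') = wroot i (mterm j n)"
      using root_image[of "mterm j n" i] i by (auto simp: lookup_single when_def)
    have "pull (\<lambda>v. wroot k' m' v - int n * wroot k m v) = pull (wroot k'' m'')"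
      unfolding pull_diff[abs_def] pull_scale p' p p'' using i
      by (auto simp: wroot_def lookup_single when_def fun_eq_iff)
    from fun_cong[OF pull_cancel[OF this], of w] 
    have "wroot k'' m'' w = wroot k' m' w - int n * wroot k m w" by simp
    also have "\<dots> \<le> wroot k' m' w - int n * 1"
      using w by (intro diff_left_mono mult_left_mono) simp_all
    also have "\<dots> = -2" using n by simp
    finally show False by (simp add: wroot_def split: if_splits)
  qed
  hence "m = 0" by (intro poly_mapping_eqI) simp
  thus ?thesis using k(2) p E by (auto simp: pconst_def)
qed

lemma monomial_conjugation:
  assumes card: "CARD('v) \<ge> 2"
  shows "\<exists>g'\<in>alg_aut. (\<forall>t. (\<forall>v. t v \<noteq> 0) \<longrightarrow> finv g' \<circ> \<Phi> (dil t) \<circ> g' = dil t) \<and>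
           (\<forall>j c. finv g' \<circ> \<Phi> (elmt j (pconst c)) \<circ> g' = elmt j (pconst c))"
proof -
  from translation_image[OF card] have "\<forall>j. \<exists>k a. a \<noteq> 0 \<and> pull (wroot k 0) = wroot j 0 \<and> (\<forall>c. \<Psi> (elmt j (pconst c)) = elmt k (pconst (a * c)))" by blast
  from choice[OF this] obtain p where "\<forall>j. \<exists>a. a \<noteq> 0 \<and> pull (wroot (p j) 0) = wroot j 0 \<and> (\<forall>c. \<Psi> (elmt j (pconst c)) = elmt (p j) (pconst (a * c)))" ..
  from choice[OF this] obtain a where pa: "\<And>j. a j \<noteq> 0" "\<And>j. pull (wroot (p j) 0) = wroot j 0" 
    "\<And>j c. \<Psi> (elmt j (pconst c)) = elmt (p j) (pconst (a j * c))" by blast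
  have w0: "wroot k 0 = (\<lambda>v. if v = k then -1 else 0)" for k :: 'v by (auto simp: wroot_def)
  \<comment> \<open>The weight matrix is thereby a permutation matrix, and \<open>p\<close> is the
    permutation of the translations.\<close>
  have Mp: "M (p j) w = (if w = j then 1 else 0)" for j w
    using fun_cong[OF pa(2)[of j], of w] unfolding w0 pull_minus_single by (simp split: if_splits)
  have "inj p"
  proof (rule injI)
    fix i j assume "p i = p j"
    hence "M (p i) i = M (p j) i" by simp
    thus "i = j" by (simp add: Mp split: if_splits)
  qed
  hence bij: "bij p" using finite_UNIV_inj_surj[OF _ \<open>inj p\<close>] by (simp add: bij_def)
  have pp: "p (finv p w) = w" "finv p (p w) = w" for w
    using bij by (simp_all add: bij_def surj_f_inv_f)
  \<comment> \<open>\<open>h\<close> undoes the permutation, and the factor inverse (a v) restores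
    the parameter \<open>c\<close> from \<open>a v * c\<close>.\<close>
  define h where "h = sub (\<lambda>v. pconst (inverse (a v)) * pvar (p v))"
  define h' where "h' = sub (\<lambda>w. pconst (a (finv p w)) * pvar (finv p w))"
  have h_pvar: "h (pvar v) = pconst (inverse (a v)) * pvar (p v)" for v by (simp add: h_def)
  have h_hom: "alg_hom h" by (simp add: h_def)
  have hh: "h (h' (pvar v)) = pvar v" "h' (h (pvar v)) = pvar v" for v
    using pa(1) by (simp_all add: h_def h'_def alg_hom_simps[OF alg_hom_sub] pp mult.assoc[symmetric] pconst_simps(4)[symmetric])
  have h: "h \<in> alg_aut" by (rule alg_autI(1)[of h h']) (simp_all add: hh h_hom, simp add: h'_def)
  have g': "g \<circ> h \<in> alg_aut" by (rule alg_aut_comp[OF g h])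
  have conj: "finv (g \<circ> h) \<circ> \<Phi> f \<circ> (g \<circ> h) = f" if f: "f \<in> NAut" and eq: "\<And>v. \<Psi> f (h (pvar v)) = h (f (pvar v))" for f
  proof -
    have "\<Psi> f \<circ> h = h \<circ> f"
      by (rule alg_aut_eqI) (use f h eq in \<open>simp_all add: alg_aut_comp Psi_aut NAut_aut\<close>)
    hence "finv h \<circ> (\<Psi> f \<circ> h) = f" using h by simp
    moreover have "finv (g \<circ> h) \<circ> \<Phi> f \<circ> (g \<circ> h) = finv h \<circ> (\<Psi> f \<circ> h)"
      unfolding inv_comp_alg_aut[OF g h] \<Psi>_def by (simp only: comp_assoc)
    ultimately show ?thesis by (rule trans[rotated])
  qed
  have "finv (g \<circ> h) \<circ> \<Phi> (dil t) \<circ> (g \<circ> h) = dil t" if t: "\<forall>v. t v \<noteq> 0" for t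
  proof (rule conj[OF dil_NAut[OF t]])
    fix v
    have "chr (M (p v)) t = t v"
      by (simp add: chr_def Mp if_distrib[of "\<lambda>x. _ powi x"] cong: if_cong)
    thus "\<Psi> (dil t) (h (pvar v)) = h (dil t (pvar v))"
      unfolding Psi_dil[OF t] h_pvar dil_pvar alg_hom_simps[OF alg_hom_dil] alg_hom_simps[OF h_hom]
      by (simp add: mult.left_commute)
  qed
  moreover have "finv (g \<circ> h) \<circ> \<Phi> (elmt j (pconst c)) \<circ> (g \<circ> h) = elmt j (pconst c)" for j c
  proof (rule conj[OF elmt_NAut])
    fix v
    have pv: "p v = p j \<longleftrightarrow> v = j" using \<open>inj p\<close> by (auto dest: injD)
    have "pconst (inverse (a j)) * pconst (a j * c) = (pconst c :: ('v, 'a) pol)"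
      using pa(1)[of j] by (simp add: pconst_simps(4)[symmetric] mult.assoc[symmetric])
    thus "\<Psi> (elmt j (pconst c)) (h (pvar v)) = h (elmt j (pconst c) (pvar v))"
      unfolding pa(3) h_pvar by (simp add: elmt_pvar pv alg_hom_simps[OF alg_hom_elmt] alg_hom_simps[OF h_hom] h_pvar distrib_left)
  qed simp
  ultimately show ?thesis using g' by blast
qed

end

section \<open>Rigidity\<close>

lemma flat_monom:
  assumes "0 < k" "N \<le> k"
  shows "flat N (Polynomial.monom c k)"
proof -
  have "Polynomial.monom 1 N * Polynomial.monom c (k - N) = Polynomial.monom c k"
    using assms(2) by (simp add: mult_monom)
  hence "Polynomial.monom 1 N dvd Polynomial.monom c k" by (metis dvd_triv_left)
  thus ?thesis using assms(1) by (simp add: flat_def poly_monom power_0_left)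
qed

lemma hom_close:
  assumes f: "alg_hom f" and v: "\<And>v. f (pvar v) - pvar v \<in> ord_ge N"
  shows "f p - p \<in> ord_ge N"
proof -
  define P where "P = (\<lambda>p. f p - p \<in> ord_ge N)"
  note f_simps = alg_hom_simps[OF f]
  have P_mult: "P (p * q)" if "P p" "P q" for p q
  proof -
    have "f (p * q) - p * q = (f p - p) * f q + p * (f q - q)" by (simp add: f_simps algebra_simps)
    moreover have "(f p - p) * f q \<in> ord_ge N" "p * (f q - q) \<in> ord_ge N"
      using that ord_ge_mult[of "f p - p" N "f q" 0] ord_ge_mult[of p 0 "f q - q" N] by (simp_all add: P_def)
    ultimately show ?thesis by (simp only: P_def ord_ge_add)
  qed
  have P_const: "P (pconst c)" for c by (simp add: P_def f_simps)
  have P_add: "P (p + q)" if "P p" "P q" for p q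
  proof -
    have "f (p + q) - (p + q) = (f p - p) + (f q - q)" by (simp add: f_simps)
    thus ?thesis using that unfolding P_def by (simp only: ord_ge_add)
  qed
  have "P p" by (induction p rule: pol_ring_induct) (simp_all add: P_const P_add P_mult, simp add: P_def v)
  thus ?thesis by (simp add: P_def)
qed

lemma var_free_power: "var_free i p \<Longrightarrow> var_free i (p ^ k)"
  by (induction k) (auto simp: var_free_mult one_pconst)

lemma var_free_prod: "(\<And>j. j \<in> S \<Longrightarrow> var_free i (p j)) \<Longrightarrow> var_free i (prod p S)"
  by (induction S rule: infinite_finite_induct) (auto simp: var_free_mult one_pconst)

lemma var_free_shift_mterm:
  assumes "coef m i = 0"
  shows "var_free i (shift s (mterm m c))"
  unfolding shift_def sub_mterm mono_eval_def
proof (intro var_free_mult var_free_prod var_free_power var_free_add var_free_pconst)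
  fix v assume "v \<in> supp m"
  hence "v \<noteq> i" using assms by (auto simp: in_keys_iff)
  thus "var_free i (pvar v)" by (simp add: var_free_def pvar_def lookup_single when_def)
qed

locale normalised = diagonalised \<Phi> g "\<lambda>v w. if w = v then 1 else 0" 
  for \<Phi> :: "('v::finite, 'a::alg_closed_field) endo \<Rightarrow> ('v, 'a) endo" and g +
  assumes fix_translation: "\<Psi> (elmt j (pconst c)) = elmt j (pconst c)"
begin

lemma fix_dil: "\<forall>v. t v \<noteq> 0 \<Longrightarrow> \<Psi> (dil t) = dil t"
proof -
  assume t: "\<forall>v. t v \<noteq> 0"
  have "chr (\<lambda>w. if w = v then 1 else 0) t = t v" for v
    by (simp add: chr_def if_distrib[of "\<lambda>x. _ powi x"] cong: if_cong)
  thus ?thesis using Psi_dil[OF t] by simp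
qed

lemma pull_id: "pull \<beta> = \<beta>"
  by (simp add: pull_def[abs_def] if_distrib[of "\<lambda>x. _ * x"] cong: if_cong)

text \<open>With the torus fixed, the root is preserved. It determines the moved variable, as the
  place of its only negative coordinate, and then the monomial.\<close>

lemma mterm_image:
  assumes m: "coef m i = 0"
  shows "\<exists>a. \<forall>c. \<Psi> (elmt i (mterm m c)) = elmt i (mterm m (a * c))"
proof -
  obtain k m' a where k: "coef m' k = 0" and eq: "wroot k m' = wroot i m"
    and E: "\<forall>c. \<Psi> (elmt i (mterm m c)) = elmt k (mterm m' (a * c))"
    using root_image[OF m] unfolding pull_id by blast
  have "k = i" using fun_cong[OF eq, of k] k by (auto simp: wroot_def split: if_splits)
  moreover have "m' = m" using eq unfolding \<open>k = i\<close> by (rule wroot_inj_mono)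
  ultimately show ?thesis using E by blast
qed

definition scale :: "'v \<Rightarrow> ('v \<Rightarrow>\<^sub>0 nat) \<Rightarrow> 'a"
  where "scale i m = (SOME a. \<forall>c. \<Psi> (elmt i (mterm m c)) = elmt i (mterm m (a * c)))"

lemma scale: "coef m i = 0 \<Longrightarrow> \<Psi> (elmt i (mterm m c)) = elmt i (mterm m (scale i m * c))"
  using someI_ex[OF mterm_image[of m i]] unfolding scale_def by blast

lemma scale_0: "scale i 0 = 1"
proof -
  have "elmt i (pconst 1) = elmt i (pconst (scale i 0 * 1))"
    using fix_translation[of i 1] scale[of 0 i 1, OF lookup_zero] unfolding pconst_def by (rule trans[OF sym])
  hence "elmt i (pconst 1) (pvar i) = elmt i (pconst (scale i 0 * 1)) (pvar i)" by (rule fun_cong)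
  thus ?thesis by (simp add: elmt_pvar)
qed

text \<open>Elementary automorphisms of the same variable compose by adding their polynomials, so
  \<open>\<Psi>\<close> acts monomial by monomial.\<close>

lemma elmt_image:
  assumes "var_free i P"
  shows "\<Psi> (elmt i P) = elmt i (\<Sum>m\<in>supp P. mterm m (scale i m * coef P m))"
proof -
  have "\<Psi> (elmt i (\<Sum>m\<in>S. mterm m (coef P m))) = elmt i (\<Sum>m\<in>S. mterm m (scale i m * coef P m))"
    if "finite S" "S \<subseteq> supp P" for S
    using that
  proof induction
    case empty show ?case by (simp only: sum.empty elmt_0 Psi_id)
  next
    case (insert x S)
    have x: "coef x i = 0" using insert.prems assms by (auto simp: var_free_def)
    have free: "var_free i (\<Sum>m\<in>S. mterm m (f m))" for f :: "_ \<Rightarrow> 'a"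
    proof -
      have "var_free i (\<Sum>m\<in>T. mterm m (f m))" if "finite T" "T \<subseteq> supp P" for T
        using that by (induction) (use assms in \<open>auto simp: var_free_def[of i P] intro!: var_free_add\<close>)
      thus ?thesis using insert by auto
    qed
    have "elmt i (\<Sum>m\<in>insert x S. mterm m (coef P m)) = elmt i (mterm x (coef P x)) \<circ> elmt i (\<Sum>m\<in>S. mterm m (coef P m))"
      using insert.hyps by (simp add: elmt_comp[OF free])
    hence "\<Psi> (elmt i (\<Sum>m\<in>insert x S. mterm m (coef P m))) = 
        elmt i (mterm x (scale i x * coef P x)) \<circ> elmt i (\<Sum>m\<in>S. mterm m (scale i m * coef P m))"
      using insert Psi_comp[OF elmt_NAut[OF var_free_mterm[OF x]] elmt_NAut[OF free]] by (simp add: scale[OF x])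
    also have "\<dots> = elmt i (\<Sum>m\<in>insert x S. mterm m (scale i m * coef P m))"
      using insert.hyps by (simp add: elmt_comp[OF free])
    finally show ?case .
  qed
  from this[of "supp P"] show ?thesis using pol_sum_terms[of P] by simp
qed

lemma shift_TAut: "shift s \<in> TAut"
  by (rule shift_induct) (rule TAut_id, rule elmt_TAut, rule var_free_pconst, rule TAut_comp)

text \<open>Conjugating \<open>x\<^sub>i \<mapsto> x\<^sub>i + x\<^sup>m\<close> by the translation by \<open>(1,\<dots>,1)\<close> gives \<open>x\<^sub>i \<mapsto> x\<^sub>i + (x + 1)\<^sup>m\<close>; comparing
  constant terms yields \<open>scale i m = scale i 0\<close>.\<close>

lemma fix_shift: "\<Psi> (shift s) = shift s"
proof -
  have "shift s \<in> TAut \<and> \<Psi> (shift s) = shift s"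
  proof (rule shift_induct)
    show "id \<in> TAut \<and> \<Psi> id = id" using TAut_id Psi_id by (rule conjI)
    show "elmt i (pconst c) \<in> TAut \<and> \<Psi> (elmt i (pconst c)) = elmt i (pconst c)" for i c
      by (simp add: fix_translation)
    fix f h assume f: "f \<in> TAut \<and> \<Psi> f = f" and h: "h \<in> TAut \<and> \<Psi> h = h"
    have "\<Psi> (f \<circ> h) = \<Psi> f \<circ> \<Psi> h" using f h by (intro Psi_comp NAut_of_TAut) simp_all
    thus "f \<circ> h \<in> TAut \<and> \<Psi> (f \<circ> h) = f \<circ> h" using f h TAut_comp[of f h] by (simp only: simp_thms)
  qed
  thus ?thesis ..
qed

lemma scale_1:
  assumes m: "coef m i = 0"
  shows "scale i m = 1"
proof -
  define V where "V = shift (\<lambda>_ :: 'v. 1 :: 'a)"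
  have V: "V \<in> alg_aut" "V \<in> NAut" "\<Psi> V = V" using NAut_of_TAut[OF shift_TAut] fix_shift by (simp_all add: V_def)
  have free: "var_free i (V (mterm m c))" for c unfolding V_def by (rule var_free_shift_mterm[OF m])
  have conj: "V \<circ> elmt i (mterm m c) = elmt i (V (mterm m c)) \<circ> V" for c
    by (rule alg_hom_eqI) 
       (auto intro!: alg_hom_comp simp: V_def elmt_pvar alg_hom_simps[OF alg_hom_shift] alg_hom_simps[OF alg_hom_elmt])
  have N: "elmt i (mterm m c) \<in> NAut" "elmt i (V (mterm m c)) \<in> NAut" for c :: 'a
    using free m by (simp_all add: elmt_NAut)
  have "\<Psi> (V \<circ> elmt i (mterm m 1)) = \<Psi> (elmt i (V (mterm m 1)) \<circ> V)" by (simp only: conj)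
  hence "V \<circ> elmt i (mterm m (scale i m * 1)) = \<Psi> (elmt i (V (mterm m 1))) \<circ> V"
    by (simp only: Psi_comp[OF V(2) N(1)] Psi_comp[OF N(2) V(2)] V(3) scale[OF m])
  hence "elmt i (V (mterm m (scale i m * 1))) \<circ> V = \<Psi> (elmt i (V (mterm m 1))) \<circ> V" by (simp only: conj)
  hence "elmt i (V (mterm m (scale i m * 1))) \<circ> V \<circ> finv V = \<Psi> (elmt i (V (mterm m 1))) \<circ> V \<circ> finv V" by (simp only:)
  hence "elmt i (V (mterm m (scale i m * 1))) = \<Psi> (elmt i (V (mterm m 1)))"
    unfolding comp_assoc alg_aut_inv_simps(3)[OF V(1)] comp_id .
  also have "\<dots> = elmt i (\<Sum>n\<in>supp (V (mterm m 1)). mterm n (scale i n * coef (V (mterm m 1)) n))"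
    by (rule elmt_image[OF free])
  finally have "elmt i (V (mterm m (scale i m * 1))) (pvar i) =
      elmt i (\<Sum>n\<in>supp (V (mterm m 1)). mterm n (scale i n * coef (V (mterm m 1)) n)) (pvar i)" by (rule fun_cong)
  hence "V (mterm m (scale i m * 1)) = (\<Sum>n\<in>supp (V (mterm m 1)). mterm n (scale i n * coef (V (mterm m 1)) n))"
    by (simp only: elmt_pvar refl if_True add_left_cancel)
  hence "coef (V (mterm m (scale i m * 1))) 0 = (\<Sum>n\<in>supp (V (mterm m 1)). if n = 0 then scale i n * coef (V (mterm m 1)) n else 0)"
    by (simp add: lookup_sum lookup_single when_def)
  also have "\<dots> = coef (V (mterm m 1)) 0" by (simp add: scale_0 in_keys_iff)
  finally have "coef (V (mterm m (scale i m * 1))) 0 = coef (V (mterm m 1)) 0" .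
  moreover have "coef (V (mterm m c)) 0 = c" for c
    unfolding V_def coef_0_shift by (simp add: pol_eval_single mono_eval_def)
  ultimately show ?thesis by simp
qed

lemma fix_elmt:
  assumes P: "var_free i P"
  shows "\<Psi> (elmt i P) = elmt i P"
proof -
  have "(\<Sum>m\<in>supp P. mterm m (scale i m * coef P m)) = (\<Sum>m\<in>supp P. mterm m (coef P m))"
    by (rule sum.cong) (use P in \<open>simp_all add: var_free_def scale_1\<close>)
  thus ?thesis using elmt_image[OF P] pol_sum_terms[of P] by simp
qed

lemma linear_NAut: "f \<in> linear_auts \<Longrightarrow> f \<in> NAut"
  by (rule NAut_of_TAut) (simp add: TAut_def generate.incl)

text \<open>Conjugation by a linear \<open>f\<close> turns translations into translations, which are
  fixed; hence \<open>f\<close> and its image differ on each variable by a translation-invariant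
  polynomial, a constant. Homotheties commute with \<open>f\<close>, and this makes the constant
  0.\<close>

lemma fix_linear:
  assumes f: "f \<in> linear_auts"
  shows "\<Psi> f = f"
proof (rule alg_aut_eqI[OF Psi_aut[OF linear_NAut[OF f]]])
  show f_aut: "f \<in> alg_aut" using f by (simp add: linear_auts_def)
  fix i
  obtain a where a: "\<And>i. f (pvar i) = (\<Sum>j\<in>UNIV. pconst (a i j) * pvar j)" using f by (auto simp: linear_auts_def)
  note fN = linear_NAut[OF f]
  note f_simps = alg_aut_simps[OF f_aut]
  note Pf_simps = alg_aut_simps[OF Psi_aut[OF fN]]
  define d where "d = \<Psi> f (pvar i) - f (pvar i)"
  have shift_f: "shift s (f (pvar i)) = f (pvar i) + pconst (\<Sum>j\<in>UNIV. a i j * s j)" for s i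
    by (simp add: a alg_hom_simps[OF alg_hom_shift] distrib_left sum.distrib pconst_simps(4) ring_hom_fun_simps(8)[OF ring_hom_pconst])
  have inv: "shift s d = d" for s
  proof -
    \<comment> \<open>The matrix of \<open>f\<close> applied to the translation vector, so that
      shift s \<circ> f = f \<circ> shift s'.\<close>
    define s' where "s' = (\<lambda>i. \<Sum>j\<in>UNIV. a i j * s j)"
    have "shift s \<circ> f = f \<circ> shift s'"
    proof (rule alg_hom_eqI)
      show "(shift s \<circ> f) (pvar v) = (f \<circ> shift s') (pvar v)" for v by (simp add: f_simps shift_f s'_def)
    qed (intro alg_hom_comp alg_hom_shift alg_aut_hom[OF f_aut])+
    hence "\<Psi> (shift s \<circ> f) = \<Psi> (f \<circ> shift s')" by (simp only:)
    hence "shift s \<circ> \<Psi> f = \<Psi> f \<circ> shift s'"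
      by (simp only: Psi_comp[OF NAut_of_TAut[OF shift_TAut] fN] Psi_comp[OF fN NAut_of_TAut[OF shift_TAut]] fix_shift)
    hence "(shift s \<circ> \<Psi> f) (pvar i) = (\<Psi> f \<circ> shift s') (pvar i)" by (rule fun_cong)
    hence "shift s (\<Psi> f (pvar i)) = \<Psi> f (pvar i) + pconst (s' i)" by (simp add: Pf_simps)
    thus ?thesis by (simp add: d_def alg_hom_simps[OF alg_hom_shift] shift_f s'_def)
  qed
  have d_const: "d = pconst (coef d 0)"
    by (rule shift_invariant_const[OF inv alg_closed_infinite])
  have "- {0, 1 :: 'a} \<noteq> {}" by (rule infinite_imp_nonempty[OF alg_closed_infinite_Compl]) simp
  then obtain u :: 'a where u: "u \<noteq> 0" "u \<noteq> 1" by blast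
  define D where "D = dil (\<lambda>_ :: 'v. u)"
  have D: "D \<in> NAut" "\<Psi> D = D" "alg_hom D" unfolding D_def using u(1) by (simp_all add: fix_dil)
  have "D \<circ> f = f \<circ> D"
  proof (rule alg_hom_eqI)
    show "(D \<circ> f) (pvar v) = (f \<circ> D) (pvar v)" for v
      by (simp add: D_def a alg_hom_simps[OF alg_hom_dil] f_simps sum_distrib_left mult.left_commute)
  qed (intro alg_hom_comp D(3) alg_aut_hom[OF f_aut])+
  hence "\<Psi> (D \<circ> f) = \<Psi> (f \<circ> D)" by (simp only:)
  hence "D \<circ> \<Psi> f = \<Psi> f \<circ> D" by (simp only: Psi_comp[OF D(1) fN] Psi_comp[OF fN D(1)] D(2))
  hence "(D \<circ> \<Psi> f) (pvar i) = (\<Psi> f \<circ> D) (pvar i)" by (rule fun_cong)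
  hence "D (\<Psi> f (pvar i)) = pconst u * \<Psi> f (pvar i)" by (simp add: D_def Pf_simps)
  from arg_cong[OF this, of "\<lambda>p. coef p 0"] have "coef (\<Psi> f (pvar i)) 0 = u * coef (\<Psi> f (pvar i)) 0"
    by (simp add: D_def coef_dil coef_pconst_mult)
  hence "(u - 1) * coef (\<Psi> f (pvar i)) 0 = 0" by (simp add: algebra_simps)
  hence "coef (\<Psi> f (pvar i)) 0 = 0" using u(2) by simp
  moreover have "coef (pvar j :: ('v, 'a) pol) 0 = 0" for j using mterm_eq_0_iff[of j "1 :: nat"] by (simp add: coef_pvar)
  hence "coef (f (pvar i)) 0 = 0" by (simp add: a lookup_sum coef_pconst_mult)
  ultimately have "coef d 0 = 0" by (simp add: d_def lookup_minus)
  hence "d = 0" using d_const by (simp add: pconst_simps)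
  thus "\<Psi> f (pvar i) = f (pvar i)" by (simp add: d_def)
qed

lemma fix_TAut: "f \<in> TAut \<Longrightarrow> \<Psi> f = f"
proof (induction rule: TAut_induct)
  case (inv f)
  have f: "f \<in> NAut" "finv f \<in> NAut" "f \<in> alg_aut"
    using NAut_of_TAut[OF inv.hyps] NAut_of_TAut[OF TAut_inv[OF inv.hyps]] TAut_aut[OF inv.hyps] by simp_all
  have "f \<circ> \<Psi> (finv f) = \<Psi> (f \<circ> finv f)" using Psi_comp[OF f(1,2)] inv.IH by simp
  also have "\<dots> = f \<circ> finv f" using f(3) by (simp add: Psi_id)
  finally have "finv f \<circ> (f \<circ> \<Psi> (finv f)) = finv f \<circ> (f \<circ> finv f)" by (simp only:)
  thus ?case using f(3) by simp
next
  case (comp f h)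
  thus ?case using Psi_comp[OF NAut_of_TAut NAut_of_TAut, of f h] by (simp only:)
qed (simp_all add: fix_linear fix_elmt)

text \<open>Along \<open>u \<mapsto> s\<^sub>u \<psi> s\<^sub>u\<inverse>\<close>, where \<open>s\<^sub>u\<close> is multiplication by \<open>u\<close>, the coefficients of degree \<open>d\<close> are multiplied
  by \<open>u ^ (d - 1)\<close>. For \<open>\<psi>\<close> equal to the identity up to order \<open>N\<close>, this curve is constant up to
  order \<open>N - 1\<close> at \<open>u = 0\<close>, hence so is its image.\<close>

lemma Psi_order:
  assumes \<psi>: "\<psi> \<in> NAut" "\<And>v. \<psi> (pvar v) - pvar v \<in> ord_ge N" and N: "N \<ge> 2"
  shows "\<Psi> \<psi> (pvar v) - pvar v \<in> ord_ge N"
proof -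
  define s where "s = (\<lambda>u. dil (\<lambda>_ :: 'v. u :: 'a))"
  have s: "s u \<in> NAut" "\<Psi> (s u) = s u" "s u \<in> alg_aut" "finv (s u) = s (inverse u)" if "u \<noteq> 0" for u
    using that by (simp_all add: s_def fix_dil dil_aut finv_dil)
  have me: "mono_eval (\<lambda>_. u) m = u ^ mon_degree m" for u :: 'a and m :: "'v \<Rightarrow>\<^sub>0 nat"
    by (simp add: mono_eval_UNIV mon_degree_def power_sum)
  have conj_coef: "coef ((s u \<circ> f \<circ> finv (s u)) (pvar v)) m = inverse u * u ^ mon_degree m * coef (f (pvar v)) m"
    if u: "u \<noteq> 0" and f: "f \<in> alg_aut" for u f v m
  proof -
    have "(s u \<circ> f \<circ> finv (s u)) (pvar v) = pconst (inverse u) * s u (f (pvar v))"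
      unfolding s(4)[OF u] by (simp add: s_def alg_aut_simps[OF f] alg_hom_simps[OF alg_hom_dil])
    thus ?thesis by (simp add: coef_pconst_mult s_def coef_dil me mult.assoc)
  qed
  \<comment> \<open>Conjugation is undefined at u = 0, but its coefficients extend there, with the
    identity as limit.\<close>
  define C where "C = (\<lambda>u. if u = 0 then id else s u \<circ> \<psi> \<circ> finv (s u))"
  have C_NAut: "C u \<in> NAut" for u unfolding C_def s_def using NAut_dil_conj[OF \<psi>(1)] by simp
  have \<psi>_aut: "\<psi> \<in> alg_aut" by (rule NAut_aut[OF \<psi>(1)])
  \<comment> \<open>Below degree \<open>N\<close> the coefficients are those of the identity. From
    degree \<open>N\<close> on they carry u^(degree - 1), whose exponent is at least N - 1.\<close>
  define H where "H = (\<lambda>v m. [:coef (pvar v) m:] + (if N \<le> mon_degree m then Polynomial.monom (coef (\<psi> (pvar v)) m) (mon_degree m - 1) else 0))"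
  have low: "coef (\<psi> (pvar v)) m = coef (pvar v) m" if "mon_degree m < N" for v m
    using \<psi>(2)[of v] that by (simp add: ord_ge_iff lookup_minus)
  have pv: "coef (pvar v :: ('v, 'a) pol) m = 0" if "mon_degree m \<noteq> 1" for v m using that by (auto simp: coef_pvar)
  have C_coef: "coef (C u (pvar v)) m = poly (H v m) u" for u v m
  proof (cases "u = 0")
    case True
    thus ?thesis using N by (simp add: C_def H_def poly_monom power_0_left)
  next
    case u: False
    show ?thesis
    proof (cases "N \<le> mon_degree m")
      case True
      hence "mon_degree m = Suc (mon_degree m - 1)" using N by simp
      hence "u ^ mon_degree m = u * u ^ (mon_degree m - 1)" by (metis power_Suc)
      thus ?thesis using u True N conj_coef[OF u \<psi>_aut] by (simp add: C_def H_def poly_monom pv)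
    next
      case False
      thus ?thesis using u conj_coef[OF u \<psi>_aut] low[of m v] pv[of m v] by (cases "mon_degree m = 1") (simp_all add: C_def H_def)
    qed
  qed
  have C_fam: "(\<lambda>u. C u (pvar v)) \<in> families (polys (N - 1))" for v
  proof -
    obtain d where d: "\<psi> (pvar v) \<in> deg_le d" using deg_le_ex by meson
    show ?thesis
    proof (rule families_polysI[OF C_coef])
      show "flat (N - 1) (H v m)" for m
        unfolding H_def using N flat_const[of "N - 1" 0] by (intro flat_add flat_const) (auto intro!: flat_monom simp del: flat_const)
      show "C u (pvar v) \<in> deg_le (max 1 d)" for u
        unfolding deg_le_iff C_coef using d by (auto simp: H_def deg_le_iff pv)
    qed
  qed
  have "(\<lambda>u. \<Psi> (C u) (pvar v)) \<in> families (polys (N - 1))"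
    by (rule Psi_families[where C = C, OF C_NAut C_fam])
  hence fam: "\<exists>K. flat (N - 1) K \<and> (\<forall>u. coef (\<Psi> (C u) (pvar v)) m = poly K u)" for m
    unfolding families_def polys_def by (auto simp: fun_eq_iff)
  show ?thesis
    unfolding ord_ge_iff
  proof (intro allI impI)
    fix m :: "'v \<Rightarrow>\<^sub>0 nat" assume m: "mon_degree m < N"
    define b where "b = coef (\<Psi> \<psi> (pvar v)) m"
    obtain K where K: "flat (N - 1) K" "\<And>u. coef (\<Psi> (C u) (pvar v)) m = poly K u" using fam by blast
    have K0: "poly K 0 = coef (pvar v) m" using K(2)[of 0] by (simp add: C_def Psi_id)
    have Ku: "poly K u = inverse u * u ^ mon_degree m * b" if u: "u \<noteq> 0" for u
    proof -
      have fs: "finv (s u) \<in> TAut" unfolding s_def using u by (intro TAut_inv dil_TAut) simp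
      have N1: "s u \<circ> \<psi> \<in> NAut"
      proof -
        have "s u \<circ> \<psi> \<circ> finv (s u) \<in> NAut" using C_NAut[of u] u by (simp add: C_def)
        from NAut_TAut[OF this, of "s u"] have "s u \<circ> \<psi> \<circ> (finv (s u) \<circ> s u) \<in> NAut"
          using u by (simp add: s_def comp_assoc)
        thus ?thesis using s(3)[OF u] by simp
      qed
      have "\<Psi> (C u) = \<Psi> (s u \<circ> \<psi>) \<circ> \<Psi> (finv (s u))"
        using u Psi_comp[OF N1 NAut_of_TAut[OF fs]] by (simp add: C_def)
      also have "\<dots> = s u \<circ> \<Psi> \<psi> \<circ> finv (s u)"
        using Psi_comp[OF s(1)[OF u] \<psi>(1)] s(2)[OF u] fix_TAut[OF fs] by simp
      finally show ?thesis using K(2)[of u] conj_coef[OF u Psi_aut[OF \<psi>(1)], of v m] by (simp add: b_def)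
    qed
    have inf: "infinite (- {0 :: 'a})" by (rule alg_closed_infinite_Compl) simp
    \<comment> \<open>In degree 0 the coefficient is \<open>b\<close> divided by \<open>u\<close>,
      so polynomiality forces b = 0. In degree 1 it is constant and equals its value at u = 0. In
      degree k + 1 < N with k > 0 it is b u^k, which flatness excludes unless b = 0.\<close>
    have "b = coef (pvar v) m"
    proof (cases "mon_degree m")
      case 0
      have "[:0, 1:] * K = [:b:]"
        by (rule poly_eqI_cofinite[OF inf]) (simp add: Ku 0)
      from arg_cong[OF this, of "\<lambda>p. poly p 0"] show ?thesis using 0 pv[of m v] by simp
    next
      case (Suc k)
      have "K = Polynomial.monom b k"
        by (rule poly_eqI_cofinite[OF inf]) (simp add: Ku Suc poly_monom)
      thus ?thesis
      proof (cases "k = 0")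
        case False
        have "Polynomial.coeff K k = 0" using flat_coeff[OF K(1), of k] False m Suc by simp
        thus ?thesis using \<open>K = Polynomial.monom b k\<close> pv[of m v] Suc False by simp
      qed (use K0 in \<open>simp add: poly_monom\<close>)
    qed
    thus "coef (\<Psi> \<psi> (pvar v) - pvar v) m = 0" by (simp add: lookup_minus b_def)
  qed
qed

text \<open>The tame factor is fixed and the other one has an image close to itself, so
  \<open>\<Psi> f\<close> and \<open>f\<close> agree on variables to every order. The offset 2 meets
  the lower bound required by \<open>Psi_order\<close>.\<close>

theorem fix_NAut:
  assumes f: "f \<in> NAut"
  shows "\<Psi> f = f"
proof (rule alg_aut_eqI[OF Psi_aut[OF f] NAut_aut[OF f]])
  fix v
  have ord: "\<Psi> f (pvar v) - f (pvar v) \<in> ord_ge (N + 2)" for N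
  proof -
    obtain \<psi> \<tau> where *: "\<psi> \<in> alg_aut" "\<tau> \<in> TAut" "f = \<psi> \<circ> \<tau>"
      "\<forall>i. \<psi> (pvar i) - pvar i \<in> ideal_power (ideal_span (range pvar)) (N + 2)"
      using f unfolding NAut_def by blast
    have \<psi>_ord: "\<psi> (pvar i) - pvar i \<in> ord_ge (N + 2)" for i using *(4) by (intro ideal_power_ord_ge) blast
    have "f \<circ> finv \<tau> \<in> NAut" by (rule NAut_TAut[OF f TAut_inv[OF *(2)]])
    hence \<psi>: "\<psi> \<in> NAut" using *(3) TAut_aut[OF *(2)] by (simp add: comp_assoc)
    have "\<Psi> f = \<Psi> \<psi> \<circ> \<tau>" unfolding *(3) using Psi_comp[OF \<psi> NAut_of_TAut[OF *(2)]] fix_TAut[OF *(2)] by simp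
    hence "\<Psi> f (pvar v) - f (pvar v) = (\<Psi> \<psi> (\<tau> (pvar v)) - \<tau> (pvar v)) - (\<psi> (\<tau> (pvar v)) - \<tau> (pvar v))"
      by (simp add: *(3))
    also have "\<dots> \<in> ord_ge (N + 2)"
      by (rule ord_ge_diff[OF hom_close[OF alg_aut_hom[OF Psi_aut[OF \<psi>]] Psi_order[OF \<psi> \<psi>_ord]] 
            hom_close[OF alg_aut_hom[OF *(1)] \<psi>_ord]]) simp
    finally show ?thesis .
  qed
  obtain d where d: "\<Psi> f (pvar v) - f (pvar v) \<in> deg_le d" using deg_le_ex by meson
  have "\<Psi> f (pvar v) - f (pvar v) = 0"
    by (rule ord_ge_eq_0[OF d ord_ge_mono[OF ord[of d]]]) simp
  thus "\<Psi> f (pvar v) = f (pvar v)" by simp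
qed

end

theorem (in ind_automorphism) inner:
  assumes card: "CARD('v) \<ge> 2"
  shows "\<exists>g\<in>alg_aut. \<forall>f\<in>NAut. \<Phi> f = g \<circ> f \<circ> finv g"
proof -
  obtain g \<mu> where g: "g \<in> alg_aut" "\<And>v. g (pvar v) \<in> wt (\<mu> v)" using linearisable by blast
  interpret d: diagonalised \<Phi> g \<mu>
  proof
    fix t :: "'v \<Rightarrow> 'a" assume t: "\<forall>v. t v \<noteq> 0"
    have N: "dil t \<in> NAut" by (rule dil_NAut[OF t])
    show "finv g \<circ> \<Phi> (dil t) \<circ> g = dil (\<lambda>v. chr (\<mu> v) t)"
    proof (rule alg_hom_eqI)
      fix v
      have "\<Phi> (dil t) (g (pvar v)) = pconst (chr (\<mu> v) t) * g (pvar v)" using g(2) t unfolding wt_def by blast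
      thus "(finv g \<circ> \<Phi> (dil t) \<circ> g) (pvar v) = dil (\<lambda>v. chr (\<mu> v) t) (pvar v)"
        using g(1) by (simp add: alg_aut_simps[OF alg_aut_inv[OF g(1)]])
    qed (simp_all add: alg_aut_hom alg_aut_comp alg_aut_inv g(1) Phi_aut[OF N])
  qed (rule g)
  obtain g' where g': "g' \<in> alg_aut" "\<And>t. \<forall>v. t v \<noteq> 0 \<Longrightarrow> finv g' \<circ> \<Phi> (dil t) \<circ> g' = dil t"
    "\<And>j c. finv g' \<circ> \<Phi> (elmt j (pconst c)) \<circ> g' = elmt j (pconst c)"
    using d.monomial_conjugation[OF card] by blast
  \<comment> \<open>The same situation with the corrected conjugator, whose weights are the
    coordinate vectors.\<close>
  interpret d': diagonalised \<Phi> g' "\<lambda>v w. if w = v then 1 else 0"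
  proof
    fix t :: "'v \<Rightarrow> 'a" assume t: "\<forall>v. t v \<noteq> 0"
    have "chr (\<lambda>w. if w = v then 1 else 0) t = t v" for v
      by (simp add: chr_def if_distrib[of "\<lambda>x. _ powi x"] cong: if_cong)
    thus "finv g' \<circ> \<Phi> (dil t) \<circ> g' = dil (\<lambda>v. chr (\<lambda>w. if w = v then 1 else 0) t)" using g'(2)[OF t] by simp
  qed (rule g')
  interpret n: normalised \<Phi> g'
    by unfold_locales (simp only: d'.\<Psi>_def g'(3))
  have "\<Phi> f = g' \<circ> f \<circ> finv g'" if "f \<in> NAut" for f
    using d'.Phi_Psi[OF that] n.fix_NAut[OF that] by simp
  thus ?thesis using g'(1) by blast
qed

section \<open>Base change to the algebraic closure\<close>

text \<open>Action on coefficients; it serves for the inclusion into the closure, for the Frobenius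
  map, and for a retraction that is only additive.\<close>

definition cmap :: "('a::zero \<Rightarrow> 'b::zero) \<Rightarrow> ('v, 'a) pol \<Rightarrow> ('v, 'b) pol"
  where "cmap = Poly_Mapping.map"

lemma coef_cmap: "\<theta> 0 = 0 \<Longrightarrow> coef (cmap \<theta> p) m = \<theta> (coef p m)"
  by (simp add: cmap_def Poly_Mapping.map.rep_eq when_def)

lemma cmap_mterm: "\<theta> 0 = 0 \<Longrightarrow> cmap \<theta> (mterm m c) = mterm m (\<theta> c)"
  by (rule poly_mapping_eqI) (simp add: coef_cmap lookup_single when_def)

lemma cmap_0 [simp]: "cmap \<theta> 0 = 0"
  by (simp add: cmap_def map_eq_zero_iff)

lemma cmap_add: "\<theta> 0 = 0 \<Longrightarrow> (\<And>x y. \<theta> (x + y) = \<theta> x + \<theta> y) \<Longrightarrow> cmap \<theta> (p + q) = cmap \<theta> p + cmap \<theta> q"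
  by (rule poly_mapping_eqI) (simp add: coef_cmap lookup_add)

lemma cmap_pconst: "\<theta> 0 = 0 \<Longrightarrow> cmap \<theta> (pconst c) = pconst (\<theta> c)"
  by (simp add: pconst_def cmap_mterm)

lemma cmap_pvar: "\<theta> 0 = 0 \<Longrightarrow> \<theta> 1 = 1 \<Longrightarrow> cmap \<theta> (pvar v) = pvar v"
  by (simp add: pvar_def cmap_mterm)

lemma ring_hom_cmap:
  fixes \<theta> :: "'a::comm_ring_1 \<Rightarrow> 'b::comm_ring_1"
  assumes "ring_hom_fun \<theta>"
  shows "ring_hom_fun (cmap \<theta> :: ('v, 'a) pol \<Rightarrow> _)"
proof -
  note h = ring_hom_fun_simps[OF assms]
  have "cmap \<theta> (p * q) = cmap \<theta> p * cmap \<theta> q" for p q :: "('v, 'a) pol"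
  proof (induction p rule: pol_induct)
    case (mterm m c)
    show ?case
      by (induction q rule: pol_induct) (simp_all add: mult_single cmap_mterm cmap_add distrib_left h)
  qed (simp_all add: cmap_add distrib_right h)
  moreover have "cmap \<theta> 1 = (1 :: ('v, 'b) pol)" using cmap_pconst[of \<theta> 1] by (simp add: h pconst_simps)
  ultimately show ?thesis by (simp add: ring_hom_fun_def cmap_add h)
qed

definition ext :: "('v, 'k::field) pol \<Rightarrow> ('v, 'k alg_closure) pol"
  where "ext = cmap to_ac"

lemma coef_ext: "coef (ext p) m = to_ac (coef p m)"
  by (simp add: ext_def coef_cmap)

lemma ext_eq_iff [simp]: "ext p = ext q \<longleftrightarrow> p = q"
proof
  assume "ext p = ext q"
  hence "to_ac (coef p m) = to_ac (coef q m)" for m by (metis coef_ext)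
  thus "p = q" by (intro poly_mapping_eqI) simp
qed simp

lemma ext_range: "(\<And>m. coef p m \<in> range to_ac) \<Longrightarrow> p \<in> range ext"
proof -
  assume p: "\<And>m. coef p m \<in> range to_ac"
  have "p = ext (cmap of_ac p)"
    by (intro poly_mapping_eqI) (simp add: coef_ext coef_cmap to_ac_of_ac p)
  thus ?thesis by blast
qed

lemma ring_hom_to_ac: "ring_hom_fun to_ac"
  by (simp add: ring_hom_fun_def)

lemma ring_hom_ext: "ring_hom_fun ext"
  unfolding ext_def by (rule ring_hom_cmap[OF ring_hom_to_ac])

lemmas ext_simps = ring_hom_fun_simps[OF ring_hom_ext]

lemma ext_pconst [simp]: "ext (pconst c) = pconst (to_ac c)"
  by (simp add: ext_def cmap_pconst)

lemma ext_pvar [simp]: "ext (pvar v) = pvar v"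
  by (simp add: ext_def cmap_pvar)

lemma base_change_sub: "base_change f = sub (\<lambda>i. ext (f (pvar i)))"
  by (simp add: base_change_def ext_def cmap_def)

lemma alg_hom_base_change [simp]: "alg_hom (base_change f)"
  by (simp add: base_change_sub)

lemma base_change_ext_pvar [simp]: "base_change f (pvar i) = ext (f (pvar i))"
  by (simp add: base_change_sub)

lemma base_change_ext:
  assumes "alg_hom f"
  shows "base_change f (ext p) = ext (f p)"
proof -
  have "(\<lambda>p. base_change f (ext p)) = (\<lambda>p. ext (f p))"
    by (rule ring_hom_pol_eqI)
       (simp_all add: ring_hom_fun_comp ring_hom_ext alg_homD[OF alg_hom_base_change] alg_homD[OF assms])
  thus ?thesis by (rule fun_cong)
qed

lemma base_change_comp: "alg_hom f \<Longrightarrow> alg_hom h \<Longrightarrow> base_change (f \<circ> h) = base_change f \<circ> base_change h"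
  by (rule alg_hom_eqI) (simp_all add: alg_hom_comp base_change_ext)

lemma base_change_id: "base_change id = id"
  by (rule alg_hom_eqI) simp_all

lemma base_change_inj:
  assumes "alg_hom f" "alg_hom h" "base_change f = base_change h"
  shows "f = h"
proof (rule alg_hom_eqI[OF assms(1,2)])
  fix v
  have "ext (f (pvar v)) = ext (h (pvar v))" using assms(3) by (metis base_change_ext_pvar)
  thus "f (pvar v) = h (pvar v)" by simp
qed

lemma base_change_inverse:
  assumes "f \<in> alg_aut"
  shows "base_change f \<in> alg_aut" "finv (base_change f) = base_change (finv f)"
proof -
  have *: "base_change f \<circ> base_change (finv f) = id" "base_change (finv f) \<circ> base_change f = id"
    using assms by (simp_all add: base_change_comp[symmetric] alg_aut_hom alg_aut_inv base_change_id)
  have "base_change f (base_change (finv f) (pvar v)) = pvar v" "base_change (finv f) (base_change f (pvar v)) = pvar v" for v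
    using fun_cong[OF *(1), of "pvar v"] fun_cong[OF *(2), of "pvar v"] by simp_all
  from alg_autI[OF alg_hom_base_change alg_hom_base_change this]
  show "base_change f \<in> alg_aut" "finv (base_change f) = base_change (finv f)" .
qed

lemma var_free_ext: "var_free i P \<Longrightarrow> var_free i (ext P)"
  by (simp add: var_free_def in_keys_iff coef_ext)

lemma base_change_elmt: "base_change (elmt i P) = elmt i (ext P)"
  by (rule alg_hom_eqI) (simp_all add: elmt_pvar ext_simps)

lemma base_change_dil: "base_change (dil t) = dil (\<lambda>v. to_ac (t v))"
  by (rule alg_hom_eqI) (simp_all add: ext_simps)

lemma base_change_TAut: "f \<in> TAut \<Longrightarrow> base_change f \<in> TAut"
proof (induction rule: TAut_induct)
  case (linear f)
  then obtain a where a: "\<And>i. f (pvar i) = (\<Sum>j\<in>UNIV. pconst (a i j) * pvar j)" "f \<in> alg_aut"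
    by (auto simp: linear_auts_def)
  have "base_change f (pvar i) = (\<Sum>j\<in>UNIV. pconst (to_ac (a i j)) * pvar j)" for i
    by (simp add: a ext_simps)
  hence "base_change f \<in> linear_auts" unfolding linear_auts_def using base_change_inverse(1)[OF a(2)]
    by (intro CollectI conjI exI[of _ "\<lambda>i j. to_ac (a i j)"] allI)
  thus ?case unfolding TAut_def by (intro generate.incl) simp
next
  case (elementary i P)
  thus ?case by (simp add: base_change_elmt var_free_ext)
next
  case (comp f h)
  thus ?case using TAut_comp[OF comp.IH] base_change_comp[of f h] by (simp only: alg_aut_hom TAut_aut)
next
  case (inv f)
  thus ?case using base_change_inverse(2)[OF TAut_aut[OF inv.hyps]] TAut_inv by metis
qed

lemma ext_ideal_power:
  assumes "p \<in> ideal_power (ideal_span (range pvar)) N"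
  shows "ext p \<in> ideal_power (ideal_span (range pvar)) N"
  by (rule ideal_power_hom[OF ring_hom_ext _ assms]) (simp add: ideal_span_closed(2)[OF rangeI])

lemma base_change_NAut:
  assumes f: "f \<in> NAut"
  shows "base_change f \<in> NAut"
proof -
  have "\<exists>\<psi>\<in>alg_aut. \<exists>\<tau>\<in>TAut. base_change f = \<psi> \<circ> \<tau> \<and>
      (\<forall>i. \<psi> (pvar i) - pvar i \<in> ideal_power (ideal_span (range pvar)) m)" for m
  proof -
    obtain \<psi> \<tau> where *: "\<psi> \<in> alg_aut" "\<tau> \<in> TAut" "f = \<psi> \<circ> \<tau>"
      "\<forall>i. \<psi> (pvar i) - pvar i \<in> ideal_power (ideal_span (range pvar)) m"
      using f unfolding NAut_def by blast
    have "base_change \<psi> (pvar i) - pvar i \<in> ideal_power (ideal_span (range pvar)) m" for i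
      using ext_ideal_power[OF *(4)[rule_format, of i]] by (simp add: ext_simps)
    moreover have "base_change f = base_change \<psi> \<circ> base_change \<tau>"
      unfolding *(3) by (rule base_change_comp) (simp_all add: * alg_aut_hom TAut_aut)
    ultimately show ?thesis using base_change_inverse(1)[OF *(1)] base_change_TAut[OF *(2)] by blast
  qed
  thus ?thesis using base_change_inverse(1)[OF NAut_aut[OF f]] by (simp add: NAut_def)
qed

section \<open>Regular morphisms over a field\<close>

lemma poly_pol_eval: "poly (pol_eval h a p) u = pol_eval (\<lambda>c. poly (h c) u) (\<lambda>v. poly (a v) u) p"
  by (simp add: pol_eval_def poly_sum poly_prod)

text \<open>Inserting the polynomial coordinates of the curve into the local quotients leaves
  quotients of polynomials in \<open>u\<close>, and polynomial expressions in flat polynomials are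
  flat.\<close>

lemma ind_morphism_curve_regular:
  fixes F :: "('v::finite, 'k::field alg_closure) endo \<Rightarrow> ('v, 'k alg_closure) endo"
  assumes F: "ind_morphism aut_coords NAut_le aut_coords NAut_le F"
  shows "curve_regular F"
  unfolding curve_regular_def
proof (intro allI impI)
  fix D M d and C :: "'k alg_closure \<Rightarrow> ('v, 'k alg_closure) endo"
  assume C: "C ` D \<subseteq> NAut_le d" and q: "\<forall>x. \<exists>q. flat M q \<and> (\<forall>u\<in>D. aut_coords (C u) x = poly q u)"
  from choice[OF q] obtain q where q: "\<And>x. flat M (q x)" "\<And>x u. u \<in> D \<Longrightarrow> aut_coords (C u) x = poly (q x) u" by blast
  obtain j where j: "variety_morphism aut_coords (NAut_le d) aut_coords (NAut_le j) F"
    using F unfolding ind_morphism_def by blast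
  have "\<forall>u\<in>D. F (C u) \<in> NAut_le j" using j C unfolding variety_morphism_def by blast
  moreover have "loc_rational D M (\<lambda>u. aut_coords (F (C u)) x)" for x
    unfolding loc_rational_def
  proof
    fix u assume u: "u \<in> D"
    have "regular_on aut_coords (NAut_le d) (\<lambda>p. aut_coords (F p) x)" using j unfolding variety_morphism_def by blast
    moreover have "C u \<in> NAut_le d" using C u by blast
    ultimately obtain P Q :: "('v \<times> ('v \<Rightarrow>\<^sub>0 nat), 'k) pol" where PQ: "pol_eval to_ac (aut_coords (C u)) Q \<noteq> 0"
      "\<forall>p\<in>NAut_le d. pol_eval to_ac (aut_coords p) Q \<noteq> 0 \<longrightarrow> 
         aut_coords (F p) x = pol_eval to_ac (aut_coords p) P / pol_eval to_ac (aut_coords p) Q"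
      unfolding regular_on_def by blast
    define E where "E = (\<lambda>P :: ('v \<times> ('v \<Rightarrow>\<^sub>0 nat), 'k) pol. pol_eval (\<lambda>c. [:to_ac c:]) q P)"
    have E: "poly (E P) w = pol_eval to_ac (aut_coords (C w)) P" if "w \<in> D" for P w
    proof -
      have "(\<lambda>v. poly (q v) w) = aut_coords (C w)" using q(2)[OF that] by auto
      thus ?thesis by (simp add: E_def poly_pol_eval)
    qed
    have fl: "flat M (E P)" for P unfolding E_def by (intro flat_pol_eval flat_const q(1))
    have "\<forall>w\<in>D. poly (E Q) w \<noteq> 0 \<longrightarrow> aut_coords (F (C w)) x = poly (E P) w / poly (E Q) w"
    proof (intro ballI impI)
      fix w assume w: "w \<in> D" "poly (E Q) w \<noteq> 0"
      have "C w \<in> NAut_le d" using C w by blast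
      from PQ(2)[rule_format, OF this] w(2) show "aut_coords (F (C w)) x = poly (E P) w / poly (E Q) w"
        by (simp add: E[OF w(1)])
    qed
    moreover have "poly (E Q) u \<noteq> 0" using PQ(1) by (simp add: E[OF u])
    ultimately show "\<exists>P Q. flat M P \<and> flat M Q \<and> poly Q u \<noteq> 0 \<and> (\<forall>w\<in>D. poly Q w \<noteq> 0 \<longrightarrow>
        aut_coords (F (C w)) x = poly P w / poly Q w)" using fl by blast
  qed
  ultimately show "(\<exists>j. \<forall>u\<in>D. F (C u) \<in> NAut_le j) \<and> (\<forall>x. loc_rational D M (\<lambda>u. aut_coords (F (C u)) x))" by blast
qed

lemma NAutG_simps: "carrier NAutG = NAut" "f \<otimes>\<^bsub>NAutG\<^esub> h = f \<circ> h"
  by (simp_all add: NAutG_def AutG_def)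

lemma iso_NAutG:
  assumes "F \<in> iso NAutG NAutG"
  shows "f \<in> NAut \<Longrightarrow> h \<in> NAut \<Longrightarrow> F (f \<circ> h) = F f \<circ> F h" "bij_betw F NAut NAut"
  using assms unfolding iso_def hom_def by (simp_all add: NAutG_simps)

text \<open>The hypotheses say that \<open>z\<close> behaves like g(x_k) under the conjugated
  translations with parameters in \<open>U\<close> and one homothety. Then the preimage of
  \<open>z\<close> differs from x_k by a polynomial that is invariant under enough translations to
  be constant, and the homothety with u different from 1 kills a constant.\<close>

lemma translation_dilation_rigid:
  fixes g :: "('v::finite, 'a::alg_closed_field) endo"
  assumes g: "g \<in> alg_aut" and U: "infinite U" "\<And>u n. u \<in> U \<Longrightarrow> u ^ n \<in> U"
    and tr: "\<And>j c. c \<in> U \<Longrightarrow> g (elmt j (pconst c) (finv g z)) = z + (if j = k then pconst c else 0)"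
    and dl: "u \<noteq> 1" "g (dil (\<lambda>_. u) (finv g z)) = pconst u * z"
  shows "z = g (pvar k)"
proof -
  define e where "e = finv g z - pvar k"
  note gi_simps = alg_aut_simps[OF alg_aut_inv[OF g]]
  have e1: "elmt j (pconst c) e = e" if "c \<in> U" for j c
  proof -
    have "elmt j (pconst c) (finv g z) = finv g (z + (if j = k then pconst c else 0))"
      using g tr[OF that, of j] by (metis alg_aut_inv_simps(2))
    thus ?thesis by (simp add: e_def alg_hom_simps[OF alg_hom_elmt] elmt_pvar gi_simps)
  qed
  have e2: "dil (\<lambda>_. u) e = pconst u * e"
  proof -
    have "dil (\<lambda>_. u) (finv g z) = finv g (pconst u * z)" using g dl(2) by (metis alg_aut_inv_simps(2))
    thus ?thesis by (simp add: e_def alg_hom_simps[OF alg_hom_dil] gi_simps right_diff_distrib)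
  qed
  have "e = pconst (coef e 0)"
  proof (rule shift_invariant_const[OF _ U(1)])
    fix w :: 'a and n :: "'v \<Rightarrow> nat" assume w: "w \<in> U"
    have "shift (\<lambda>v. if v \<in> S then w ^ n v else 0) e = e" if "finite S" for S
      using that
    proof induction
      case empty show ?case by (simp add: shift_0)
    next
      case (insert x S)
      have "shift (\<lambda>v. if v \<in> insert x S then w ^ n v else 0) = 
          elmt x (pconst (w ^ n x)) \<circ> shift (\<lambda>v. if v \<in> S then w ^ n v else 0)"
        unfolding shift_elmt shift_comp by (rule arg_cong[of _ _ shift]) (use insert in auto)
      thus ?case using insert e1[OF U(2)[OF w]] by simp
    qed
    from this[of UNIV] show "shift (\<lambda>v. w ^ n v) e = e" by simp
  qed
  then obtain c where c: "e = pconst c" by blast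
  have "pconst c = (pconst (u * c) :: ('v, 'a) pol)" using e2 by (simp add: c alg_hom_simps[OF alg_hom_dil] pconst_simps)
  hence "c = u * c" by (simp only: pconst_eq_iff)
  hence "(u - 1) * c = 0" by (simp add: algebra_simps)
  hence "e = 0" using dl(1) by (simp add: c pconst_simps)
  thus ?thesis using g by (simp add: e_def) (metis alg_aut_inv_simps(1))
qed

section \<open>Linear retraction onto the ground field, and finite fields\<close>

text \<open>The vector 1 is extended to a basis of the closure over the ground field. The map
  obtained is linear, not multiplicative.\<close>

lemma retraction:
  "\<exists>\<pi> :: 'k::field alg_closure \<Rightarrow> 'k. \<pi> 1 = 1 \<and> (\<forall>x y. \<pi> (x + y) = \<pi> x + \<pi> y) \<and> (\<forall>c x. \<pi> (to_ac c * x) = c * \<pi> x)"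
proof -
  interpret vs: vector_space_pair "\<lambda>(c :: 'k) (x :: 'k alg_closure). to_ac c * x" "(*) :: 'k \<Rightarrow> 'k \<Rightarrow> 'k"
    by unfold_locales (simp_all add: algebra_simps)
  have "vs.vs1.independent {1}" by simp
  from vs.linear_independent_extend[OF this, of "\<lambda>_. 1"] obtain \<pi> :: "'k alg_closure \<Rightarrow> 'k" 
    where \<pi>: "Vector_Spaces.linear (\<lambda>c x. to_ac c * x) (*) \<pi>" "\<pi> 1 = 1" by auto
  interpret l: Vector_Spaces.linear "\<lambda>(c :: 'k) (x :: 'k alg_closure). to_ac c * x" "(*) :: 'k \<Rightarrow> 'k \<Rightarrow> 'k" \<pi> by fact
  show ?thesis using \<pi>(2) l.add l.scale by blast
qed

text \<open>Multiplication by a nonzero \<open>x\<close> permutes the nonzero elements; comparing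
  their products gives x^(q - 1) = 1.\<close>

lemma finite_field_power_card:
  fixes x :: "'k::field"
  assumes fin: "finite (UNIV :: 'k set)"
  shows "x ^ CARD('k) = x"
proof (cases "x = 0")
  case True
  thus ?thesis using fin by (simp add: power_0_left)
next
  case False
  let ?S = "UNIV - {0 :: 'k}"
  have "bij_betw ((*) x) ?S ?S"
    by (rule bij_betwI[of _ _ _ "(*) (inverse x)"]) (use False in auto)
  hence "(\<Prod>y\<in>?S. x * y) = (\<Prod>y\<in>?S. y)" by (rule prod.reindex_bij_betw)
  hence "x ^ card ?S * (\<Prod>y\<in>?S. y) = 1 * (\<Prod>y\<in>?S. y)" by (simp add: prod.distrib)
  moreover have "(\<Prod>y\<in>?S. y) \<noteq> 0" using fin by simp
  ultimately have 1: "x ^ card ?S = 1" by (simp only: mult_cancel_right) simp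
  have "CARD('k) = Suc (card ?S)" by (rule card.remove[OF fin UNIV_I])
  hence "x ^ CARD('k) = x * x ^ card ?S" by (simp only: power_Suc)
  thus ?thesis unfolding 1 by (simp only: mult_1_right)
qed

text \<open>The polynomial \<open>(X + 1)\<^sup>q - X\<^sup>q - 1\<close> has degree less than \<open>q\<close> and vanishes on the field with \<open>q\<close>
  elements, so the intermediate binomial coefficients are zero in it.\<close>

lemma finite_field_power_card_add:
  fixes x y :: "'k::field alg_closure"
  assumes fin: "finite (UNIV :: 'k set)"
  shows "(x + y) ^ CARD('k) = x ^ CARD('k) + y ^ CARD('k)"
proof -
  let ?q = "CARD('k)"
  have q0: "?q > 0" using fin by (simp add: card_gt_0_iff)
  define p :: "'k poly" where "p = (\<Sum>i\<in>{1..<?q}. Polynomial.monom (of_nat (?q choose i)) i)"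
  have split: "(\<Sum>i\<le>?q. f i) = f 0 + (\<Sum>i\<in>{1..<?q}. f i) + f ?q" for f :: "nat \<Rightarrow> 'c::comm_monoid_add"
  proof -
    have "{..?q} = insert 0 (insert ?q {1..<?q})" using q0 by auto
    thus ?thesis using q0 by (simp add: add_ac)
  qed
  have "poly p a = 0" for a
  proof -
    have "(a + 1) ^ ?q = 1 + poly p a + a ^ ?q"
      unfolding binomial_ring split by (simp add: p_def poly_sum poly_monom)
    thus ?thesis by (simp add: finite_field_power_card[OF fin])
  qed
  hence "{a. poly p a = 0} = UNIV" by auto
  moreover have "Polynomial.degree p < ?q"
    unfolding p_def using q0 by (intro degree_sum_less) (auto intro: le_less_trans[OF degree_monom_le])
  ultimately have "p = 0" using card_poly_roots_bound[of p] by fastforce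
  have "of_nat (?q choose i) = (0 :: 'k alg_closure)" if "i \<in> {1..<?q}" for i
  proof -
    have "Polynomial.coeff p i = of_nat (?q choose i)" using that by (simp add: p_def coeff_sum coeff_monom)
    hence "to_ac (of_nat (?q choose i) :: 'k) = 0" using \<open>p = 0\<close> by simp
    thus ?thesis by simp
  qed
  thus ?thesis unfolding binomial_ring split by simp
qed

text \<open>The polynomial X^q - X has at most q roots, and the q elements of the ground field are
  roots already.\<close>

lemma finite_field_fixed:
  fixes x :: "'k::field alg_closure"
  assumes fin: "finite (UNIV :: 'k set)" and x: "x ^ CARD('k) = x"
  shows "x \<in> range to_ac"
proof -
  let ?q = "CARD('k)"
  define p :: "'k alg_closure poly" where "p = Polynomial.monom 1 ?q - Polynomial.monom 1 1"
  have "\<exists>a :: 'k. a \<noteq> 0" using one_neq_zero by blast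
  have "card {0, 1 :: 'k} \<le> ?q" using fin by (intro card_mono) auto
  hence q: "?q \<ge> 2" by simp
  have "Polynomial.coeff p ?q = 1" using q by (simp add: p_def coeff_monom)
  hence p0: "p \<noteq> 0" by auto
  have "Polynomial.degree p \<le> ?q" unfolding p_def 
    by (intro degree_diff_le degree_monom_le[THEN order_trans]) (use q in auto)
  hence "card {a. poly p a = 0} \<le> ?q" using card_poly_roots_bound[OF p0] by simp
  moreover have "range to_ac \<subseteq> {a. poly p a = 0}"
    by (auto simp: p_def poly_monom to_ac_power[symmetric] finite_field_power_card[OF fin] simp del: to_ac_power)
  moreover have "card (range (to_ac :: 'k \<Rightarrow> _)) = ?q" by (simp add: card_image inj_to_ac)
  moreover have "finite {a. poly p a = 0}" by (rule poly_roots_finite[OF p0])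
  ultimately have "range to_ac = {a. poly p a = 0}" by (intro card_seteq) auto
  thus ?thesis using x by (simp add: p_def poly_monom)
qed

section \<open>Descent to the ground field\<close>

lemma pol_eval_ring_hom:
  assumes "ring_hom_fun \<sigma>" "\<And>c. \<sigma> (h c) = h c"
  shows "\<sigma> (pol_eval h a p) = pol_eval h (\<lambda>v. \<sigma> (a v)) p"
  by (simp add: pol_eval_def ring_hom_fun_simps[OF assms(1)] assms(2))

text \<open>The local quotients have coefficients in the ground field, so they commute with a field
  endomorphism \<sigma> fixing it. This is how being defined over the ground field is exploited when
  that field is finite.\<close>

lemma regular_galois:
  fixes F :: "('v::finite, 'k::field alg_closure) endo \<Rightarrow> ('v, 'k alg_closure) endo"
  assumes F: "ind_morphism aut_coords NAut_le aut_coords NAut_le F"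
    and \<sigma>: "ring_hom_fun \<sigma>" "\<And>c. \<sigma> (to_ac c) = to_ac c"
    and f: "f \<in> NAut" "f' \<in> NAut" "\<And>v. f' (pvar v) = cmap \<sigma> (f (pvar v))"
  shows "F f' (pvar v) = cmap \<sigma> (F f (pvar v))"
proof (rule poly_mapping_eqI)
  fix m
  note h = ring_hom_fun_simps[OF \<sigma>(1)]
  have "\<forall>v. \<exists>d. f (pvar v) \<in> deg_le d" using deg_le_ex by blast
  from choice[OF this] obtain d where d: "\<And>v. f (pvar v) \<in> deg_le (d v)" by blast
  have dle: "d v \<le> (\<Sum>v\<in>UNIV. d v)" for v by (rule member_le_sum) auto
  have fd: "f (pvar v) \<in> deg_le (\<Sum>v\<in>UNIV. d v)" for v by (rule deg_le_mono[OF d dle])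
  have f'd: "f' (pvar v) \<in> deg_le (\<Sum>v\<in>UNIV. d v)" for v
    using fd[of v] unfolding deg_le_iff f(3) by (simp add: coef_cmap h)
  have A: "f \<in> NAut_le (\<Sum>v\<in>UNIV. d v)" "f' \<in> NAut_le (\<Sum>v\<in>UNIV. d v)"
    using f fd f'd unfolding NAut_le_def deg_le_def by blast+
  have coords: "aut_coords f' = (\<lambda>x. \<sigma> (aut_coords f x))"
    by (auto simp: aut_coords_def f(3) coef_cmap h)
  obtain j where "variety_morphism aut_coords (NAut_le (\<Sum>v\<in>UNIV. d v)) aut_coords (NAut_le j) F"
    using F unfolding ind_morphism_def by blast
  hence "regular_on aut_coords (NAut_le (\<Sum>v\<in>UNIV. d v)) (\<lambda>p. aut_coords (F p) (v, m))" unfolding variety_morphism_def by blast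
  then obtain P Q :: "('v \<times> ('v \<Rightarrow>\<^sub>0 nat), 'k) pol" where PQ: "pol_eval to_ac (aut_coords f) Q \<noteq> 0"
      "\<forall>p\<in>NAut_le (\<Sum>v\<in>UNIV. d v). pol_eval to_ac (aut_coords p) Q \<noteq> 0 \<longrightarrow> 
         aut_coords (F p) (v, m) = pol_eval to_ac (aut_coords p) P / pol_eval to_ac (aut_coords p) Q"
    using A(1) unfolding regular_on_def by blast
  have E: "pol_eval to_ac (aut_coords f') R = \<sigma> (pol_eval to_ac (aut_coords f) R)" for R
    unfolding coords by (rule pol_eval_ring_hom[OF \<sigma>, symmetric])
  have nz: "\<sigma> x \<noteq> 0" if "x \<noteq> 0" for x
  proof
    assume "\<sigma> x = 0"
    hence "\<sigma> (x * inverse x) = 0" by (simp only: h(4) mult_zero_left)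
    thus False using that by (simp add: h)
  qed
  have div: "\<sigma> (x / y) = \<sigma> x / \<sigma> y" if "y \<noteq> 0" for x y
  proof -
    have "\<sigma> (x / y) * \<sigma> y = \<sigma> x" using that by (simp add: h(4)[symmetric])
    thus ?thesis using nz[OF that] by (simp add: field_simps)
  qed
  have "aut_coords (F f') (v, m) = \<sigma> (aut_coords (F f) (v, m))"
    using PQ(2)[rule_format, OF A(1) PQ(1)] PQ(2)[rule_format, OF A(2)] nz[OF PQ(1)] div[OF PQ(1)] by (simp only: E simp_thms not_False_eq_True)
  thus "coef (F f' (pvar v)) m = coef (cmap \<sigma> (F f (pvar v))) m" by (simp add: aut_coords_def coef_cmap h)
qed

text \<open>An endomorphism extended from the ground field sends monomials to polynomials with
  rational coefficients, so linearity of \<pi> over the ground field is enough.\<close>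

lemma cmap_base_change:
  assumes f: "alg_hom f" and \<pi>: "\<And>x y. \<pi> (x + y) = \<pi> x + \<pi> y" "\<And>c x. \<pi> (to_ac c * x) = to_ac c * \<pi> x"
  shows "base_change f (cmap \<pi> p) = cmap \<pi> (base_change f p)"
proof -
  have \<pi>0: "\<pi> 0 = 0" using \<pi>(2)[of 0 0] by simp
  note bc = alg_hom_simps[OF alg_hom_base_change[of f]]
  show ?thesis
  proof (induction p rule: pol_induct)
    case (mterm m c)
    have *: "base_change f (mterm m d) = pconst d * ext (f (mterm m 1))" for d
    proof -
      have "mterm m d = pconst d * ext (mterm m 1)" by (simp add: ext_def cmap_mterm pconst_mult_single)
      thus ?thesis by (simp add: bc base_change_ext[OF f])
    qed
    have "cmap \<pi> (pconst c * ext r) = pconst (\<pi> c) * ext r" for r :: "('a, 'b) pol"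
      by (rule poly_mapping_eqI)
         (use \<pi>(2) in \<open>simp add: coef_cmap \<pi>0 coef_pconst_mult coef_ext mult.commute[of _ "to_ac _"]\<close>)
    thus ?case unfolding cmap_mterm[of \<pi>, OF \<pi>0] * by simp
  qed (simp_all add: bc cmap_add \<pi>0 \<pi>)
qed

theorem theorem1p1:
  fixes \<phi> :: "('n::finite, 'k::field) endo \<Rightarrow> ('n, 'k) endo"
  assumes "CARD('n) \<ge> 3"
    and "ind_scheme_automorphism \<phi>"
  shows "\<exists>g\<in>carrier AutG. \<forall>f\<in>NAut. \<phi> f = g \<otimes>\<^bsub>AutG\<^esub> f \<otimes>\<^bsub>AutG\<^esub> inv\<^bsub>AutG\<^esub> g"
proof -
  obtain \<Phi> :: "('n, 'k alg_closure) endo \<Rightarrow> ('n, 'k alg_closure) endo"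
    where \<phi>: "\<phi> \<in> iso NAutG NAutG" and \<Phi>: "\<Phi> \<in> iso NAutG NAutG"
    and reg: "ind_morphism aut_coords NAut_le aut_coords NAut_le \<Phi>"
    and reg': "ind_morphism aut_coords NAut_le aut_coords NAut_le (inv_into NAut \<Phi>)"
    and compat: "\<And>f. f \<in> NAut \<Longrightarrow> \<Phi> (base_change f) = base_change (\<phi> f)"
    using assms(2) unfolding ind_scheme_automorphism_def by blast
  interpret ind_automorphism \<Phi>
    by unfold_locales (simp_all add: iso_NAutG[OF \<Phi>] ind_morphism_curve_regular reg reg')
  have "2 \<le> CARD('n)" using assms(1) by simp
  from inner[OF this] obtain g where g: "g \<in> alg_aut" and conj: "\<And>f. f \<in> NAut \<Longrightarrow> \<Phi> f = g \<circ> f \<circ> finv g" by blast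
  have \<phi>_NAut: "\<phi> f \<in> NAut" if "f \<in> NAut" for f
    using iso_NAutG(2)[OF \<phi>] that by (auto simp: bij_betw_def)
  note g_simps = alg_aut_simps[OF g]
  obtain \<pi>' :: "'k alg_closure \<Rightarrow> 'k" where \<pi>': "\<pi>' 1 = 1" "\<forall>x y. \<pi>' (x + y) = \<pi>' x + \<pi>' y" "\<forall>c x. \<pi>' (to_ac c * x) = c * \<pi>' x"
    using retraction by blast
  define \<pi> where "\<pi> = (\<lambda>x. to_ac (\<pi>' x))"
  have \<pi>: "\<pi> (x + y) = \<pi> x + \<pi> y" "\<pi> (to_ac c * x) = to_ac c * \<pi> x" "\<pi> x \<in> range to_ac" for x y c
    using \<pi>' by (simp_all add: \<pi>_def)
  have \<pi>_to_ac: "\<pi> (to_ac c) = to_ac c" for c using \<pi>(2)[of c 1] \<pi>'(1) by (simp add: \<pi>_def)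
  have \<pi>0: "\<pi> 0 = 0" using \<pi>_to_ac[of 0] by simp
  have elm: "\<Phi> (elmt j (pconst c)) (g (pvar k)) = g (pvar k) + (if j = k then pconst c else 0)" for j k c
    using g by (simp add: conj elmt_NAut elmt_pvar g_simps)
  have dl: "\<Phi> (dil (\<lambda>_. u)) (g (pvar k)) = pconst u * g (pvar k)" if "u \<noteq> 0" for u k
    using g that by (simp add: conj dil_NAut g_simps)
  \<comment> \<open>The conjugator was found over the closure. Applying a coefficient map that
    respects the ground field to its coordinates preserves the relations of
    \<open>translation_dilation_rigid\<close>, so uniqueness makes them rational.\<close>
  have "g (pvar k) \<in> range ext" for k
  proof (cases "finite (UNIV :: 'k set)")
    case False
    define z where "z = cmap \<pi> (g (pvar k))"
    \<comment> \<open>On rational automorphisms \<Phi> takes rational values, and these commute with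
      \<pi> on coefficients.\<close>
    have bc: "\<Phi> (base_change f) z = cmap \<pi> (\<Phi> (base_change f) (g (pvar k)))" if "f \<in> NAut" for f
      unfolding z_def compat[OF that]
      by (rule cmap_base_change[OF alg_aut_hom[OF NAut_aut[OF \<phi>_NAut[OF that]]] \<pi>(1,2)])
    have "infinite (UNIV - {0, 1 :: 'k})" using False by simp
    from infinite_imp_nonempty[OF this] obtain u :: 'k where u: "u \<noteq> 0" "u \<noteq> 1" by blast
    have "z = g (pvar k)"
    proof (rule translation_dilation_rigid[OF g, of "range to_ac"])
      show "infinite (range (to_ac :: 'k \<Rightarrow> _))" using False finite_imageD[OF _ inj_to_ac] by blast
      show "c ^ n \<in> range to_ac" if "c \<in> range to_ac" for c :: "'k alg_closure" and n
        using that by (auto simp flip: to_ac_power)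
      show "g (elmt j (pconst c) (finv g z)) = z + (if j = k then pconst c else 0)" if "c \<in> range to_ac" for j c
      proof -
        from that obtain c' where c': "c = to_ac c'" by blast
        have "\<Phi> (elmt j (pconst c)) z = cmap \<pi> (g (pvar k) + (if j = k then pconst c else 0))"
          using bc[OF NAut_of_TAut[OF elmt_TAut[OF var_free_pconst]], of j c'] by (simp add: base_change_elmt elm c')
        thus ?thesis by (simp add: conj elmt_NAut cmap_add \<pi>0 \<pi> z_def cmap_pconst c' \<pi>_to_ac)
      qed
      show "to_ac u \<noteq> 1" using u(2) to_ac_eq_iff[of u 1] by simp
      have "\<Phi> (dil (\<lambda>_. to_ac u)) z = cmap \<pi> (pconst (to_ac u) * g (pvar k))"
        using bc[OF NAut_of_TAut[OF dil_TAut], of "\<lambda>_. u"] u(1) by (simp add: base_change_dil dl)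
      also have "\<dots> = pconst (to_ac u) * z"
        by (rule poly_mapping_eqI) (simp add: coef_cmap \<pi>0 coef_pconst_mult z_def \<pi>)
      finally show "g (dil (\<lambda>_. to_ac u) (finv g z)) = pconst (to_ac u) * z" using u(1) by (simp add: conj dil_NAut)
    qed
    hence "coef (g (pvar k)) m = \<pi> (coef (g (pvar k)) m)" for m using coef_cmap[of \<pi>, OF \<pi>0] by (metis z_def)
    thus ?thesis using \<pi>(3) by (intro ext_range) metis
  next
    case fin: True
    let ?q = "CARD('k)"
    have q: "?q > 0" using fin by (simp add: card_gt_0_iff)
    define \<sigma> where "\<sigma> = (\<lambda>x :: 'k alg_closure. x ^ ?q)"
    have \<sigma>: "ring_hom_fun \<sigma>" "\<sigma> (to_ac c) = to_ac c" for c
      by (simp_all add: ring_hom_fun_def \<sigma>_def finite_field_power_card_add[OF fin] power_mult_distrib 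
            to_ac_power[symmetric] finite_field_power_card[OF fin] del: to_ac_power)
    note h = ring_hom_fun_simps[OF \<sigma>(1)]
    note hc = ring_hom_fun_simps[OF ring_hom_cmap[OF \<sigma>(1)]]
    have \<sigma>_surj: "\<exists>x. \<sigma> x = y" for y unfolding \<sigma>_def by (rule nth_root_exists[OF q])
    define z where "z = cmap \<sigma> (g (pvar k))"
    \<comment> \<open>The image of a Frobenius twist is the Frobenius twist of the image. Both sides
      are semilinear ring homomorphisms, so constants and variables suffice.\<close>
    have comm: "\<Phi> f' (cmap \<sigma> p) = cmap \<sigma> (\<Phi> f p)" 
      if f: "f \<in> NAut" "f' \<in> NAut" "\<And>v. f' (pvar v) = cmap \<sigma> (f (pvar v))" for f f' p
    proof -
      have F: "alg_hom (\<Phi> f)" "alg_hom (\<Phi> f')" using f Phi_aut alg_aut_hom by blast+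
      have "(\<lambda>p. \<Phi> f' (cmap \<sigma> p)) = (\<lambda>p. cmap \<sigma> (\<Phi> f p))"
        by (rule ring_hom_pol_eqI)
           (simp_all add: ring_hom_fun_comp[OF alg_homD(1)[OF F(2)] ring_hom_cmap[OF \<sigma>(1)]] 
              ring_hom_fun_comp[OF ring_hom_cmap[OF \<sigma>(1)] alg_homD(1)[OF F(1)]]
              cmap_pconst cmap_pvar h alg_homD(2)[OF F(1)] alg_homD(2)[OF F(2)] regular_galois[OF reg \<sigma> f])
      thus ?thesis by (rule fun_cong)
    qed
    \<comment> \<open>The factor of the homothety is taken in the closure, as the ground field may
      consist of 0 and 1 only.\<close>
    have "- {0, 1 :: 'k alg_closure} \<noteq> {}" by (rule infinite_imp_nonempty[OF alg_closed_infinite_Compl]) simp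
    then obtain w :: "'k alg_closure" where w: "w \<noteq> 0" "w \<noteq> 1" by blast
    have "z = g (pvar k)"
    proof (rule translation_dilation_rigid[OF g, of UNIV])
      show "infinite (UNIV :: 'k alg_closure set)" by (rule alg_closed_infinite)
      show "g (elmt j (pconst c) (finv g z)) = z + (if j = k then pconst c else 0)" for j c
      proof -
        \<comment> \<open>Every element of the closure is a q-th power, so every translation is a
          Frobenius twist of a translation.\<close>
        obtain c' where c': "\<sigma> c' = c" using \<sigma>_surj by blast
        have "\<Phi> (elmt j (pconst c)) z = cmap \<sigma> (\<Phi> (elmt j (pconst c')) (g (pvar k)))"
          unfolding z_def by (rule comm) (simp_all add: elmt_NAut elmt_pvar hc cmap_pvar cmap_pconst h c')
        also have "\<dots> = z + (if j = k then pconst c else 0)"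
          by (simp add: elm hc cmap_pconst h c' z_def)
        finally show ?thesis by (simp add: conj elmt_NAut)
      qed
      obtain u where u: "\<sigma> u = w" using \<sigma>_surj by blast
      have u0: "u \<noteq> 0" using u w(1) h(1) by auto
      have "\<Phi> (dil (\<lambda>_. w)) z = cmap \<sigma> (\<Phi> (dil (\<lambda>_. u)) (g (pvar k)))"
        unfolding z_def by (rule comm) (use u0 w in \<open>simp_all add: dil_NAut hc cmap_pvar cmap_pconst h u\<close>)
      also have "\<dots> = pconst w * z" using u0 by (simp add: dl hc cmap_pconst h u z_def)
      finally show "g (dil (\<lambda>_. w) (finv g z)) = pconst w * z" using w(1) by (simp add: conj dil_NAut)
    qed (simp_all add: w)
    hence "coef (g (pvar k)) m ^ ?q = coef (g (pvar k)) m" for m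
      using coef_cmap[of \<sigma> "g (pvar k)" m, OF h(1)] by (simp add: z_def \<sigma>_def)
    thus ?thesis by (intro ext_range finite_field_fixed[OF fin])
  qed
  hence "\<forall>k. \<exists>G. g (pvar k) = ext G" by blast
  from choice[OF this] obtain G where G: "\<And>k. g (pvar k) = ext (G k)" by blast
  define g0 where "g0 = sub G"
  have g0: "alg_hom g0" by (simp add: g0_def)
  have bc_g0: "base_change g0 = g"
    by (rule alg_hom_eqI) (simp_all add: alg_aut_hom[OF g] g0_def G)
  have g_ext: "g (ext p) = ext (g0 p)" for p using base_change_ext[OF g0, of p] by (simp only: bc_g0)
  have "inj g0"
  proof (rule injI)
    fix p p' assume "g0 p = g0 p'"
    hence "finv g (g (ext p)) = finv g (g (ext p'))" by (simp only: g_ext)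
    thus "p = p'" using g by simp
  qed
  moreover have "surj g0"
    unfolding surj_def
  proof
    fix p
    define z where "z = finv g (ext p)"
    have gz: "g z = ext p" using g by (simp add: z_def)
    \<comment> \<open>\<pi> commutes with \<open>g\<close> and fixes the rational polynomial g z;
      injectivity of \<open>g\<close> then makes the preimage \<open>z\<close> rational.\<close>
    have "g (cmap \<pi> z) = cmap \<pi> (ext p)" using cmap_base_change[OF g0 \<pi>(1,2), of z] by (simp only: bc_g0 gz)
    also have "cmap \<pi> (ext p) = ext p" by (rule poly_mapping_eqI) (simp add: coef_cmap \<pi>0 coef_ext \<pi>_to_ac)
    finally have "finv g (g (cmap \<pi> z)) = z" by (simp only: z_def)
    hence "cmap \<pi> z = z" using g by simp
    hence "coef z m = \<pi> (coef z m)" for m using coef_cmap[of \<pi> z m, OF \<pi>0] by simp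
    hence "coef z m \<in> range to_ac" for m using \<pi>(3) by metis
    then obtain p' where "z = ext p'" using ext_range[of z] by blast
    hence "ext (g0 p') = ext p" using gz g_ext by simp
    thus "\<exists>p'. p = g0 p'" by auto
  qed
  ultimately have g0_aut: "g0 \<in> alg_aut" using g0 by (simp add: alg_aut_iff bij_def)
  have "\<phi> f = g0 \<circ> f \<circ> finv g0" if f: "f \<in> NAut" for f
  proof -
    have hom: "alg_hom f" "alg_hom (\<phi> f)" using f \<phi>_NAut NAut_aut alg_aut_hom by blast+
    have "base_change (\<phi> f) = g \<circ> base_change f \<circ> finv g"
      using compat[OF f] conj[OF base_change_NAut[OF f]] by (simp only:)
    hence "base_change (\<phi> f) \<circ> g = g \<circ> base_change f" using g by (simp add: comp_assoc)
    hence "base_change (\<phi> f \<circ> g0) = base_change (g0 \<circ> f)"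
      by (simp only: base_change_comp[OF hom(2) g0] base_change_comp[OF g0 hom(1)] bc_g0)
    hence "\<phi> f \<circ> g0 = g0 \<circ> f" by (rule base_change_inj[OF alg_hom_comp[OF hom(2) g0] alg_hom_comp[OF g0 hom(1)]])
    hence "\<phi> f \<circ> g0 \<circ> finv g0 = g0 \<circ> f \<circ> finv g0" by (simp only:)
    thus ?thesis using g0_aut by (simp add: comp_assoc)
  qed
  thus ?thesis using g0_aut by (intro bexI[of _ g0]) (simp_all add: inv_AutG)
qed

end
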